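(* Let $n\ge2$, $1<\mathscr{P}\le n-1$, $N=\binom{n}{\mathscr{P}}$, let $0\le l<k\le N$ be integers, $q=k+1$, $p=q-l>1$, and let $\varepsilon>0$. Let $\varphi\in C^2(\mathbb{S}^n)$ be positive and let $u\in C^4(\mathbb{S}^n)$ be a positive admissible solution of $$\frac{\sigma_k(\Lambda(\nabla^2u+uI))}{\sigma_l(\Lambda(\nabla^2u+uI))}=u^{p-1+\varepsilon}(u^2+|\nabla u|^2)^{\frac{k+1-q}{2}}\varphi\quad\text{on }\mathbb{S}^n.$$ Define $\widetilde u=u/\min_{\mathbb{S}^n}u$. Then there exists a positive constant $C''$, depending only on $n,k,l,\mathscr{P}$, $\min_{\mathbb{S}^n}\varphi$ and $\|\varphi\|_{C^2}$, such that $|\nabla^2\widetilde u(x)|\le C''$ for all $x\in\mathbb{S}^n$.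
   Context: $\mathbb{S}^n$ is the unit sphere with its standard metric; $\nabla u$, $\nabla^2u$ are the gradient and covariant Hessian in a local orthonormal frame; $I$ is the identity. Let $\mathbf{I}_1,\dots,\mathbf{I}_N$ enumerate the multi-indices $1\le i_1<\dots<i_{\mathscr{P}}\le n$. For a symmetric matrix $A$ with eigenvalues $\lambda$, $\Lambda(A)=(\Lambda_{\mathbf{I}_1},\dots,\Lambda_{\mathbf{I}_N})$ with $\Lambda_{\mathbf{I}}=\lambda_{i_1}+\dots+\lambda_{i_{\mathscr{P}}}$. $\sigma_m$ is the $m$-th elementary symmetric polynomial, $\sigma_0=1$; $\Gamma_k=\{\mu\in\mathbb{R}^N:\sigma_j(\mu)>0,\ 1\le j\le k\}$. A function $u\in C^2(\mathbb{S}^n)$ is admissible if $\Lambda(\nabla^2u+uI)\in\Gamma_k$ at every point. *)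

theory Defs
  imports "HOL-Analysis.Analysis"
begin

text \<open>The unit sphere S^n is modelled as sphere 0 1 in real^'m with CARD('m) = n+1.
 Functions on S^n are given by extensions to an open neighbourhood of the sphere;
 all quantities below (tangential gradient, covariant Hessian) are intrinsic.\<close>

definition pd :: "((real^'m) \<Rightarrow> real) \<Rightarrow> 'm \<Rightarrow> real^'m \<Rightarrow> real" where
  "pd f i x = deriv (\<lambda>t. f (x + t *\<^sub>R axis i 1)) 0"

primrec Ck :: "nat \<Rightarrow> (real^'m) set \<Rightarrow> ((real^'m) \<Rightarrow> real) \<Rightarrow> bool" where
  "Ck 0 U f = continuous_on U f"
| "Ck (Suc k) U f =
     ((\<forall>x\<in>U. \<forall>i. ((\<lambda>t. f (x + t *\<^sub>R axis i 1)) has_real_derivative pd f i x) (at 0))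
      \<and> (\<forall>i. Ck k U (pd f i)))"

definition CkS :: "nat \<Rightarrow> ((real^'m) \<Rightarrow> real) \<Rightarrow> bool" where
  "CkS k f = (\<exists>U. open U \<and> sphere 0 1 \<subseteq> U \<and> Ck k U f)"

definition egrad :: "((real^'m) \<Rightarrow> real) \<Rightarrow> real^'m \<Rightarrow> real^'m" where
  "egrad f x = (\<chi> i. pd f i x)"

definition sgrad :: "((real^'m) \<Rightarrow> real) \<Rightarrow> real^'m \<Rightarrow> real^'m" where
  "sgrad f x = egrad f x - (egrad f x \<bullet> x) *\<^sub>R x"

text \<open>Covariant Hessian of f on the unit sphere at x, applied to tangent vectors X, Y.\<close>
definition shess :: "((real^'m) \<Rightarrow> real) \<Rightarrow> real^'m \<Rightarrow> real^'m \<Rightarrow> real^'m \<Rightarrow> real" where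
  "shess f x X Y = (\<Sum>i\<in>UNIV. \<Sum>j\<in>UNIV. X$i * Y$j * pd (pd f j) i x) - (egrad f x \<bullet> x) * (X \<bullet> Y)"

definition frame :: "real^'m \<Rightarrow> (nat \<Rightarrow> real^'m) \<Rightarrow> bool" where
  "frame x e = ((\<forall>i<CARD('m) - 1. e i \<bullet> x = 0) \<and>
     (\<forall>i<CARD('m) - 1. \<forall>j<CARD('m) - 1. e i \<bullet> e j = (if i = j then 1 else 0)))"

definition eig :: "((real^'m) \<Rightarrow> real) \<Rightarrow> real^'m \<Rightarrow> nat \<Rightarrow> real" where
  "eig f x = (SOME lam. \<exists>e. frame x e \<and>
     (\<forall>i<CARD('m) - 1. \<forall>j<CARD('m) - 1.
        shess f x (e i) (e j) + f x * (e i \<bullet> e j) = (if i = j then lam i else 0)))"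

definition Pset :: "nat \<Rightarrow> nat \<Rightarrow> nat set set" where
  "Pset n P = {I. I \<subseteq> {..<n} \<and> card I = P}"

text \<open>Lambda(nabla^2 f + f I) at x, as a function on Pset n P.\<close>
definition Lam :: "nat \<Rightarrow> ((real^'m) \<Rightarrow> real) \<Rightarrow> real^'m \<Rightarrow> nat set \<Rightarrow> real" where
  "Lam P f x I = (\<Sum>i\<in>I. eig f x i)"

definition sigma :: "nat \<Rightarrow> ('a \<Rightarrow> real) \<Rightarrow> 'a set \<Rightarrow> real" where
  "sigma m g A = (\<Sum>S\<in>{S. S \<subseteq> A \<and> card S = m}. \<Prod>a\<in>S. g a)"

definition Gamma :: "nat \<Rightarrow> ('a \<Rightarrow> real) \<Rightarrow> 'a set \<Rightarrow> bool" where
  "Gamma k g A = (\<forall>j. 1 \<le> j \<and> j \<le> k \<longrightarrow> sigma j g A > 0)"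

definition admissible :: "nat \<Rightarrow> nat \<Rightarrow> ((real^'m) \<Rightarrow> real) \<Rightarrow> bool" where
  "admissible P k f = (\<forall>x\<in>sphere 0 1. Gamma k (Lam P f x) (Pset (CARD('m) - 1) P))"

definition hnorm :: "((real^'m) \<Rightarrow> real) \<Rightarrow> real^'m \<Rightarrow> real" where
  "hnorm f x = (let e = (SOME e. frame x e) in
     sqrt (\<Sum>i<CARD('m) - 1. \<Sum>j<CARD('m) - 1. (shess f x (e i) (e j))\<^sup>2))"

definition C2norm :: "((real^'m) \<Rightarrow> real) \<Rightarrow> real" where
  "C2norm f = (SUP x\<in>sphere 0 1. \<bar>f x\<bar>) + (SUP x\<in>sphere 0 1. norm (sgrad f x))
     + (SUP x\<in>sphere 0 1. hnorm f x)"

definition smin :: "((real^'m) \<Rightarrow> real) \<Rightarrow> real" where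
  "smin f = (INF x\<in>sphere (0::real^'m) 1. f x)"

end

theory Submission
  imports Defs "HOL-Computational_Algebra.Fundamental_Theorem_Algebra"
begin

text \<open>
  Write \<open>W = \<nabla>\<^sup>2u + u I\<close>, \<open>r = k - l\<close>, \<open>s = \<epsilon> / r\<close>; since \<open>q = k + 1\<close> the gradient factor is trivial and
  the equation is \<open>F(W) = u\<^bsup>1+s\<^esup> \<phi>\<^bsup>1/r\<^esup>\<close> with \<open>F = (\<sigma>\<^sub>k / \<sigma>\<^sub>l)\<^bsup>1/r\<^esup> \<circ> \<Lambda>\<close> concave, monotone and homogeneous of
  degree one. Let \<open>Q\<close> be the maximum of \<open>W(\<xi>,\<xi>) / u\<close> over unit tangent vectors. At a maximum point, with
  \<open>p\<close> the top eigendirection, concavity of \<open>F\<close> and commutation of covariant derivatives give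
  \<open>\<nabla>\<^sub>p\<nabla>\<^sub>p (u\<^bsup>1+s\<^esup> \<phi>\<^bsup>1/r\<^esup>) \<le> (1 + Q) F - 2 Q u tr F'\<close>. The term \<open>Q F\<close> cancels against the left-hand side,
  \<open>tr F' \<ge> F(I)\<close>, and \<open>F / u\<close> is bounded by comparison at the maximum of \<open>u\<close>; what is left is
  \<open>Q \<le> C (1 + |\<nabla> log u|)\<close> with \<open>C\<close> independent of \<open>\<epsilon>\<close>. On a great circle \<open>z = (log u)'\<close> satisfies
  \<open>z' \<le> Q - 1 - z\<^sup>2\<close> and is periodic, so \<open>z\<^sup>2 \<le> Q - 1\<close>. This bounds \<open>Q\<close> and gives the Harnack inequality for \<open>u\<close>;
  \<open>\<sigma>\<^sub>1(\<Lambda>) > 0\<close> then bounds \<open>W\<close> from below.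
\<close>

section \<open>Elementary symmetric polynomials and Newton's inequality\<close>

text \<open>The eigenvalues \<open>eig\<close> are chosen point by point, without order or
  regularity, so F is never differentiated. Its derivative at the maximum point is replaced by the
  nonnegative weights of a linear form that lies above F on the whole cone and touches it there.
  With these weights frozen and W tested on a frame carried along the great circle in direction p,
  one gets a function that lies above u^(1+s) phi^(1/r) and meets it at the maximum point; the
  displayed inequality compares second derivatives at that single point. The curvature terms come
  from the degree-one extension of u restricted to tangent planes, where covariant derivatives
  become ordinary ones. The constant is uniform in epsilon for two reasons. First, F / u = u^s
  phi^(1/r), and W \<le> u I at the maximum of u bounds u^s there, hence everywhere since s \<ge> 0.
  Second, the remaining error terms grow at most like 1 + s, as does the good term s Q + 2 Q /
  kappa, so 1 + s divides out.\<close>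

lemma sigma_0 [simp]: "finite A \<Longrightarrow> sigma 0 g A = 1"
proof -
  assume "finite A"
  then have "{S. S \<subseteq> A \<and> card S = 0} = {{}}"
    by (auto dest: finite_subset)
  then show ?thesis by (simp add: sigma_def)
qed

lemma sigma_empty [simp]: "sigma (Suc m) g {} = 0"
  by (simp add: sigma_def)

lemma sigma_insert:
  assumes "finite A" "a \<notin> A"
  shows "sigma (Suc m) g (insert a A) = sigma (Suc m) g A + g a * sigma m g A"
proof -
  let ?T = "{S. S \<subseteq> A \<and> card S = m}" and ?U = "{S. S \<subseteq> A \<and> card S = Suc m}"
  have fin: "finite ?T" "finite ?U"
    using assms(1) by auto
  have eq: "{S. S \<subseteq> insert a A \<and> card S = Suc m} = ?U \<union> insert a ` ?T"
  proof (intro set_eqI iffI)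
    fix S assume S: "S \<in> {S. S \<subseteq> insert a A \<and> card S = Suc m}"
    show "S \<in> ?U \<union> insert a ` ?T"
    proof (cases "a \<in> S")
      case True
      have "finite S" using S assms(1) finite_subset by (metis (mono_tags) finite_insert mem_Collect_eq)
      then have "S - {a} \<in> ?T" "S = insert a (S - {a})" using S True by auto
      then show ?thesis by blast
    next
      case False
      then show ?thesis using S by blast
    qed
  next
    fix S assume "S \<in> ?U \<union> insert a ` ?T"
    then show "S \<in> {S. S \<subseteq> insert a A \<and> card S = Suc m}"
      using assms finite_subset[OF _ assms(1)] by (auto simp: card_insert_if)
  qed
  have inj: "inj_on (insert a) ?T"
  proof (rule inj_onI)
    fix S T assume "S \<in> ?T" "T \<in> ?T" "insert a S = insert a T"
    then show "S = T" using assms(2) by (metis (mono_tags, lifting) insert_ident mem_Collect_eq subsetD)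
  qed
  have "sigma (Suc m) g (insert a A) = sum (prod g) ?U + sum (prod g) (insert a ` ?T)"
    unfolding sigma_def eq using fin assms(2) by (intro sum.union_disjoint) auto
  also have "sum (prod g) (insert a ` ?T) = (\<Sum>S\<in>?T. g a * prod g S)"
    using inj assms finite_subset[OF _ assms(1)]
    by (subst sum.reindex) (auto intro!: sum.cong prod.insert)
  finally show ?thesis by (simp add: sigma_def sum_distrib_left)
qed

lemma sigma_remove:
  assumes "finite A" "a \<in> A"
  shows "sigma (Suc m) g A = sigma (Suc m) g (A - {a}) + g a * sigma m g (A - {a})"
  using sigma_insert[of "A - {a}" a m g] assms by (simp add: insert_absorb)

lemma sigma_1: "finite A \<Longrightarrow> sigma (Suc 0) g A = sum g A"
  by (induction A rule: finite_induct) (auto simp: sigma_insert)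

lemma sigma_cong:
  assumes "\<And>a. a \<in> A \<Longrightarrow> g a = h a"
  shows "sigma m g A = sigma m h A"
  unfolding sigma_def by (intro sum.cong prod.cong) (use assms in auto)

lemma sigma_scale: "finite A \<Longrightarrow> sigma m (\<lambda>a. c * g a) A = c ^ m * sigma m g A"
proof (induction A arbitrary: m rule: finite_induct)
  case empty
  then show ?case by (cases m) auto
next
  case (insert a A)
  then show ?case by (cases m) (auto simp: sigma_insert algebra_simps)
qed

lemma sigma_one:
  assumes "finite A"
  shows "sigma m (\<lambda>_. 1) A = real (card A choose m)"
  using n_subsets[OF assms, of m] by (simp add: sigma_def)

lemma sigma_reindex:
  assumes "bij_betw p A B"
  shows "sigma m (\<lambda>a. g (p a)) A = sigma m g B"
proof -
  have inj: "inj_on p A" and im: "p ` A = B"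
    using assms by (auto simp: bij_betw_def)
  let ?X = "{S. S \<subseteq> A \<and> card S = m}"
  have injS: "inj_on p S" if "S \<subseteq> A" for S
    using inj that inj_on_subset by blast
  have eq: "{S. S \<subseteq> B \<and> card S = m} = image p ` ?X"
  proof (intro set_eqI iffI)
    fix S assume S: "S \<in> {S. S \<subseteq> B \<and> card S = m}"
    then obtain T where T: "T \<subseteq> A" "S = p ` T"
      using im by (metis (mono_tags, lifting) mem_Collect_eq subset_imageE)
    then have "card T = m"
      using S card_image[OF injS] by auto
    then show "S \<in> image p ` ?X" using T by blast
  next
    fix S assume "S \<in> image p ` ?X"
    then show "S \<in> {S. S \<subseteq> B \<and> card S = m}"
      using im card_image[OF injS] by auto
  qed
  have "inj_on (image p) ?X"
    using inj by (intro inj_onI) (auto dest: inj_on_image_eq_iff)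
  then have "sigma m g B = (\<Sum>S\<in>?X. prod g (p ` S))"
    unfolding sigma_def eq by (subst sum.reindex) auto
  also have "\<dots> = sigma m (\<lambda>a. g (p a)) A"
    unfolding sigma_def using injS by (intro sum.cong refl) (auto simp: prod.reindex)
  finally show ?thesis ..
qed

text \<open>Euler's identity for a form of degree m + 1: \<open>sigma m g (A - {a})\<close> is its
  partial derivative in the variable \<open>g a\<close>.\<close>

lemma sigma_euler:
  assumes "finite A"
  shows "real (Suc m) * sigma (Suc m) g A = (\<Sum>a\<in>A. g a * sigma m g (A - {a}))"
  using assms
proof (induction A arbitrary: m rule: finite_induct)
  case empty
  then show ?case by simp
next
  case (insert b A)
  have rem: "insert b A - {a} = insert b (A - {a})" if "a \<in> A" for a
    using insert.hyps that by auto
  show ?case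
  proof (cases m)
    case 0
    then show ?thesis using insert by (simp add: sigma_1)
  next
    case (Suc j)
    have "(\<Sum>a\<in>insert b A. g a * sigma m g (insert b A - {a}))
        = g b * sigma m g A + (\<Sum>a\<in>A. g a * sigma m g (insert b (A - {a})))"
      using insert.hyps by (simp add: rem cong: sum.cong)
    also have "(\<Sum>a\<in>A. g a * sigma m g (insert b (A - {a})))
        = (\<Sum>a\<in>A. g a * sigma m g (A - {a})) + g b * (\<Sum>a\<in>A. g a * sigma j g (A - {a}))"
      using insert.hyps by (simp add: Suc sigma_insert algebra_simps sum.distrib sum_distrib_left)
    also have "\<dots> = real (Suc m) * sigma (Suc m) g A + g b * (real (Suc j) * sigma (Suc j) g A)"
      by (simp only: insert.IH)
    finally show ?thesis
      using insert.hyps by (simp add: Suc sigma_insert algebra_simps)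
  qed
qed

section \<open>Coefficients of real-rooted polynomials\<close>

lemma coeff_prod_linear_sigma:
  assumes "finite A"
  shows "m \<le> card A \<Longrightarrow> coeff (\<Prod>a\<in>A. [:of_real (g a), 1:] :: complex poly) (card A - m) = of_real (sigma m g A)"
  using assms
proof (induction A arbitrary: m rule: finite_induct)
  case empty
  then show ?case by simp
next
  case (insert a A)
  let ?p = "\<Prod>a\<in>A. [:of_real (g a), 1:] :: complex poly"
  have deg: "coeff ?p (Suc (card A)) = 0"
  proof (rule coeff_eq_0)
    have "degree ?p \<le> (\<Sum>a\<in>A. degree [:of_real (g a), 1 :: complex:])"
      using degree_prod_sum_le[OF insert.hyps(1), of "\<lambda>a. [:of_real (g a), 1 :: complex:]"] by (simp add: o_def)
    then show "degree ?p < Suc (card A)" by simp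
  qed
  have top: "sigma (Suc (card A)) g A = 0"
  proof -
    have "\<not> (S \<subseteq> A \<and> card S = Suc (card A))" for S
      using card_mono[OF insert.hyps(1), of S] by auto
    then have "{S. S \<subseteq> A \<and> card S = Suc (card A)} = {}" by blast
    then show ?thesis unfolding sigma_def by (simp only: sum.empty)
  qed
  have step: "coeff (\<Prod>a\<in>insert a A. [:of_real (g a), 1:] :: complex poly) j
      = of_real (g a) * coeff ?p j + (case j of 0 \<Rightarrow> 0 | Suc i \<Rightarrow> coeff ?p i)" for j
    unfolding prod.insert[OF insert.hyps] by (cases j) simp_all
  show ?case
  proof (cases m)
    case 0
    then show ?thesis using insert.hyps insert.IH[of 0] deg by (simp add: step)
  next
    case (Suc i)
    have i: "i \<le> card A" using insert.prems insert.hyps Suc by simp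
    have c: "card (insert a A) - m = card A - i" using insert.hyps Suc by simp
    show ?thesis
    proof (cases "i = card A")
      case True
      then show ?thesis
        using insert.IH[OF i] insert.hyps top by (simp add: c step Suc sigma_insert)
    next
      case False
      then have "card A - i = Suc (card A - m)" "m \<le> card A" using i Suc by auto
      then show ?thesis
        using insert.IH[OF i] insert.IH[of m] insert.hyps
        by (simp add: c step sigma_insert Suc add.commute)
    qed
  qed
qed

text \<open>Stated for complex polynomials so that a derivative can be split into linear factors.
  The roots are the numbers - x. The value c = 0 is allowed, which keeps the class closed under
  differentiation even when the derivative vanishes.\<close>

definition real_rooted :: "complex poly \<Rightarrow> bool" where
  "real_rooted p = (\<exists>(c::real) A. p = smult (of_real c) (\<Prod>x\<in>#A. [:of_real x, 1:]))"

text \<open>Each summand 1 / (x + z) of the logarithmic derivative has imaginary part of sign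
  opposite to Im z, so the sum cannot vanish off the real axis. Multiplying by Im z treats both
  half-planes at once.\<close>

lemma logderiv_prod_linear:
  fixes z :: complex
  assumes "Im z \<noteq> 0"
  defines "q \<equiv> \<lambda>A. \<Prod>x\<in>#A. [:of_real x, 1:] :: complex poly"
  shows "poly (q A) z \<noteq> 0 \<and> (A \<noteq> {#} \<longrightarrow> Im (poly (pderiv (q A)) z / poly (q A) z) * Im z < 0)"
proof (induction A)
  case empty
  then show ?case by (simp add: q_def)
next
  case (add x A)
  have nz: "of_real x + z \<noteq> 0" using assms(1) by (auto simp: complex_eq_iff)
  have q: "q (add_mset x A) = [:of_real x, 1:] * q A" by (simp add: q_def)
  have eq: "poly (pderiv (q (add_mset x A))) z / poly (q (add_mset x A)) z
      = 1 / (of_real x + z) + poly (pderiv (q A)) z / poly (q A) z"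
    unfolding q pderiv_mult using nz add.IH
    by (simp add: pderiv_pCons field_simps)
  have im: "Im (1 / (of_real x + z)) * Im z < 0"
  proof -
    have "Im (1 / (of_real x + z)) * Im z = - ((Im z)\<^sup>2 / ((x + Re z)\<^sup>2 + (Im z)\<^sup>2))"
      by (simp add: Im_divide power2_eq_square)
    moreover have "0 < (Im z)\<^sup>2 / ((x + Re z)\<^sup>2 + (Im z)\<^sup>2)"
      using assms(1) by (simp add: add_nonneg_pos)
    ultimately show ?thesis by linarith
  qed
  have "Im (poly (pderiv (q A)) z / poly (q A) z) * Im z \<le> 0"
    using add.IH by (cases "A = {#}") (auto simp: q_def)
  moreover have "poly (q (add_mset x A)) z = (of_real x + z) * poly (q A) z"
    by (simp add: q algebra_simps)
  ultimately show ?case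
    unfolding eq using add.IH nz im by (metis add_neg_nonpos distrib_right mult_eq_0_iff plus_complex.sel(2))
qed

text \<open>A non-real root of the derivative would be a zero of the logarithmic derivative. This
  takes the place of Rolle's theorem and avoids counting multiplicities.\<close>

lemma real_rooted_pderiv:
  assumes "real_rooted p"
  shows "real_rooted (pderiv p)"
proof (cases "pderiv p = 0")
  case True
  have "(0 :: complex poly) = smult (of_real 0) (\<Prod>x\<in>#{#}. [:of_real x, 1:])" by simp
  then show ?thesis unfolding real_rooted_def True by blast
next
  case False
  obtain c :: real and A where p: "p = smult (of_real c) (\<Prod>x\<in>#A. [:of_real x, 1:])"
    using assms by (auto simp: real_rooted_def)
  let ?q = "\<Prod>x\<in>#A. [:of_real x, 1:] :: complex poly"
  have c: "c \<noteq> 0" and A: "A \<noteq> {#}"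
    using False p by (auto simp: pderiv_smult)
  have lead: "lead_coeff ?q = 1"
    by (induction A) (auto simp: lead_coeff_mult simp del: mult_pCons_left)
  obtain B where B: "size B = degree (pderiv p)"
    "pderiv p = smult (lead_coeff (pderiv p)) (\<Prod>x\<in>#B. [:-x, 1:])"
    using alg_closed_imp_factorization[OF False] by blast
  have real: "Im x = 0" if "x \<in># B" for x
  proof (rule ccontr)
    assume im: "Im x \<noteq> 0"
    have "poly (pderiv p) x = 0"
      by (subst B(2)) (use that in \<open>auto simp: poly_prod_mset dest!: multi_member_split\<close>)
    then have "poly (pderiv ?q) x = 0"
      using c by (simp add: p pderiv_smult)
    then show False using logderiv_prod_linear[OF im, of A] A by simp
  qed
  obtain d where d: "degree p = Suc d"
    using False by (metis not0_implies_Suc pderiv_eq_0_iff)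
  have "lead_coeff (pderiv p) = of_nat (degree p) * lead_coeff p"
    by (simp only: degree_pderiv coeff_pderiv d diff_Suc_1)
  also have "\<dots> = of_real (real (degree p) * c)"
    using lead by (simp add: p)
  finally have lc: "lead_coeff (pderiv p) = of_real (real (degree p) * c)" .
  have "(\<Prod>x\<in>#B. [:-x, 1:]) = (\<Prod>x\<in>#image_mset (\<lambda>z. - Re z) B. [:of_real x, 1:])"
    unfolding image_mset.compositionality
    by (rule arg_cong[of _ _ prod_mset], rule image_mset_cong)
       (use real in \<open>auto simp: complex_eq_iff\<close>)
  from B(2)[unfolded lc this] show ?thesis unfolding real_rooted_def by blast
qed

text \<open>Differentiating j times moves the three coefficients to positions 0, 1, 2 and produces
  the factors j + 1 and j + 2. There the claim is that c1^2 - 2 c0 c2 is nonnegative; when no root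
  is zero it equals c0^2 times the sum of the inverse squares of the roots. Adding one linear factor
  at a time covers zero roots too.\<close>

lemma real_rooted_newton:
  assumes "real_rooted p"
  shows "(real j + 2) * (Re (coeff p j) * Re (coeff p (j + 2))) \<le> (real j + 1) * (Re (coeff p (j + 1)))\<^sup>2"
  using assms
proof (induction j arbitrary: p)
  case 0
  then obtain c :: real and A where p: "p = smult (of_real c) (\<Prod>x\<in>#A. [:of_real x, 1:])"
    by (auto simp: real_rooted_def)
  let ?q = "\<lambda>A. \<Prod>x\<in>#A. [:of_real x, 1:] :: complex poly"
  have base: "2 * (Re (coeff (?q A) 0) * Re (coeff (?q A) 2)) \<le> (Re (coeff (?q A) 1))\<^sup>2"
  proof (induction A)
    case empty
    then show ?case by (simp add: coeff_pCons)
  next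
    case (add x A)
    let ?c = "\<lambda>i. Re (coeff (?q A) i)"
    have "Re (coeff (?q (add_mset x A)) 0) = x * ?c 0"
      "Re (coeff (?q (add_mset x A)) 1) = x * ?c 1 + ?c 0"
      "Re (coeff (?q (add_mset x A)) 2) = x * ?c 2 + ?c 1"
      by (simp_all add: coeff_pCons numeral_2_eq_2)
    moreover have "2 * (x * a * (x * c + b)) \<le> (x * b + a)\<^sup>2" if "2 * (a * c) \<le> b\<^sup>2" for a b c :: real
    proof -
      have "x\<^sup>2 * (2 * (a * c)) \<le> x\<^sup>2 * b\<^sup>2"
        by (rule mult_left_mono[OF that]) simp
      moreover have "(x * b + a)\<^sup>2 - 2 * (x * a * (x * c + b)) = a\<^sup>2 + (x\<^sup>2 * b\<^sup>2 - x\<^sup>2 * (2 * (a * c)))"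
        by algebra
      moreover have "0 \<le> a\<^sup>2" by simp
      ultimately show ?thesis by linarith
    qed
    ultimately show ?case using add.IH by presburger
  qed
  have "c\<^sup>2 * (2 * (Re (coeff (?q A) 0) * Re (coeff (?q A) 2))) \<le> c\<^sup>2 * (Re (coeff (?q A) 1))\<^sup>2"
    by (rule mult_left_mono[OF base]) simp
  then show ?case by (simp add: p algebra_simps power2_eq_square numeral_2_eq_2)
next
  case (Suc j)
  let ?c = "\<lambda>i. Re (coeff p i)"
  have cd: "Re (coeff (pderiv p) i) = real (Suc i) * ?c (Suc i)" for i
    by (simp add: coeff_pderiv)
  have "(real j + 2) * ((real j + 1) * ?c (j + 1) * ((real j + 3) * ?c (j + 3)))
      \<le> (real j + 1) * ((real j + 2) * ?c (j + 2))\<^sup>2"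
    using Suc.IH[OF real_rooted_pderiv[OF Suc.prems]]
    by (simp add: cd add.commute numeral_3_eq_3 algebra_simps)
  then have "((real j + 1) * (real j + 2)) * ((real j + 3) * (?c (j + 1) * ?c (j + 3)))
      \<le> ((real j + 1) * (real j + 2)) * ((real j + 2) * (?c (j + 2))\<^sup>2)"
    by (simp add: algebra_simps power2_eq_square)
  then have "(real j + 3) * (?c (j + 1) * ?c (j + 3)) \<le> (real j + 2) * (?c (j + 2))\<^sup>2"
    by (rule mult_left_le_imp_le) simp
  then show ?case by (simp add: algebra_simps numeral_3_eq_3)
qed

text \<open>In the product of the factors g a + X, the coefficients in degrees j, j + 1, j + 2 with
  j = card A - (m + 2) are the symmetric functions of index m + 2, m + 1, m. The factor (j + 2) / (j
  + 1) is dropped where the left product is positive; otherwise the square on the right settles the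
  claim.\<close>

lemma sigma_newton:
  assumes "finite A"
  shows "sigma m g A * sigma (m + 2) g A \<le> (sigma (m + 1) g A)\<^sup>2"
proof (cases "m + 2 \<le> card A")
  case True
  let ?p = "\<Prod>a\<in>A. [:of_real (g a), 1:] :: complex poly"
  define j where "j = card A - (m + 2)"
  have "?p = smult (of_real 1) (\<Prod>x\<in>#image_mset g (mset_set A). [:of_real x, 1:])"
    by (simp add: image_mset.compositionality prod_unfold_prod_mset o_def)
  then have rr: "real_rooted ?p" unfolding real_rooted_def by blast
  have j: "card A - (m + 2) = j" "card A - (m + 1) = j + 1" "card A - m = j + 2"
    using True by (auto simp: j_def)
  have c: "Re (coeff ?p j) = sigma (m + 2) g A" "Re (coeff ?p (j + 1)) = sigma (m + 1) g A"
    "Re (coeff ?p (j + 2)) = sigma m g A"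
    using coeff_prod_linear_sigma[OF assms, of "m + 2" g] coeff_prod_linear_sigma[OF assms, of "m + 1" g]
      coeff_prod_linear_sigma[OF assms, of m g] True
    unfolding j by simp_all
  have n: "(real j + 2) * (sigma m g A * sigma (m + 2) g A) \<le> (real j + 1) * (sigma (m + 1) g A)\<^sup>2"
    using real_rooted_newton[OF rr, of j] unfolding c by (simp add: mult.commute)
  show ?thesis
  proof (cases "sigma m g A * sigma (m + 2) g A \<le> 0")
    case True
    then show ?thesis by (meson order_trans zero_le_power2)
  next
    case False
    then have "(real j + 1) * (sigma m g A * sigma (m + 2) g A) \<le> (real j + 1) * (sigma (m + 1) g A)\<^sup>2"
      using n by (simp add: distrib_right)
    then show ?thesis by (rule mult_left_le_imp_le) simp
  qed
next
  case False
  then have "\<not> (S \<subseteq> A \<and> card S = m + 2)" for S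
    using card_mono[OF assms, of S] by auto
  then have "{S. S \<subseteq> A \<and> card S = m + 2} = {}" by blast
  then have "sigma (m + 2) g A = 0" unfolding sigma_def by (simp only: sum.empty)
  then show ?thesis by simp
qed

section \<open>Concavity of quotients on Garding cones\<close>

lemma Gamma_pos:
  assumes "Gamma k g A" "finite A" "j \<le> k"
  shows "sigma j g A > 0"
  using assms by (cases j) (auto simp: Gamma_def)

lemma Gamma_mono: "Gamma k g A \<Longrightarrow> j \<le> k \<Longrightarrow> Gamma j g A"
  by (auto simp: Gamma_def)

text \<open>At the first index where positivity fails on A - {a}, expanding two consecutive
  symmetric functions of A at a gives two positive expressions. Together they force the product of
  the outer two symmetric functions on A - {a} to exceed the square of the middle one, against
  Newton's inequality.\<close>

lemma Gamma_remove:
  assumes "Gamma (Suc k) g A" "finite A" "a \<in> A"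
  shows "Gamma k g (A - {a})"
proof -
  have fin: "finite (A - {a})" using assms(2) by simp
  have "m \<le> k \<Longrightarrow> sigma m g (A - {a}) > 0" for m
  proof (induction m)
    case 0
    then show ?case using fin by simp
  next
    case (Suc m)
    let ?s = "\<lambda>j. sigma j g (A - {a})"
    show ?case
    proof (rule ccontr)
      assume "\<not> 0 < ?s (Suc m)"
      then have le: "?s (Suc m) \<le> 0" by simp
      have p0: "?s m > 0" using Suc by simp
      have p1: "?s (Suc m) + g a * ?s m > 0"
        using Gamma_pos[OF assms(1,2), of "Suc m"] sigma_remove[OF assms(2,3), of m g] Suc.prems
        by simp
      have p2: "?s (Suc (Suc m)) + g a * ?s (Suc m) > 0"
        using Gamma_pos[OF assms(1,2), of "Suc (Suc m)"] sigma_remove[OF assms(2,3), of "Suc m" g] Suc.prems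
        by simp
      have "(- ?s (Suc m)) * (- ?s (Suc m)) \<le> (g a * ?s m) * (- ?s (Suc m))"
        using p1 le by (intro mult_right_mono) auto
      also have "\<dots> = ?s m * (- (g a * ?s (Suc m)))" by simp
      also have "\<dots> < ?s m * ?s (Suc (Suc m))"
        using p0 p2 by (intro mult_strict_left_mono) auto
      finally show False
        using sigma_newton[OF fin, of m g] by (simp add: power2_eq_square)
    qed
  qed
  then show ?thesis by (auto simp: Gamma_def)
qed

section \<open>Supporting linear forms for quotients of symmetric functions\<close>

definition sigma_quot :: "nat \<Rightarrow> ('a \<Rightarrow> real) \<Rightarrow> 'a set \<Rightarrow> real" where
  "sigma_quot j g A = sigma (Suc j) g A / sigma j g A"

text \<open>Euler's identity divided by \<open>sigma (Suc j) g A\<close>, which for every a equals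
  \<open>sigma j g (A - {a})\<close> times the sum of \<open>g a\<close> and the lower quotient on A
  - {a}.\<close>

lemma sigma_quot_rec:
  assumes "Gamma (Suc (Suc j)) g A" "finite A"
  shows "real (Suc (Suc j)) * sigma_quot (Suc j) g A
    = (\<Sum>a\<in>A. g a - (g a)\<^sup>2 / (g a + sigma_quot j g (A - {a})))"
    and "a \<in> A \<Longrightarrow> g a + sigma_quot j g (A - {a}) > 0"
proof -
  have s: "sigma (Suc j) g A > 0" using Gamma_pos[OF assms] by simp
  have t: "sigma j g (A - {a}) > 0" "sigma j g (A - {a}) * (g a + sigma_quot j g (A - {a})) = sigma (Suc j) g A"
    if "a \<in> A" for a
  proof -
    show p: "sigma j g (A - {a}) > 0"
      using Gamma_pos[OF Gamma_remove[OF assms that]] assms(2) by simp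
    show "sigma j g (A - {a}) * (g a + sigma_quot j g (A - {a})) = sigma (Suc j) g A"
      using p sigma_remove[OF assms(2) that, of j g] by (simp add: sigma_quot_def field_simps)
  qed
  show pos: "g a + sigma_quot j g (A - {a}) > 0" if "a \<in> A" for a
    using t[OF that] s by (metis zero_less_mult_pos)
  have alg: "x * (S * (y - x)) / (S * y) = x - x\<^sup>2 / y" if "S > 0" "y > 0" for x y S :: real
    using that by (simp add: field_simps power2_eq_square)
  have "g a * sigma (Suc j) g (A - {a}) / sigma (Suc j) g A = g a - (g a)\<^sup>2 / (g a + sigma_quot j g (A - {a}))"
    if a: "a \<in> A" for a
  proof -
    let ?y = "g a + sigma_quot j g (A - {a})"
    have e: "sigma (Suc j) g (A - {a}) = sigma j g (A - {a}) * (?y - g a)"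
      using t(1)[OF a] by (simp add: sigma_quot_def)
    show ?thesis
      unfolding e t(2)[OF a, symmetric] using t(1)[OF a] pos[OF a] by (rule alg)
  qed
  then show "real (Suc (Suc j)) * sigma_quot (Suc j) g A
    = (\<Sum>a\<in>A. g a - (g a)\<^sup>2 / (g a + sigma_quot j g (A - {a})))"
    using sigma_euler[OF assms(2), of "Suc j" g]
    by (simp add: sigma_quot_def sum_divide_distrib del: of_nat_Suc)
qed

text \<open>A supporting linear form for a degree-one homogeneous function encodes its concavity without
  derivatives; the recursion for \<open>\<sigma>\<^sub>j\<^sub>+\<^sub>1 / \<sigma>\<^sub>j\<close> preserves its existence because
  \<open>x\<^sup>2 / y\<close> is convex and decreasing in \<open>y > 0\<close>.\<close>

lemma sigma_quot_support:
  assumes "finite A" "Gamma (Suc j) g0 A"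
  shows "\<exists>w. (\<forall>g. Gamma (Suc j) g A \<longrightarrow> sigma_quot j g A \<le> (\<Sum>a\<in>A. w a * g a))
    \<and> sigma_quot j g0 A = (\<Sum>a\<in>A. w a * g0 a)"
  using assms
proof (induction j arbitrary: A)
  case 0
  then show ?case
    by (intro exI[of _ "\<lambda>_. 1"]) (simp add: sigma_quot_def sigma_1)
next
  case (Suc j)
  have "\<forall>a\<in>A. \<exists>w. (\<forall>g. Gamma (Suc j) g (A - {a}) \<longrightarrow> sigma_quot j g (A - {a}) \<le> (\<Sum>b\<in>A - {a}. w b * g b))
    \<and> sigma_quot j g0 (A - {a}) = (\<Sum>b\<in>A - {a}. w b * g0 b)"
    using Suc.IH Gamma_remove[OF Suc.prems(2,1)] Suc.prems(1) by blast
  then obtain w where w: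
    "\<And>a g. a \<in> A \<Longrightarrow> Gamma (Suc j) g (A - {a}) \<Longrightarrow> sigma_quot j g (A - {a}) \<le> (\<Sum>b\<in>A - {a}. w a b * g b)"
    "\<And>a. a \<in> A \<Longrightarrow> sigma_quot j g0 (A - {a}) = (\<Sum>b\<in>A - {a}. w a b * g0 b)"
    by metis
  \<comment> \<open>The tangent plane of x^2 / y at (x0, y0) is 2 d x - d^2 y with d = x0 / y0;
    \<open>c\<close> is this slope d at \<open>g0\<close>. \<open>L g a\<close> puts the support of
    the lower quotient in place of that quotient, and \<open>v\<close> collects the coefficient of
    each \<open>g b\<close>: its own term a = b and the weights \<open>w a b\<close> coming from all
    other a.\<close>
  define c where "c a = g0 a / (g0 a + sigma_quot j g0 (A - {a}))" for a
  define L where "L g a = g a - 2 * c a * g a + (c a)\<^sup>2 * (g a + (\<Sum>b\<in>A - {a}. w a b * g b))" for g a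
  define v where "v b = (1 - 2 * c b + (c b)\<^sup>2 + (\<Sum>a\<in>A - {b}. (c a)\<^sup>2 * w a b)) / real (Suc (Suc j))" for b
  have swap: "(\<Sum>a\<in>A. \<Sum>b\<in>A - {a}. F a b) = (\<Sum>b\<in>A. \<Sum>a\<in>A - {b}. F a b)" for F :: "'a \<Rightarrow> 'a \<Rightarrow> real"
  proof -
    have 1: "(\<Sum>b\<in>A - {a}. F a b) = (\<Sum>b\<in>A. if a = b then 0 else F a b)" for a
      using Suc.prems(1) by (intro sum.mono_neutral_cong_left) auto
    have 2: "(\<Sum>a\<in>A - {b}. F a b) = (\<Sum>a\<in>A. if a = b then 0 else F a b)" for b
      using Suc.prems(1) by (intro sum.mono_neutral_cong_left) auto
    show ?thesis unfolding 1 2 by (rule sum.swap)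
  qed
  have Lv: "(\<Sum>a\<in>A. L g a) = real (Suc (Suc j)) * (\<Sum>a\<in>A. v a * g a)" for g
  proof -
    have "real (Suc (Suc j)) * (\<Sum>a\<in>A. v a * g a)
        = (\<Sum>b\<in>A. (1 - 2 * c b + (c b)\<^sup>2) * g b) + (\<Sum>b\<in>A. \<Sum>a\<in>A - {b}. (c a)\<^sup>2 * w a b * g b)"
      by (simp add: v_def sum_distrib_left sum_distrib_right distrib_right sum.distrib[symmetric] del: of_nat_Suc)
    also have "(\<Sum>b\<in>A. \<Sum>a\<in>A - {b}. (c a)\<^sup>2 * w a b * g b) = (\<Sum>a\<in>A. \<Sum>b\<in>A - {a}. (c a)\<^sup>2 * w a b * g b)"
      by (rule swap[symmetric])
    also have "(\<Sum>b\<in>A. (1 - 2 * c b + (c b)\<^sup>2) * g b) + \<dots> = (\<Sum>a\<in>A. L g a)"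
      unfolding sum.distrib[symmetric]
    proof (intro sum.cong refl)
      fix a
      have "(\<Sum>b\<in>A - {a}. (c a)\<^sup>2 * w a b * g b) = (c a)\<^sup>2 * (\<Sum>b\<in>A - {a}. w a b * g b)"
        unfolding sum_distrib_left by (simp only: mult.assoc)
      then show "(1 - 2 * c a + (c a)\<^sup>2) * g a + (\<Sum>b\<in>A - {a}. (c a)\<^sup>2 * w a b * g b) = L g a"
        unfolding L_def by (simp only: ring_distribs)
    qed
    finally show ?thesis ..
  qed
  \<comment> \<open>This is (x - d y)^2 / y \<ge> 0, followed by enlarging y; equality holds for d =
    x / y and y' = y.\<close>
  have tan: "x - x\<^sup>2 / y \<le> x - 2 * d * x + d\<^sup>2 * y'" if "y > 0" "y \<le> y'" for x y y' d :: real
  proof -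
    have "0 \<le> (x - d * y)\<^sup>2 / y" using that by simp
    also have "\<dots> = x\<^sup>2 / y - 2 * d * x + d\<^sup>2 * y"
      using that by (simp add: field_simps power2_eq_square)
    finally have "x - x\<^sup>2 / y \<le> x - 2 * d * x + d\<^sup>2 * y" by simp
    also have "d\<^sup>2 * y \<le> d\<^sup>2 * y'" using that by (intro mult_left_mono) auto
    finally show ?thesis by simp
  qed
  have tan_eq: "x - x\<^sup>2 / y = x - 2 * (x / y) * x + (x / y)\<^sup>2 * y" if "y > 0" for x y :: real
    using that by (simp add: field_simps power2_eq_square)
  show ?case
  proof (intro exI[of _ v] conjI allI impI)
    fix g assume g: "Gamma (Suc (Suc j)) g A"
    have "real (Suc (Suc j)) * sigma_quot (Suc j) g A \<le> (\<Sum>a\<in>A. L g a)"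
      unfolding sigma_quot_rec(1)[OF g Suc.prems(1)] L_def
      using sigma_quot_rec(2)[OF g Suc.prems(1)] w(1) Gamma_remove[OF g Suc.prems(1)]
      by (intro sum_mono tan) auto
    then show "sigma_quot (Suc j) g A \<le> (\<Sum>a\<in>A. v a * g a)"
      unfolding Lv by (rule mult_left_le_imp_le) simp
  next
    have "g0 a - (g0 a)\<^sup>2 / (g0 a + sigma_quot j g0 (A - {a})) = L g0 a" if "a \<in> A" for a
      using sigma_quot_rec(2)[OF Suc.prems(2,1) that]
      unfolding L_def c_def w(2)[OF that, symmetric] by (rule tan_eq)
    then have "real (Suc (Suc j)) * sigma_quot (Suc j) g0 A = (\<Sum>a\<in>A. L g0 a)"
      using sigma_quot_rec(1)[OF Suc.prems(2,1)] by simp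
    then show "sigma_quot (Suc j) g0 A = (\<Sum>a\<in>A. v a * g0 a)"
      unfolding Lv by (simp del: of_nat_Suc)
  qed
qed

definition quot_root :: "nat \<Rightarrow> nat \<Rightarrow> ('a \<Rightarrow> real) \<Rightarrow> 'a set \<Rightarrow> real" where
  "quot_root k l g A = (sigma k g A / sigma l g A) powr (1 / real (k - l))"

lemma quot_root_pos:
  assumes "Gamma k g A" "finite A" "l < k"
  shows "quot_root k l g A > 0"
  using Gamma_pos[OF assms(1,2), of k] Gamma_pos[OF assms(1,2), of l] assms(3)
  by (simp add: quot_root_def)

text \<open>Raising one entry by t adds t times \<open>sigma i g (A - {a})\<close> to the symmetric
  function of index i + 1, and the cone property of A - {a} makes this term nonnegative.\<close>

lemma Gamma_add_unit:
  assumes "Gamma k g A" "finite A" "a \<in> A" "t \<ge> 0"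
  shows "Gamma k (g(a := g a + t)) A"
  unfolding Gamma_def
proof (intro allI impI)
  fix j assume j: "1 \<le> j \<and> j \<le> k"
  then obtain i where i: "j = Suc i" by (cases j) auto
  let ?h = "g(a := g a + t)"
  have c: "sigma m ?h (A - {a}) = sigma m g (A - {a})" for m
    by (rule sigma_cong) auto
  have "sigma j ?h A = sigma j g A + t * sigma i g (A - {a})"
    unfolding i sigma_remove[OF assms(2,3)] c by (simp add: algebra_simps)
  moreover have "sigma i g (A - {a}) > 0"
  proof -
    have "Gamma (Suc i) g A" using assms(1) j i Gamma_mono by auto
    from Gamma_remove[OF this assms(2,3)] show ?thesis
      using Gamma_pos assms(2) by blast
  qed
  moreover have "sigma j g A > 0" using assms(1) j by (auto simp: Gamma_def)
  ultimately show "sigma j ?h A > 0" using assms(4) by (simp add: add_pos_nonneg)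
qed

text \<open>The quotient telescopes into k - l successive quotients. The arithmetic-geometric mean
  inequality, applied to their ratios to the values at \<open>g0\<close>, turns the geometric mean
  into a sum; the weights are the corresponding average of the individual supports.\<close>

lemma quot_root_support:
  assumes "finite A" "l < k" "Gamma k g0 A"
  obtains w where "\<And>a. a \<in> A \<Longrightarrow> 0 \<le> w a"
    and "\<And>g. Gamma k g A \<Longrightarrow> quot_root k l g A \<le> (\<Sum>a\<in>A. w a * g a)"
    and "quot_root k l g0 A = (\<Sum>a\<in>A. w a * g0 a)"
proof -
  let ?f = "\<lambda>g. quot_root k l g A"
  let ?q = "\<lambda>j g. sigma_quot j g A"
  define r where "r = k - l"
  have r: "r > 0" using assms(2) by (simp add: r_def)
  have qpos: "?q j g > 0" if "Gamma k g A" "j < k" for j g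
    using Gamma_pos[OF that(1) assms(1)] that(2) by (simp add: sigma_quot_def)
  have tele: "sigma k g A / sigma l g A = (\<Prod>j\<in>{l..<k}. ?q j g)" if g: "Gamma k g A" for g
  proof -
    have "l \<le> k' \<Longrightarrow> k' \<le> k \<Longrightarrow> sigma k' g A / sigma l g A = (\<Prod>j\<in>{l..<k'}. ?q j g)" for k'
    proof (induction k' rule: dec_induct)
      case base
      then show ?case using Gamma_pos[OF g assms(1), of l] assms(2) by simp
    next
      case (step i)
      have "sigma (Suc i) g A / sigma l g A = sigma i g A / sigma l g A * ?q i g"
        using Gamma_pos[OF g assms(1), of i] step.prems by (simp add: sigma_quot_def)
      with step show ?case by simp
    qed
    then show ?thesis using assms(2) by auto
  qed
  have f: "?f g = (\<Prod>j\<in>{l..<k}. ?q j g) powr (1 / real r)" if "Gamma k g A" for g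
    using tele[OF that] by (simp add: quot_root_def r_def)
  have "\<exists>w. (\<forall>g. Gamma (Suc j) g A \<longrightarrow> ?q j g \<le> (\<Sum>a\<in>A. w a * g a))
      \<and> ?q j g0 = (\<Sum>a\<in>A. w a * g0 a)" if "j < k" for j
    using sigma_quot_support[OF assms(1), of j g0] Gamma_mono[OF assms(3), of "Suc j"] that by simp
  then obtain v where v:
    "\<And>j g. j < k \<Longrightarrow> Gamma (Suc j) g A \<Longrightarrow> ?q j g \<le> (\<Sum>a\<in>A. v j a * g a)"
    "\<And>j. j < k \<Longrightarrow> ?q j g0 = (\<Sum>a\<in>A. v j a * g0 a)"
    by metis
  define w where "w a = ?f g0 / real r * (\<Sum>j\<in>{l..<k}. v j a / ?q j g0)" for a
  have f0: "?f g0 > 0" using quot_root_pos assms by blast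
  have wsum: "(\<Sum>a\<in>A. w a * g a) = ?f g0 / real r * (\<Sum>j\<in>{l..<k}. (\<Sum>a\<in>A. v j a * g a) / ?q j g0)" for g
  proof -
    have "(\<Sum>a\<in>A. w a * g a) = (\<Sum>a\<in>A. \<Sum>j\<in>{l..<k}. ?f g0 / real r * (v j a * g a / ?q j g0))"
      unfolding w_def by (simp add: sum_distrib_left sum_distrib_right algebra_simps)
    also have "\<dots> = (\<Sum>j\<in>{l..<k}. \<Sum>a\<in>A. ?f g0 / real r * (v j a * g a / ?q j g0))"
      by (rule sum.swap)
    finally show ?thesis by (simp add: sum_distrib_left sum_divide_distrib)
  qed
  have le: "?f g \<le> (\<Sum>a\<in>A. w a * g a)" if g: "Gamma k g A" for g
  proof -
    have "?f g / ?f g0 = (\<Prod>j\<in>{l..<k}. ?q j g / ?q j g0) powr (1 / real r)"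
      unfolding f[OF g] f[OF assms(3)] prod_dividef
      by (rule powr_divide[symmetric])
    also have "\<dots> \<le> (\<Sum>j\<in>{l..<k}. ?q j g / ?q j g0 / real r)"
      using arith_geom_mean[of "{l..<k}" "\<lambda>j. ?q j g / ?q j g0"] qpos[OF g] qpos[OF assms(3)] assms(2)
      by (simp add: r_def less_imp_le)
    also have "\<dots> \<le> (\<Sum>j\<in>{l..<k}. (\<Sum>a\<in>A. v j a * g a) / ?q j g0 / real r)"
    proof (intro sum_mono divide_right_mono)
      fix j assume "j \<in> {l..<k}"
      then show "?q j g \<le> (\<Sum>a\<in>A. v j a * g a)" "0 \<le> ?q j g0"
        using v(1) Gamma_mono[OF g, of "Suc j"] qpos[OF assms(3), of j] by auto
    qed simp
    also have "\<dots> = (\<Sum>j\<in>{l..<k}. (\<Sum>a\<in>A. v j a * g a) / ?q j g0) / real r"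
      by (rule sum_divide_distrib[symmetric])
    finally have "?f g \<le> (\<Sum>j\<in>{l..<k}. (\<Sum>a\<in>A. v j a * g a) / ?q j g0) / real r * ?f g0"
      using f0 by (simp only: pos_divide_le_eq)
    then show ?thesis unfolding wsum by (simp add: mult.commute)
  qed
  have eq: "?f g0 = (\<Sum>a\<in>A. w a * g0 a)"
  proof -
    have "(\<Sum>j\<in>{l..<k}. (\<Sum>a\<in>A. v j a * g0 a) / ?q j g0) = (\<Sum>j\<in>{l..<k}. 1)"
      using v(2) qpos[OF assms(3)] by (intro sum.cong) (auto simp: less_imp_neq[symmetric])
    then show ?thesis unfolding wsum using r by (simp add: r_def)
  qed
  have "0 \<le> w a" if a: "a \<in> A" for a
  proof (rule ccontr)
    assume "\<not> 0 \<le> w a"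
    then have neg: "w a < 0" by simp
    \<comment> \<open>With a negative weight, this move inside the cone would bring the linear form
      down to 0, although the positive quotient must stay below it.\<close>
    define t where "t = ?f g0 / (- w a)"
    have t: "t \<ge> 0" using f0 neg by (simp add: t_def divide_nonneg_neg)
    let ?h = "g0(a := g0 a + t)"
    have G: "Gamma k ?h A" using Gamma_add_unit[OF assms(3,1) a t] .
    have "(\<Sum>b\<in>A. w b * ?h b) = (\<Sum>b\<in>A. w b * g0 b) + w a * t"
    proof -
      have "(\<Sum>b\<in>A. w b * ?h b) = (\<Sum>b\<in>A. w b * g0 b + (if b = a then w a * t else 0))"
        by (intro sum.cong) (auto simp: algebra_simps)
      then show ?thesis using assms(1) a by (simp add: sum.distrib)
    qed
    also have "\<dots> = 0" using eq neg by (simp add: t_def field_simps)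
    finally show False using le[OF G] quot_root_pos[OF G assms(1,2)] by simp
  qed
  then show ?thesis using that le eq by blast
qed

lemma quot_root_reindex:
  assumes "bij_betw p A B"
  shows "quot_root k l (\<lambda>a. g (p a)) A = quot_root k l g B"
    and "Gamma k (\<lambda>a. g (p a)) A = Gamma k g B"
  using sigma_reindex[OF assms] by (simp_all add: quot_root_def Gamma_def)

lemma quot_root_scale:
  assumes "finite A" "l < k" "c > 0" "Gamma k g A"
  shows "quot_root k l (\<lambda>a. c * g a) A = c * quot_root k l g A"
    and "Gamma k (\<lambda>a. c * g a) A"
proof -
  have "c ^ k / c ^ l = c ^ (k - l)" using assms(2,3) by (simp add: power_diff)
  then have "sigma k (\<lambda>a. c * g a) A / sigma l (\<lambda>a. c * g a) A = c ^ (k - l) * (sigma k g A / sigma l g A)"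
    using assms(1) by (simp add: sigma_scale flip: times_divide_times_eq)
  moreover have "(c ^ (k - l)) powr (1 / real (k - l)) = c"
    using assms(2,3) by (simp add: powr_powr flip: powr_realpow)
  ultimately show "quot_root k l (\<lambda>a. c * g a) A = c * quot_root k l g A"
    using assms Gamma_pos[OF assms(4,1), of k] Gamma_pos[OF assms(4,1), of l]
    by (simp add: quot_root_def powr_mult del: times_divide_eq_right times_divide_eq_left)
  show "Gamma k (\<lambda>a. c * g a) A"
    using assms by (auto simp: Gamma_def sigma_scale)
qed

lemma Gamma_const:
  assumes "finite A" "k \<le> card A" "c > 0"
  shows "Gamma k (\<lambda>_. c) A"
proof -
  have "sigma j (\<lambda>_. c) A = c ^ j * real (card A choose j)" for j
    using sigma_scale[OF assms(1), of j c "\<lambda>_. 1"] sigma_one[OF assms(1)] by simp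
  then show ?thesis using assms by (auto simp: Gamma_def zero_less_binomial)
qed

section \<open>Rearrangement for doubly stochastic matrices\<close>

text \<open>Linear programming duality is used, so that S need not be decomposed into permutation
  matrices.\<close>

lemma rearrangement_sorted:
  fixes F lam :: "nat \<Rightarrow> real" and S :: "nat \<Rightarrow> nat \<Rightarrow> real"
  assumes S: "\<And>i j. i < n \<Longrightarrow> j < n \<Longrightarrow> 0 \<le> S i j"
    and rows: "\<And>i. i < n \<Longrightarrow> (\<Sum>j<n. S i j) = 1"
    and cols: "\<And>j. j < n \<Longrightarrow> (\<Sum>i<n. S i j) = 1"
    and F: "\<And>i j. i \<le> j \<Longrightarrow> j < n \<Longrightarrow> F i \<le> F j"
    and lam: "\<And>i j. i \<le> j \<Longrightarrow> j < n \<Longrightarrow> lam j \<le> lam i"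
  shows "(\<Sum>i<n. F i * lam i) \<le> (\<Sum>i<n. \<Sum>j<n. S i j * (F i * lam j))"
proof -
  define \<beta> where "\<beta> j = (\<Sum>t<j. F t * (lam (Suc t) - lam t))" for j
  have tele: "\<beta> j - \<beta> i = (\<Sum>t=i..<j. F t * (lam (Suc t) - lam t))" if "i \<le> j" for i j
    using sum.atLeastLessThan_concat[of 0 i j "\<lambda>t. F t * (lam (Suc t) - lam t)"] that
    by (simp add: \<beta>_def atLeast0LessThan)
  have lam_tele: "lam j - lam i = (\<Sum>t=i..<j. lam (Suc t) - lam t)" if "i \<le> j" for i j
    using sum_Suc_diff'[OF that, of lam] by simp
  \<comment> \<open>\<open>\<beta>\<close> and \<open>\<lambda>i. F i * lam i - \<beta> i\<close> are optimal dual potentials for the assignment problem.\<close>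
  have pot: "\<beta> j - \<beta> i \<le> F i * (lam j - lam i)" if "i < n" "j < n" for i j
  proof (cases "i \<le> j")
    case True
    have "\<beta> j - \<beta> i \<le> (\<Sum>t=i..<j. F i * (lam (Suc t) - lam t))"
      unfolding tele[OF True] using that F lam
      by (intro sum_mono mult_right_mono_neg) auto
    then show ?thesis by (simp add: lam_tele[OF True] sum_distrib_left)
  next
    case False
    then have ji: "j \<le> i" by simp
    have "(\<Sum>t=j..<i. F i * (lam (Suc t) - lam t)) \<le> \<beta> i - \<beta> j"
      unfolding tele[OF ji] using that F lam
      by (intro sum_mono mult_right_mono_neg) auto
    then have "F i * (lam i - lam j) \<le> \<beta> i - \<beta> j"
      by (simp add: lam_tele[OF ji] sum_distrib_left)
    then show ?thesis by (simp add: algebra_simps)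
  qed
  \<comment> \<open>Averaged against S, the potentials cancel because all row and column sums are
    1.\<close>
  have "(\<Sum>i<n. \<Sum>j<n. S i j * (F i * lam i - \<beta> i + \<beta> j)) \<le> (\<Sum>i<n. \<Sum>j<n. S i j * (F i * lam j))"
  proof (intro sum_mono mult_left_mono)
    fix i j assume "i \<in> {..<n}" "j \<in> {..<n}"
    then show "F i * lam i - \<beta> i + \<beta> j \<le> F i * lam j" "0 \<le> S i j"
      using pot[of i j] S by (auto simp: algebra_simps)
  qed
  moreover have "(\<Sum>i<n. \<Sum>j<n. S i j * (F i * lam i - \<beta> i + \<beta> j))
    = (\<Sum>i<n. (\<Sum>j<n. S i j) * (F i * lam i - \<beta> i)) + (\<Sum>j<n. (\<Sum>i<n. S i j) * \<beta> j)"
    unfolding distrib_left sum.distrib sum_distrib_right by (subst (2) sum.swap) simp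
  ultimately show ?thesis
    by (simp add: rows cols sum_subtractf)
qed

lemma sorting_bij:
  fixes F :: "nat \<Rightarrow> real"
  obtains p where "bij_betw p {..<n} {..<n}" "\<And>i j. i \<le> j \<Longrightarrow> j < n \<Longrightarrow> F (p i) \<le> F (p j)"
proof -
  define xs where "xs = sort_key F [0..<n]"
  have len: "length xs = n" and set: "set xs = {..<n}" and dist: "distinct xs"
    by (auto simp: xs_def)
  have "sorted (map F xs)" by (simp add: xs_def)
  then have "F (xs ! i) \<le> F (xs ! j)" if "i \<le> j" "j < n" for i j
    using sorted_nth_mono[of "map F xs" i j] that len by simp
  moreover have "bij_betw (\<lambda>i. xs ! i) {..<n} {..<n}"
    by (rule bij_betw_nth[OF dist]) (simp_all only: len set)
  ultimately show ?thesis using that by blast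
qed

text \<open>Meant for S i j = (e i . g j)^2 with two orthonormal frames e and g. Any permutation is
  good enough there, since the functions of the eigenvalues are symmetric.\<close>

lemma rearrangement:
  fixes F lam :: "nat \<Rightarrow> real" and S :: "nat \<Rightarrow> nat \<Rightarrow> real"
  assumes S: "\<And>i j. i < n \<Longrightarrow> j < n \<Longrightarrow> 0 \<le> S i j"
    and rows: "\<And>i. i < n \<Longrightarrow> (\<Sum>j<n. S i j) = 1"
    and cols: "\<And>j. j < n \<Longrightarrow> (\<Sum>i<n. S i j) = 1"
  obtains \<pi> where "bij_betw \<pi> {..<n} {..<n}"
    "(\<Sum>i<n. F i * lam (\<pi> i)) \<le> (\<Sum>i<n. \<Sum>j<n. S i j * (F i * lam j))"
proof -
  obtain p where p: "bij_betw p {..<n} {..<n}" "\<And>i j. i \<le> j \<Longrightarrow> j < n \<Longrightarrow> F (p i) \<le> F (p j)"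
    using sorting_bij[of n F] by blast
  obtain q where q: "bij_betw q {..<n} {..<n}" "\<And>i j. i \<le> j \<Longrightarrow> j < n \<Longrightarrow> - lam (q i) \<le> - lam (q j)"
    using sorting_bij[of n "\<lambda>i. - lam i"] by blast
  let ?p' = "inv_into {..<n} p"
  have p': "bij_betw ?p' {..<n} {..<n}" by (rule bij_betw_inv_into[OF p(1)])
  have lt: "p i < n" "q i < n" if "i < n" for i
    using p(1) q(1) that by (auto simp: bij_betw_def)
  have re: "(\<Sum>i<n. h (p i)) = (\<Sum>i<n. h i)" "(\<Sum>i<n. h (q i)) = (\<Sum>i<n. h i)" for h :: "nat \<Rightarrow> real"
    using sum.reindex_bij_betw[OF p(1), of h] sum.reindex_bij_betw[OF q(1), of h] by simp_all
  have "(\<Sum>i<n. F (p i) * lam (q i)) \<le> (\<Sum>i<n. \<Sum>j<n. S (p i) (q j) * (F (p i) * lam (q j)))"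
  proof (rule rearrangement_sorted)
    show "(\<Sum>j<n. S (p i) (q j)) = 1" if "i < n" for i
      using rows[of "p i"] re(2)[of "\<lambda>j. S (p i) j"] lt that by simp
    show "(\<Sum>i<n. S (p i) (q j)) = 1" if "j < n" for j
      using cols[of "q j"] re(1)[of "\<lambda>i. S i (q j)"] lt that by simp
  qed (use S lt p q in auto)
  also have "\<dots> = (\<Sum>i<n. \<Sum>j<n. S i j * (F i * lam j))"
    using re(1)[of "\<lambda>i. \<Sum>j<n. S i (q j) * (F i * lam (q j))"] re(2)[of "\<lambda>j. S i j * (F i * lam j)" for i]
    by simp
  also have "(\<Sum>i<n. F (p i) * lam (q i)) = (\<Sum>i<n. F i * lam (q (?p' i)))"
    using re(1)[of "\<lambda>i. F i * lam (q (?p' i))"] p(1)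
    by (simp add: bij_betw_inv_into_left[OF p(1)])
  finally show ?thesis
    using that[of "q \<circ> ?p'"] bij_betw_trans[OF p' q(1)] by simp
qed

section \<open>Orthonormal frames and the spectral theorem\<close>

lemma quadratic_nonpos_imp_zero:
  fixes b c :: real
  assumes "\<And>t. 2 * t * b + t\<^sup>2 * c \<le> 0"
  shows "b = 0"
proof (rule ccontr)
  assume b: "b \<noteq> 0"
  define d where "d = \<bar>c\<bar> + 1"
  have d: "d > 0" by (simp add: d_def)
  have "d\<^sup>2 * (2 * (b / d) * b + (b / d)\<^sup>2 * c) = b\<^sup>2 * (2 * d + c)"
    using d by (simp add: field_simps power2_eq_square)
  moreover have "b\<^sup>2 * (2 * d + c) > 0"
    using b by (intro mult_pos_pos) (auto simp: d_def)
  moreover have "d\<^sup>2 * (2 * (b / d) * b + (b / d)\<^sup>2 * c) \<le> 0"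
    using assms[of "b / d"] by (intro mult_nonneg_nonpos) auto
  ultimately show False by linarith
qed

text \<open>The first-order condition for the Rayleigh quotient on V. With w the part of y
  orthogonal to v, the form at v + t w minus \<open>B v v\<close> times the squared length is
  nonpositive and vanishes at t = 0, so its linear term in t is zero.\<close>

lemma rayleigh_max:
  fixes B :: "'a::euclidean_space \<Rightarrow> 'a \<Rightarrow> real"
  assumes B: "bilinear B" "\<And>X Y. B X Y = B Y X"
    and V: "subspace V" "v \<in> V" "norm v = 1" "y \<in> V"
    and max: "\<And>w. w \<in> V \<Longrightarrow> norm w = 1 \<Longrightarrow> B w w \<le> B v v"
  shows "B v y = B v v * (v \<bullet> y)"
proof -
  note bl = bilinear_ladd[OF B(1)] bilinear_radd[OF B(1)] bilinear_lmul[OF B(1)] bilinear_rmul[OF B(1)]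
    bilinear_rsub[OF B(1)]
  have max': "B w w \<le> B v v * (w \<bullet> w)" if w: "w \<in> V" for w
  proof (cases "w = 0")
    case True
    then show ?thesis using bilinear_lzero[OF B(1)] by simp
  next
    case False
    let ?w = "(1 / norm w) *\<^sub>R w"
    have "B ?w ?w \<le> B v v" using False w V(1) by (intro max) (auto simp: subspace_scale)
    then have "B w w / (norm w)\<^sup>2 \<le> B v v" by (simp add: bl power2_eq_square)
    then show ?thesis using False by (simp add: pos_divide_le_eq power2_norm_eq_inner)
  qed
  define w where "w = y - (v \<bullet> y) *\<^sub>R v"
  have wV: "w \<in> V" using V by (simp add: w_def subspace_diff subspace_scale)
  have vv: "v \<bullet> v = 1" using V(3) by (simp add: norm_eq_1)
  have vw: "v \<bullet> w = 0" by (simp add: w_def inner_diff_right vv)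
  have "2 * t * B v w + t\<^sup>2 * (B w w - B v v * (w \<bullet> w)) \<le> 0" for t
  proof -
    have "B (v + t *\<^sub>R w) (v + t *\<^sub>R w) \<le> B v v * ((v + t *\<^sub>R w) \<bullet> (v + t *\<^sub>R w))"
      using V wV by (intro max') (simp add: subspace_add subspace_scale)
    moreover have "B (v + t *\<^sub>R w) (v + t *\<^sub>R w) = B v v + 2 * t * B v w + t\<^sup>2 * B w w"
      using B(2)[of w v] by (simp add: bl algebra_simps power2_eq_square)
    moreover have "(v + t *\<^sub>R w) \<bullet> (v + t *\<^sub>R w) = 1 + t\<^sup>2 * (w \<bullet> w)"
      using vw vv by (simp add: inner_add_left inner_add_right inner_commute[of w v] power2_eq_square)
    ultimately have "B v v + 2 * t * B v w + t\<^sup>2 * B w w \<le> B v v * (1 + t\<^sup>2 * (w \<bullet> w))"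
      by (simp only:)
    then show ?thesis by (simp add: algebra_simps)
  qed
  then have "B v w = 0" by (rule quadratic_nonpos_imp_zero)
  then show ?thesis by (simp add: w_def bl)
qed

lemma spectral_frame:
  fixes x :: "real^'m" and B :: "real^'m \<Rightarrow> real^'m \<Rightarrow> real"
  assumes B: "bilinear B" "\<And>X Y. B X Y = B Y X"
  obtains e where "frame x e"
    and "\<And>i j. i < CARD('m) - 1 \<Longrightarrow> j < CARD('m) - 1 \<Longrightarrow> i \<noteq> j \<Longrightarrow> B (e i) (e j) = 0"
proof -
  define n where "n = CARD('m) - 1"
  \<comment> \<open>Each e i maximizes the form among unit vectors orthogonal to x and to the
    earlier vectors. The last clause is the eigenvector equation tested only against such vectors: B
    lives on the whole space and may mix x with its complement, so only its restriction to the
    tangent space is diagonalized.\<close>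
  define good where "good e k \<longleftrightarrow> (\<forall>i<k. e i \<bullet> x = 0 \<and> norm (e i) = 1 \<and> (\<forall>j<i. e i \<bullet> e j = 0)
    \<and> (\<forall>v. v \<bullet> x = 0 \<and> (\<forall>j<i. v \<bullet> e j = 0) \<longrightarrow> B (e i) v = B (e i) (e i) * (e i \<bullet> v)))" for e and k :: nat
  have "k \<le> n \<Longrightarrow> \<exists>e. good e k" for k
  proof (induction k)
    case 0
    then show ?case by (simp add: good_def)
  next
    case (Suc k)
    then obtain e where e: "good e k" by auto
    define V where "V = {v. v \<bullet> x = 0 \<and> (\<forall>j<k. v \<bullet> e j = 0)}"
    have sub: "subspace V"
      by (auto simp: V_def subspace_def inner_add_left)
    have "dim (insert x (e ` {..<k})) \<le> card (insert x (e ` {..<k}))"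
      by (rule dim_le_card') auto
    also have "\<dots> \<le> Suc k"
      by (rule order_trans[OF card_insert_le_m1[of "Suc k"]]) (auto intro: card_image_le[of "{..<k}", simplified])
    also have "\<dots> < DIM(real^'m)" using Suc.prems by (simp add: n_def)
    finally obtain y where y: "y \<noteq> 0" "\<And>z. z \<in> span (insert x (e ` {..<k})) \<Longrightarrow> orthogonal y z"
      using orthogonal_to_subspace_exists by blast
    have "y \<in> V"
      using y(2) by (auto simp: V_def orthogonal_def intro!: span_base)
    then have "(1 / norm y) *\<^sub>R y \<in> V \<inter> sphere 0 1"
      using y(1) sub by (simp add: subspace_scale)
    then have ne: "V \<inter> sphere 0 1 \<noteq> {}" by blast
    have comp: "compact (V \<inter> sphere 0 1)"
      using sub by (intro closed_Int_compact closed_subspace) auto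
    have bb: "bounded_bilinear B" using B(1) by (simp add: bilinear_conv_bounded_bilinear)
    have "continuous_on (V \<inter> sphere 0 1) (\<lambda>v. B v v)"
      by (rule bounded_bilinear.continuous_on[OF bb continuous_on_id continuous_on_id])
    from continuous_attains_sup[OF comp ne this]
    obtain v where v: "v \<in> V" "norm v = 1" "\<And>w. w \<in> V \<Longrightarrow> norm w = 1 \<Longrightarrow> B w w \<le> B v v"
      by auto
    have "good (e(k := v)) (Suc k)"
      unfolding good_def
    proof (intro allI impI)
      fix i assume i: "i < Suc k"
      show "(e(k := v)) i \<bullet> x = 0 \<and> norm ((e(k := v)) i) = 1 \<and> (\<forall>j<i. (e(k := v)) i \<bullet> (e(k := v)) j = 0) \<and>
         (\<forall>va. va \<bullet> x = 0 \<and> (\<forall>j<i. va \<bullet> (e(k := v)) j = 0) \<longrightarrow>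
               B ((e(k := v)) i) va = B ((e(k := v)) i) ((e(k := v)) i) * ((e(k := v)) i \<bullet> va))"
      proof (cases "i = k")
        case True
        have "B v y = B v v * (v \<bullet> y)" if "y \<in> V" for y
          using rayleigh_max[OF B sub v(1,2) that v(3)] .
        then have "\<forall>y. y \<bullet> x = 0 \<and> (\<forall>j<k. y \<bullet> e j = 0) \<longrightarrow> B v y = B v v * (v \<bullet> y)"
          unfolding V_def by blast
        moreover have "(e(k := v)) k = v" "\<And>j. j < k \<Longrightarrow> (e(k := v)) j = e j" by auto
        moreover have "v \<bullet> x = 0" "\<forall>j<k. v \<bullet> e j = 0" using v(1) by (auto simp: V_def)
        ultimately show ?thesis
          using v(2) unfolding True by metis
      next
        case False
        then have "i < k" using i by simp
        then have "e i \<bullet> x = 0 \<and> norm (e i) = 1 \<and> (\<forall>j<i. e i \<bullet> e j = 0)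
            \<and> (\<forall>v. v \<bullet> x = 0 \<and> (\<forall>j<i. v \<bullet> e j = 0) \<longrightarrow> B (e i) v = B (e i) (e i) * (e i \<bullet> v))"
          using e unfolding good_def by blast
        moreover have "(e(k := v)) i = e i" "\<And>j. j < i \<Longrightarrow> (e(k := v)) j = e j"
          using \<open>i < k\<close> by auto
        ultimately show ?thesis by metis
      qed
    qed
    then show ?case by blast
  qed
  then obtain e where e: "good e n" by blast
  have ex: "e i \<bullet> x = 0" "norm (e i) = 1" if "i < n" for i
    using e that unfolding good_def by blast+
  have orth1: "e i \<bullet> e j = 0" if "j < i" "i < n" for i j
    using e that unfolding good_def by blast
  have orth2: "B (e i) (e j) = 0" if ij: "j < i" "i < n" for i j
  proof -
    have "e i \<bullet> e t = 0" if "t < j" for t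
      using orth1[of t i] that ij by simp
    moreover have "\<forall>v. v \<bullet> x = 0 \<and> (\<forall>t<j. v \<bullet> e t = 0) \<longrightarrow> B (e j) v = B (e j) (e j) * (e j \<bullet> v)"
      using e ij unfolding good_def by (meson less_trans)
    ultimately have "B (e j) (e i) = B (e j) (e j) * (e j \<bullet> e i)"
      using ex(1)[OF ij(2)] by blast
    then show ?thesis using orth1[OF ij] B(2)[of "e i" "e j"] by (simp add: inner_commute)
  qed
  have "frame x e"
    unfolding frame_def n_def[symmetric]
  proof (intro conjI allI impI)
    fix i assume "i < n" then show "e i \<bullet> x = 0" by (rule ex)
  next
    fix i j assume "i < n" "j < n"
    then show "e i \<bullet> e j = (if i = j then 1 else 0)"
      using ex(2)[of i] orth1[of i j] orth1[of j i]
      by (cases i j rule: linorder_cases) (auto simp: norm_eq_1 inner_commute)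
  qed
  moreover have "B (e i) (e j) = 0" if "i < n" "j < n" "i \<noteq> j" for i j
    using that orth2[of i j] orth2[of j i] B(2)[of "e i" "e j"] by (cases i j rule: linorder_cases) auto
  ultimately show ?thesis using that unfolding n_def by blast
qed

lemma frame_exists: obtains e where "frame (x::real^'m) e"
proof (rule spectral_frame[of "(\<bullet>)" x])
  show "bilinear ((\<bullet>) :: real^'m \<Rightarrow> real^'m \<Rightarrow> real)"
    by (simp add: bilinear_conv_bounded_bilinear bounded_bilinear_inner)
qed (auto simp: inner_commute that)

text \<open>Together with x the vectors e i are CARD('m) many and orthonormal, hence a basis of the
  ambient space; a tangent v has no component along x.\<close>

lemma frame_expand:
  fixes x v :: "real^'m"
  assumes e: "frame x e" and x: "norm x = 1" and v: "v \<bullet> x = 0"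
  shows "v = (\<Sum>i<CARD('m) - 1. (v \<bullet> e i) *\<^sub>R e i)"
proof -
  define n where "n = CARD('m) - 1"
  have ex: "e i \<bullet> x = 0" and ee: "e i \<bullet> e j = (if i = j then 1 else 0)" if "i < n" "j < n" for i j
    using e that by (auto simp: frame_def n_def)
  let ?S = "insert x (e ` {..<n})"
  have inj: "inj_on e {..<n}"
    using ee by (intro inj_onI) (metis lessThan_iff zero_neq_one)
  have xn: "x \<notin> e ` {..<n}"
    using ex x by (auto simp: norm_eq_1)
  have card: "card ?S = CARD('m)"
    using inj xn by (simp add: card_image n_def)
  have "pairwise orthogonal ?S"
    using ex ee by (auto simp: pairwise_def orthogonal_def inner_commute)
  moreover have "0 \<notin> ?S"
    using ee x by (auto dest: sym) (metis inner_zero_left zero_neq_one)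
  ultimately have "independent ?S" by (rule pairwise_orthogonal_independent)
  then have span: "span ?S = UNIV"
    using card card_eq_dim[of ?S UNIV] by (auto simp: dim_UNIV)
  define w where "w = v - (\<Sum>i<n. (v \<bullet> e i) *\<^sub>R e i)"
  have "w \<bullet> x = 0"
    using v ex by (simp add: w_def inner_diff_left inner_sum_left)
  moreover have "w \<bullet> e j = 0" if "j < n" for j
  proof -
    have "(\<Sum>i<n. (v \<bullet> e i) * (e i \<bullet> e j)) = (\<Sum>i<n. if i = j then v \<bullet> e j else 0)"
      using ee that by (intro sum.cong) auto
    then show ?thesis using that by (simp add: w_def inner_diff_left inner_sum_left)
  qed
  ultimately have "orthogonal w y" if "y \<in> ?S" for y
    using that by (auto simp: orthogonal_def)
  then have "orthogonal w w"
    using orthogonal_to_span[of w ?S w] span by auto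
  then have "w = 0" by (simp add: orthogonal_self)
  then show ?thesis by (simp add: w_def n_def)
qed

lemma frame_norm_sq:
  fixes x v :: "real^'m"
  assumes e: "frame x e" and x: "norm x = 1" and v: "v \<bullet> x = 0"
  shows "(\<Sum>i<CARD('m) - 1. (v \<bullet> e i)\<^sup>2) = v \<bullet> v"
  using arg_cong[OF frame_expand[OF assms], of "\<lambda>w. v \<bullet> w"]
  by (simp add: inner_sum_right power2_eq_square)

section \<open>Calculus of \<open>C\<^sup>k\<close> functions\<close>

lemma pd_eqI:
  "((\<lambda>t. f (x + t *\<^sub>R axis i 1)) has_real_derivative D) (at 0) \<Longrightarrow> pd f i x = D"
  unfolding pd_def by (rule DERIV_imp_deriv)

lemma eventually_line_in_open:
  fixes x v :: "'a::real_normed_vector"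
  assumes "open U" "x \<in> U"
  shows "\<forall>\<^sub>F t in nhds (0::real). x + t *\<^sub>R v \<in> U"
proof -
  have "((\<lambda>t. x + t *\<^sub>R v) \<longlongrightarrow> x + 0 *\<^sub>R v) (nhds (0::real))"
    by (intro tendsto_intros filterlim_ident)
  then show ?thesis using assms by (intro topological_tendstoD) auto
qed

lemma pd_cong:
  assumes "open U" "x \<in> U" "\<And>y. y \<in> U \<Longrightarrow> f y = g y"
  shows "pd f i x = pd g i x"
  unfolding pd_def
  by (rule deriv_cong_ev) (use assms(3) in \<open>auto intro: eventually_mono[OF eventually_line_in_open[OF assms(1,2)]]\<close>)

lemma Ck_cong:
  assumes "open U" "\<And>y. y \<in> U \<Longrightarrow> f y = g y" "Ck k U f"
  shows "Ck k U g"
  using assms(2,3)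
proof (induction k arbitrary: f g)
  case 0
  then show ?case by (simp cong: continuous_on_cong_simp)
next
  case (Suc k)
  have pd: "pd f i x = pd g i x" if "x \<in> U" for i x
    using pd_cong[OF assms(1) that] Suc.prems(1) by blast
  have "((\<lambda>t. g (x + t *\<^sub>R axis i 1)) has_real_derivative pd g i x) (at 0)" if "x \<in> U" for x i
  proof -
    have "((\<lambda>t. f (x + t *\<^sub>R axis i 1)) has_real_derivative pd g i x) (at 0)"
      using Suc.prems(2) that pd by simp
    then show ?thesis
      by (rule DERIV_cong_ev[THEN iffD1, rotated 3])
        (use Suc.prems(1) in \<open>auto intro: eventually_mono[OF eventually_line_in_open[OF assms(1) that]]\<close>)
  qed
  moreover have "Ck k U (pd g i)" for i
    using Suc.IH[of "pd f i" "pd g i"] pd Suc.prems(2) by simp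
  ultimately show ?case by simp
qed

lemma Ck_SucI:
  assumes "open U"
    and "\<And>x i. x \<in> U \<Longrightarrow> ((\<lambda>t. f (x + t *\<^sub>R axis i 1)) has_real_derivative D i x) (at 0)"
    and "\<And>i. Ck k U (D i)"
  shows "Ck (Suc k) U f"
proof -
  have pd: "pd f i x = D i x" if "x \<in> U" for i x
    using pd_eqI[OF assms(2)[OF that]] .
  have "Ck k U (pd f i)" for i
    by (rule Ck_cong[OF assms(1) _ assms(3)[of i]]) (simp add: pd)
  then show ?thesis using assms(2) pd by simp
qed

lemma Ck_line_deriv:
  assumes "Ck (Suc k) U f" "x + s *\<^sub>R axis i 1 \<in> U"
  shows "((\<lambda>s. f (x + s *\<^sub>R axis i 1)) has_real_derivative pd f i (x + s *\<^sub>R axis i 1)) (at s)"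
proof -
  have "((\<lambda>t. f ((x + s *\<^sub>R axis i 1) + t *\<^sub>R axis i 1)) has_real_derivative pd f i (x + s *\<^sub>R axis i 1)) (at 0)"
    using assms by simp
  then have "((\<lambda>t. f (x + (t + s) *\<^sub>R axis i 1)) has_real_derivative pd f i (x + s *\<^sub>R axis i 1)) (at 0)"
    by (simp add: algebra_simps)
  then show ?thesis
    using DERIV_shift[of "\<lambda>s. f (x + s *\<^sub>R axis i 1)" "pd f i (x + s *\<^sub>R axis i 1)" 0 s] by simp
qed

text \<open>The increment is built up one coordinate at a time, with the mean value theorem on each
  segment. The hypotheses are spelled out rather than given as \<open>Ck\<close>, because this lemma
  is what makes a function with continuous partial derivatives continuous.\<close>

lemma Ck1_has_derivative_aux:
  assumes "open U" "x \<in> U" "\<forall>x\<in>U. \<forall>i. ((\<lambda>t. f (x + t *\<^sub>R axis i 1)) has_real_derivative pd f i x) (at 0)"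
    and "\<And>i. continuous_on U (pd f i)"
  shows "(f has_derivative (\<lambda>v. \<Sum>i\<in>UNIV. v $ i * pd f i x)) (at (x::real^'m))"
  unfolding has_derivative_at_alt
proof (intro conjI allI impI)
  show "bounded_linear (\<lambda>v. \<Sum>i\<in>UNIV. v $ i * pd f i x)"
    by (intro bounded_linear_sum bounded_linear_mult_const bounded_linear_vec_nth)
next
  fix e :: real assume "0 < e"
  define e' where "e' = e / real CARD('m)"
  have e': "e' > 0" using \<open>0 < e\<close> by (simp add: e'_def)
  obtain r where r: "r > 0" "ball x r \<subseteq> U"
    using assms(1,2) openE by blast
  have "\<forall>i. \<exists>d>0. \<forall>y. dist y x < d \<longrightarrow> dist (pd f i y) (pd f i x) < e'"
    using assms(1,2,4) e' by (auto simp: continuous_on_eq_continuous_at continuous_at_eps_delta)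
  then obtain d where d: "\<And>i. d i > 0" "\<And>i y. dist y x < d i \<Longrightarrow> dist (pd f i y) (pd f i x) < e'"
    by metis
  define \<delta> where "\<delta> = Min (insert r (range d))"
  have \<delta>: "\<delta> > 0" "\<delta> \<le> r" "\<And>i. \<delta> \<le> d i"
    using d(1) r(1) by (auto simp: \<delta>_def min_le_iff_disj)
  have est: "norm (f (x + v) - f x - (\<Sum>i\<in>UNIV. v $ i * pd f i x)) \<le> e * norm v" if v: "norm v < \<delta>" for v
  proof -
    define w where "w A = (\<chi> i. if i \<in> A then v $ i else 0)" for A
    have part: "\<bar>f (x + w A) - f x - (\<Sum>i\<in>A. v $ i * pd f i x)\<bar> \<le> (\<Sum>i\<in>A. e' * \<bar>v $ i\<bar>)" if "finite A" for A
      using that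
    proof (induction A rule: finite_induct)
      case empty
      have "w {} = 0" by (simp add: w_def vec_eq_iff)
      then show ?case by simp
    next
      case (insert a A)
      let ?y = "\<lambda>s. x + w A + s *\<^sub>R axis a 1"
      have wa: "w (insert a A) = w A + v $ a *\<^sub>R axis a 1"
        using insert.hyps by (simp add: w_def vec_eq_iff axis_def)
      have near: "dist (?y s) x < \<delta>" if "\<bar>s\<bar> \<le> \<bar>v $ a\<bar>" for s
      proof -
        have "norm (w A + s *\<^sub>R axis a 1) \<le> norm v"
          unfolding norm_vec_def
          using insert.hyps that by (intro L2_set_mono) (auto simp: w_def axis_def)
        then show ?thesis using v by (simp add: dist_norm add.assoc)
      qed
      have der: "((\<lambda>s. f (?y s)) has_real_derivative pd f a (?y s)) (at s)" if "\<bar>s\<bar> \<le> \<bar>v $ a\<bar>" for s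
      proof -
        have U: "?y s \<in> U" using near[OF that] \<delta>(2) r(2) by (auto simp: dist_commute)
        have "((\<lambda>t. f (?y s + t *\<^sub>R axis a 1)) has_real_derivative pd f a (?y s)) (at 0)"
          using assms(3) U by blast
        then have "((\<lambda>t. f (?y (t + s))) has_real_derivative pd f a (?y s)) (at 0)"
          by (simp add: algebra_simps)
        then show ?thesis using DERIV_shift[of "\<lambda>s. f (?y s)" "pd f a (?y s)" 0 s] by simp
      qed
      have "\<exists>\<xi>. \<bar>\<xi>\<bar> \<le> \<bar>v $ a\<bar> \<and> f (?y (v $ a)) - f (?y 0) = v $ a * pd f a (?y \<xi>)"
      proof (cases "v $ a" "0 :: real" rule: linorder_cases)
        case less
        have "\<exists>z. v $ a < z \<and> z < 0 \<and> f (?y 0) - f (?y (v $ a)) = (0 - v $ a) * pd f a (?y z)"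
          using less by (intro MVT2 der) auto
        then obtain z where z: "v $ a < z" "z < 0" "f (?y 0) - f (?y (v $ a)) = (0 - v $ a) * pd f a (?y z)" by blast
        then show ?thesis by (intro exI[of _ z]) (auto simp: algebra_simps)
      next
        case equal
        then show ?thesis by (intro exI[of _ 0]) auto
      next
        case greater
        have "\<exists>z. 0 < z \<and> z < v $ a \<and> f (?y (v $ a)) - f (?y 0) = (v $ a - 0) * pd f a (?y z)"
          using greater by (intro MVT2 der) auto
        then show ?thesis by force
      qed
      then obtain \<xi> where \<xi>: "\<bar>\<xi>\<bar> \<le> \<bar>v $ a\<bar>" "f (?y (v $ a)) - f (?y 0) = v $ a * pd f a (?y \<xi>)"
        by blast
      have "dist (pd f a (?y \<xi>)) (pd f a x) < e'"
        using near[OF \<xi>(1)] \<delta>(3)[of a] by (intro d(2)) auto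
      then have "\<bar>v $ a * (pd f a (?y \<xi>) - pd f a x)\<bar> \<le> e' * \<bar>v $ a\<bar>"
        by (simp add: abs_mult dist_real_def mult.commute[of e'] mult_left_mono)
      moreover have "f (x + w (insert a A)) - f x - (\<Sum>i\<in>insert a A. v $ i * pd f i x)
          = (f (x + w A) - f x - (\<Sum>i\<in>A. v $ i * pd f i x)) + v $ a * (pd f a (?y \<xi>) - pd f a x)"
        using \<xi>(2) insert.hyps by (simp add: wa algebra_simps)
      ultimately show ?case
        using insert.IH insert.hyps by (simp add: abs_triangle_ineq[THEN order_trans] add.commute add_mono)
    qed
    have "w UNIV = v" by (simp add: w_def vec_eq_iff)
    then have "norm (f (x + v) - f x - (\<Sum>i\<in>UNIV. v $ i * pd f i x)) \<le> (\<Sum>i\<in>UNIV. e' * \<bar>v $ i\<bar>)"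
      using part[of UNIV] by simp
    also have "\<dots> \<le> (\<Sum>i\<in>(UNIV::'m set). e' * norm v)"
      using e' by (intro sum_mono mult_left_mono component_le_norm_cart) auto
    also have "\<dots> = e * norm v" by (simp add: e'_def)
    finally show ?thesis .
  qed
  show "\<exists>d>0. \<forall>y. norm (y - x) < d \<longrightarrow> norm (f y - f x - (\<Sum>i\<in>UNIV. (y - x) $ i * pd f i x)) \<le> e * norm (y - x)"
    using est[of "y - x" for y] \<delta>(1) by (intro exI[of _ \<delta>]) auto
qed

text \<open>The case k = 0 has content: \<open>Ck (Suc 0)\<close> asks only for partial derivatives
  and their continuity, and continuity of f itself follows from total differentiability.\<close>

lemma Ck_Suc_mono:
  assumes "open U" "Ck (Suc k) U f"
  shows "Ck k U f"
  using assms(2)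
proof (induction k arbitrary: f)
  case 0
  then have "(f has_derivative (\<lambda>v. \<Sum>i\<in>UNIV. v $ i * pd f i x)) (at x)" if "x \<in> U" for x
    using assms(1) that by (intro Ck1_has_derivative_aux) auto
  then show ?case
    by (auto intro!: continuous_at_imp_continuous_on dest: has_derivative_continuous)
next
  case (Suc k)
  then show ?case by auto
qed

lemma Ck_mono:
  assumes "open U" "Ck k U f" "j \<le> k"
  shows "Ck j U f"
  using assms(3,2) by (induction rule: inc_induct) (auto intro: Ck_Suc_mono[OF assms(1)])

lemma Ck_continuous_on: "open U \<Longrightarrow> Ck k U f \<Longrightarrow> continuous_on U f"
  using Ck_mono[of U k f 0] by simp

lemma Ck_pd: "Ck (Suc k) U f \<Longrightarrow> Ck k U (pd f i)"
  by simp

lemma Ck_has_derivative: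
  assumes "open U" "Ck (Suc k) U f" "x \<in> U"
  shows "(f has_derivative (\<lambda>v. \<Sum>i\<in>UNIV. v $ i * pd f i x)) (at x)"
  using assms Ck_continuous_on[OF assms(1) Ck_pd[OF assms(2)]]
  by (intro Ck1_has_derivative_aux) auto

lemma Ck_curve_deriv:
  assumes "open U" "Ck (Suc k) U f" "\<gamma> t \<in> U" "(\<gamma> has_vector_derivative v) (at t)"
  shows "((\<lambda>t. f (\<gamma> t)) has_real_derivative (\<Sum>i\<in>UNIV. v $ i * pd f i (\<gamma> t))) (at t)"
proof -
  have "((f \<circ> \<gamma>) has_derivative (\<lambda>v. \<Sum>i\<in>UNIV. v $ i * pd f i (\<gamma> t)) \<circ> (\<lambda>s. s *\<^sub>R v)) (at t)"
    using assms(4) by (intro diff_chain_at Ck_has_derivative[OF assms(1-3)]) (simp add: has_vector_derivative_def)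
  then show ?thesis
    unfolding has_field_derivative_def o_def
    by (rule has_derivative_eq_rhs) (auto simp: fun_eq_iff sum_distrib_left mult_ac)
qed

section \<open>Closure properties of C^k functions\<close>

lemma Ck_const: "open U \<Longrightarrow> Ck k U (\<lambda>_. c)"
proof (induction k arbitrary: c)
  case (Suc k)
  then show ?case by (intro Ck_SucI[where D = "\<lambda>_ _. 0"]) auto
qed simp

lemma Ck_coord: "open U \<Longrightarrow> Ck k U (\<lambda>y. y $ j)"
proof (cases k)
  case (Suc k')
  assume "open U"
  then show ?thesis unfolding Suc
    by (intro Ck_SucI[where D = "\<lambda>i _. axis i 1 $ j"] Ck_const)
      (auto intro!: derivative_eq_intros)
qed (auto intro: continuous_intros)

lemma Ck_add:
  assumes "open U" "Ck k U f" "Ck k U g"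
  shows "Ck k U (\<lambda>x. f x + g x)"
  using assms(2,3)
proof (induction k arbitrary: f g)
  case (Suc k)
  then show ?case
    by (intro Ck_SucI[where D = "\<lambda>i x. pd f i x + pd g i x"] assms(1)) (auto intro: DERIV_add)
qed (auto intro: continuous_intros)

lemma Ck_mult:
  assumes "open U" "Ck k U f" "Ck k U g"
  shows "Ck k U (\<lambda>x. f x * g x)"
  using assms(2,3)
proof (induction k arbitrary: f g)
  case (Suc k)
  note m = Ck_Suc_mono[OF assms(1) Suc.prems(1)] Ck_Suc_mono[OF assms(1) Suc.prems(2)]
  show ?case
  proof (rule Ck_SucI[where D = "\<lambda>i x. pd f i x * g x + pd g i x * f x"])
    fix x i assume "x \<in> U"
    then have "((\<lambda>t. f (x + t *\<^sub>R axis i 1)) has_real_derivative pd f i x) (at 0)"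
      "((\<lambda>t. g (x + t *\<^sub>R axis i 1)) has_real_derivative pd g i x) (at 0)"
      using Suc.prems by auto
    from DERIV_mult[OF this]
    show "((\<lambda>t. f (x + t *\<^sub>R axis i 1) * g (x + t *\<^sub>R axis i 1)) has_real_derivative
        pd f i x * g x + pd g i x * f x) (at 0)" by simp
  next
    fix i
    show "Ck k U (\<lambda>x. pd f i x * g x + pd g i x * f x)"
      using Suc m by (intro Ck_add assms(1)) auto
  qed (rule assms(1))
qed (auto intro: continuous_intros)

lemma Ck_sum:
  assumes "open U" "finite A" "\<And>a. a \<in> A \<Longrightarrow> Ck k U (f a)"
  shows "Ck k U (\<lambda>x. \<Sum>a\<in>A. f a x)"
  using assms(2,3) by (induction A rule: finite_induct) (auto intro: Ck_const Ck_add assms(1))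

lemma Ck_compose:
  fixes \<gamma> :: "real^'p \<Rightarrow> real^'m"
  assumes "open U" "open V" "\<And>y. y \<in> V \<Longrightarrow> \<gamma> y \<in> U"
    and "Ck k U f" "\<And>j. Ck k V (\<lambda>y. \<gamma> y $ j)"
  shows "Ck k V (\<lambda>y. f (\<gamma> y))"
  using assms(4,5)
proof (induction k arbitrary: f)
  case 0
  have "continuous_on V (\<lambda>y. \<chi> j. \<gamma> y $ j)"
    using 0 by (intro continuous_on_vec_lambda) simp
  then have "continuous_on V \<gamma>" by (simp only: vec_nth_inverse)
  then have "continuous_on V (f \<circ> \<gamma>)"
    using 0 assms(3) by (intro continuous_on_compose) (auto intro: continuous_on_subset)
  then show ?case by (simp add: o_def)
next
  case (Suc k)
  show ?case
  proof (rule Ck_SucI[where D = "\<lambda>i y. \<Sum>j\<in>UNIV. pd (\<lambda>y. \<gamma> y $ j) i y * pd f j (\<gamma> y)"])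
    fix y i assume y: "y \<in> V"
    have "((\<lambda>t. \<gamma> (y + t *\<^sub>R axis i 1) $ j) has_real_derivative pd (\<lambda>y. \<gamma> y $ j) i y) (at 0)" for j
      using Suc.prems(2) y by auto
    then have "((\<lambda>t. \<gamma> (y + t *\<^sub>R axis i 1)) has_vector_derivative (\<chi> j. pd (\<lambda>y. \<gamma> y $ j) i y)) (at 0)"
      unfolding has_vector_derivative_def has_field_derivative_def
      by (subst has_derivative_componentwise_within)
        (auto simp: Basis_vec_def inner_axis mult.commute[of _ "pd _ _ _"])
    from Ck_curve_deriv[OF assms(1) Suc.prems(1) _ this]
    show "((\<lambda>t. f (\<gamma> (y + t *\<^sub>R axis i 1))) has_real_derivative
        (\<Sum>j\<in>UNIV. pd (\<lambda>y. \<gamma> y $ j) i y * pd f j (\<gamma> y))) (at 0)"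
      using assms(3)[OF y] by simp
  next
    fix i
    have "Ck k V (\<lambda>y. \<gamma> y $ j)" for j
      by (rule Ck_Suc_mono[OF assms(2) Suc.prems(2)])
    then show "Ck k V (\<lambda>y. \<Sum>j\<in>UNIV. pd (\<lambda>y. \<gamma> y $ j) i y * pd f j (\<gamma> y))"
      using Suc by (intro Ck_sum Ck_mult assms(2)) auto
  qed (rule assms(2))
qed

lemma Ck_powr:
  assumes "open U" "Ck k U g" "\<And>x. x \<in> U \<Longrightarrow> g x > 0"
  shows "Ck k U (\<lambda>x. g x powr s)"
  using assms(2)
proof (induction k arbitrary: s)
  case 0
  then show ?case using assms(3) by (fastforce intro!: continuous_intros)
next
  case (Suc k)
  show ?case
  proof (rule Ck_SucI[where D = "\<lambda>i x. s * g x powr (s - 1) * pd g i x"])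
    fix x i assume x: "x \<in> U"
    then have "((\<lambda>t. g (x + t *\<^sub>R axis i 1)) has_real_derivative pd g i x) (at 0)"
      using Suc.prems by auto
    then show "((\<lambda>t. g (x + t *\<^sub>R axis i 1) powr s) has_real_derivative s * g x powr (s - 1) * pd g i x) (at 0)"
      using DERIV_fun_powr[of "\<lambda>t. g (x + t *\<^sub>R axis i 1)" "pd g i x" 0 s] assms(3)[OF x] by simp
  next
    fix i
    show "Ck k U (\<lambda>x. s * g x powr (s - 1) * pd g i x)"
      using Suc Ck_Suc_mono[OF assms(1) Suc.prems] by (intro Ck_mult Ck_const assms(1)) auto
  qed (rule assms(1))
qed

text \<open>The mixed second difference over a square of side h is symmetric in i and j, and it
  equals h^2 times a value of either mixed derivative at some point near x. Continuity then forces
  the two derivatives to agree.\<close>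

lemma pd_commute:
  assumes "open U" "Ck (Suc (Suc 0)) U f" "x \<in> U"
  shows "pd (pd f i) j x = pd (pd f j) i x"
proof -
  have mvt: "\<exists>s t. 0 < s \<and> s < h \<and> 0 < t \<and> t < h \<and>
      f (x + h *\<^sub>R axis i 1 + h *\<^sub>R axis j 1) - f (x + h *\<^sub>R axis i 1) - f (x + h *\<^sub>R axis j 1) + f x
      = h * h * pd (pd f i) j (x + s *\<^sub>R axis i 1 + t *\<^sub>R axis j 1)"
    if h: "0 < h" and ball: "\<And>s t. 0 \<le> s \<Longrightarrow> s \<le> h \<Longrightarrow> 0 \<le> t \<Longrightarrow> t \<le> h \<Longrightarrow> x + s *\<^sub>R axis i 1 + t *\<^sub>R axis j 1 \<in> U"
    for h i j
  proof -
    let ?y = "\<lambda>s t. x + s *\<^sub>R axis i 1 + t *\<^sub>R axis j 1"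
    define \<phi> where "\<phi> s = f (?y s h) - f (?y s 0)" for s
    have "(\<phi> has_real_derivative pd f i (?y s h) - pd f i (?y s 0)) (at s)" if "0 \<le> s" "s \<le> h" for s
    proof -
      have comm: "?y s t = (x + t *\<^sub>R axis j 1) + s *\<^sub>R axis i 1" for s t by simp
      have "((\<lambda>s. f (?y s t)) has_real_derivative pd f i (?y s t)) (at s)" if "0 \<le> t" "t \<le> h" for t
        unfolding comm using ball[OF \<open>0 \<le> s\<close> \<open>s \<le> h\<close> that] unfolding comm
        by (intro Ck_line_deriv[OF assms(2)])
      from this[of h] this[of 0] show ?thesis unfolding \<phi>_def using h by (intro DERIV_diff) auto
    qed
    then obtain s where s: "0 < s" "s < h" "\<phi> h - \<phi> 0 = (h - 0) * (pd f i (?y s h) - pd f i (?y s 0))"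
      using MVT2[OF h, of \<phi> "\<lambda>s. pd f i (?y s h) - pd f i (?y s 0)"] by auto
    have "((\<lambda>t. pd f i (?y s t)) has_real_derivative pd (pd f i) j (?y s t)) (at t)" if "0 \<le> t" "t \<le> h" for t
      using ball[OF _ _ that, of s] s by (intro Ck_line_deriv[OF Ck_pd[OF assms(2)]]) auto
    then obtain t where "0 < t" "t < h" "pd f i (?y s h) - pd f i (?y s 0) = (h - 0) * pd (pd f i) j (?y s t)"
      using MVT2[OF h, of "\<lambda>t. pd f i (?y s t)" "\<lambda>t. pd (pd f i) j (?y s t)"] by auto
    then show ?thesis using s unfolding \<phi>_def
      by (intro exI[of _ s] exI[of _ t]) (auto simp: algebra_simps)
  qed
  show ?thesis
  proof (rule ccontr)
    assume neq: "pd (pd f i) j x \<noteq> pd (pd f j) i x"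
    define e where "e = \<bar>pd (pd f i) j x - pd (pd f j) i x\<bar> / 2"
    have e: "e > 0" using neq by (simp add: e_def)
    have cont: "continuous_on U (pd (pd f i) j)" for i j
      using assms(2) by simp
    have "\<exists>d>0. \<forall>y. dist y x < d \<longrightarrow> dist (pd (pd f i) j y) (pd (pd f i) j x) < e" for i j
      using cont[of i j] assms(1,3) e by (auto simp: continuous_on_eq_continuous_at continuous_at_eps_delta)
    then obtain d1 d2 where d: "d1 > 0" "d2 > 0"
      "\<And>y. dist y x < d1 \<Longrightarrow> dist (pd (pd f i) j y) (pd (pd f i) j x) < e"
      "\<And>y. dist y x < d2 \<Longrightarrow> dist (pd (pd f j) i y) (pd (pd f j) i x) < e"
      by metis
    obtain r where r: "r > 0" "ball x r \<subseteq> U" using assms(1,3) openE by blast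
    define h where "h = Min {d1, d2, r} / 3"
    have h: "h > 0" "3 * h \<le> d1" "3 * h \<le> d2" "3 * h \<le> r" using d(1,2) r(1) by (auto simp: h_def)
    have near: "dist (x + s *\<^sub>R axis a 1 + t *\<^sub>R axis b 1) x < 3 * h"
      if "0 \<le> s" "s \<le> h" "0 \<le> t" "t \<le> h" for s t a b
    proof -
      have "norm (s *\<^sub>R axis a 1 + t *\<^sub>R axis b (1::real)) \<le> \<bar>s\<bar> + \<bar>t\<bar>"
        by (rule order_trans[OF norm_triangle_ineq]) simp
      then show ?thesis using that h(1) by (simp add: dist_norm add.assoc)
    qed
    have inU: "x + s *\<^sub>R axis a 1 + t *\<^sub>R axis b 1 \<in> U" if "0 \<le> s" "s \<le> h" "0 \<le> t" "t \<le> h" for s t a b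
      using near[OF that, of a b] h(4) r(2) by (auto simp: dist_commute)
    obtain s t where st: "0 < s" "s < h" "0 < t" "t < h"
      "f (x + h *\<^sub>R axis i 1 + h *\<^sub>R axis j 1) - f (x + h *\<^sub>R axis i 1) - f (x + h *\<^sub>R axis j 1) + f x
      = h * h * pd (pd f i) j (x + s *\<^sub>R axis i 1 + t *\<^sub>R axis j 1)"
      using mvt[OF h(1) inU, of i j] by blast
    obtain s' t' where st': "0 < s'" "s' < h" "0 < t'" "t' < h"
      "f (x + h *\<^sub>R axis j 1 + h *\<^sub>R axis i 1) - f (x + h *\<^sub>R axis j 1) - f (x + h *\<^sub>R axis i 1) + f x
      = h * h * pd (pd f j) i (x + s' *\<^sub>R axis j 1 + t' *\<^sub>R axis i 1)"
      using mvt[OF h(1) inU, of j i] by blast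
    have "x + h *\<^sub>R axis j 1 + h *\<^sub>R axis i 1 = x + h *\<^sub>R axis i 1 + h *\<^sub>R axis j 1" by simp
    then have "h * h * pd (pd f i) j (x + s *\<^sub>R axis i 1 + t *\<^sub>R axis j 1)
        = h * h * pd (pd f j) i (x + s' *\<^sub>R axis j 1 + t' *\<^sub>R axis i 1)"
      using st(5) st'(5) by (simp only: diff_right_commute)
    then have eq: "pd (pd f i) j (x + s *\<^sub>R axis i 1 + t *\<^sub>R axis j 1)
        = pd (pd f j) i (x + s' *\<^sub>R axis j 1 + t' *\<^sub>R axis i 1)"
      using h(1) by simp
    have "dist (pd (pd f i) j (x + s *\<^sub>R axis i 1 + t *\<^sub>R axis j 1)) (pd (pd f i) j x) < e"
      using near[of s t i j] st h by (intro d(3)) linarith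
    moreover have "dist (pd (pd f j) i (x + s' *\<^sub>R axis j 1 + t' *\<^sub>R axis i 1)) (pd (pd f j) i x) < e"
      using near[of s' t' j i] st' h by (intro d(4)) linarith
    ultimately show False unfolding eq e_def dist_real_def by (simp add: abs_if split: if_splits)
  qed
qed

text \<open>Four interchanges of neighbouring derivatives: iijj, ijij, jiij, jiji, jjii.\<close>

lemma pd_commute4:
  assumes "open U" "Ck 4 U f" "x \<in> U"
  shows "pd (pd (pd (pd f i) i) j) j x = pd (pd (pd (pd f j) j) i) i x"
proof -
  have C4: "Ck (Suc (Suc (Suc (Suc 0)))) U f" using assms(2) by (simp only: numeral_eq_Suc pred_numeral_simps BitM.simps)
  note p = Ck_pd
  note m = Ck_mono[OF assms(1)]
  have sw: "pd (pd g a) b y = pd (pd g b) a y" if "Ck (Suc (Suc k)) U g" "y \<in> U" for g a b y k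
    by (rule pd_commute[OF assms(1) m[OF that(1)] that(2)]) simp
  have c: "pd g a y = pd g' a y" if "\<And>z. z \<in> U \<Longrightarrow> g z = g' z" "y \<in> U" for g g' a y
    by (rule pd_cong[OF assms(1) that(2)]) (rule that(1))
  have "pd (pd (pd (pd f i) i) j) j x = pd (pd (pd (pd f i) j) i) j x"
    by (rule c[OF sw[OF p[OF C4]] assms(3)])
  also have "\<dots> = pd (pd (pd (pd f j) i) i) j x"
    by (rule c[OF c[OF sw[OF C4]]]) (auto simp: assms(3))
  also have "\<dots> = pd (pd (pd (pd f j) i) j) i x"
    by (rule sw[OF p[OF p[OF C4]] assms(3)])
  also have "\<dots> = pd (pd (pd (pd f j) j) i) i x"
    by (rule c[OF sw[OF p[OF C4]] assms(3)])
  finally show ?thesis .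
qed

section \<open>Second-order jets and gnomonic coordinates\<close>

text \<open>Value a, first derivative b and second derivative c at 0, where the first derivative
  exists near 0 and the second is required only at 0. This is local, stable under the operations
  below and enough for the second-derivative test.\<close>

definition jet2 :: "(real \<Rightarrow> real) \<Rightarrow> real \<Rightarrow> real \<Rightarrow> real \<Rightarrow> bool" where
  "jet2 g a b c \<longleftrightarrow> (\<exists>g'. (\<forall>\<^sub>F t in nhds 0. (g has_real_derivative g' t) (at t)) \<and> g 0 = a \<and> g' 0 = b
    \<and> (g' has_real_derivative c) (at 0))"

lemma jet2I:
  assumes "\<And>t. (g has_real_derivative g' t) (at t)" "(g' has_real_derivative c) (at 0)"
  shows "jet2 g (g 0) (g' 0) c"
  unfolding jet2_def using assms by (intro exI[of _ g']) auto

lemma jet2_tendsto: "jet2 g a b c \<Longrightarrow> (g \<longlongrightarrow> a) (nhds 0)"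
  unfolding jet2_def
  by (metis DERIV_isCont continuous_at eventually_nhds_x_imp_x tendsto_at_iff_tendsto_nhds)

lemma jet2_cong:
  assumes "jet2 g a b c" "\<forall>\<^sub>F t in nhds 0. g t = h t"
  shows "jet2 h a b c"
proof -
  obtain g' where g': "\<forall>\<^sub>F t in nhds 0. (g has_real_derivative g' t) (at t)" "g 0 = a" "g' 0 = b"
    "(g' has_real_derivative c) (at 0)"
    using assms(1) by (auto simp: jet2_def)
  have "\<forall>\<^sub>F t in nhds 0. \<forall>\<^sub>F s in nhds t. g s = h s"
    using assms(2) by (simp add: eventually_eventually)
  with g'(1) have "\<forall>\<^sub>F t in nhds 0. (h has_real_derivative g' t) (at t)"
  proof eventually_elim
    case (elim t)
    then show ?case using DERIV_cong_ev[of t t g h "g' t" "g' t"] by simp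
  qed
  moreover have "h 0 = a" using eventually_nhds_x_imp_x[OF assms(2)] g'(2) by simp
  ultimately show ?thesis using g' by (auto simp: jet2_def)
qed

lemma jet2_add:
  assumes "jet2 g a b c" "jet2 h a' b' c'"
  shows "jet2 (\<lambda>t. g t + h t) (a + a') (b + b') (c + c')"
proof -
  obtain g' h' where "\<forall>\<^sub>F t in nhds 0. (g has_real_derivative g' t) (at t)" "g 0 = a" "g' 0 = b"
    "(g' has_real_derivative c) (at 0)" "\<forall>\<^sub>F t in nhds 0. (h has_real_derivative h' t) (at t)" "h 0 = a'" "h' 0 = b'"
    "(h' has_real_derivative c') (at 0)"
    using assms by (auto simp: jet2_def)
  then show ?thesis unfolding jet2_def
    by (intro exI[of _ "\<lambda>t. g' t + h' t"]) (auto intro: DERIV_add elim: eventually_elim2)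
qed

lemma jet2_mult:
  assumes "jet2 g a b c" "jet2 h a' b' c'"
  shows "jet2 (\<lambda>t. g t * h t) (a * a') (b * a' + b' * a) (c * a' + 2 * b * b' + c' * a)"
proof -
  obtain g' h' where gh: "\<forall>\<^sub>F t in nhds 0. (g has_real_derivative g' t) (at t)" "g 0 = a" "g' 0 = b"
    "(g' has_real_derivative c) (at 0)" "\<forall>\<^sub>F t in nhds 0. (h has_real_derivative h' t) (at t)" "h 0 = a'" "h' 0 = b'"
    "(h' has_real_derivative c') (at 0)"
    using assms by (auto simp: jet2_def)
  have ev: "\<forall>\<^sub>F t in nhds 0. ((\<lambda>t. g t * h t) has_real_derivative g' t * h t + h' t * g t) (at t)"
    using gh(1,5) by eventually_elim (rule DERIV_mult)
  have g0: "(g has_real_derivative b) (at 0)" "(h has_real_derivative b') (at 0)"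
    using eventually_nhds_x_imp_x[OF gh(1)] eventually_nhds_x_imp_x[OF gh(5)] gh by auto
  have "((\<lambda>t. g' t * h t + h' t * g t) has_real_derivative (c * h 0 + b' * g' 0) + (c' * g 0 + b * h' 0)) (at 0)"
    using gh g0 by (intro DERIV_add DERIV_mult) auto
  then show ?thesis unfolding jet2_def using gh ev
    by (intro exI[of _ "\<lambda>t. g' t * h t + h' t * g t"]) (auto simp: algebra_simps)
qed

lemma jet2_const: "jet2 (\<lambda>_. a) a 0 0"
  using jet2I[of "\<lambda>_. a" "\<lambda>_. 0" 0] by simp

lemma jet2_cmult: "jet2 g a b c \<Longrightarrow> jet2 (\<lambda>t. k * g t) (k * a) (k * b) (k * c)"
  using jet2_mult[OF jet2_const[of k], of g a b c] by (simp add: mult.commute)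

lemma jet2_diff: "jet2 g a b c \<Longrightarrow> jet2 h a' b' c' \<Longrightarrow> jet2 (\<lambda>t. g t - h t) (a - a') (b - b') (c - c')"
  using jet2_add[of g a b c "\<lambda>t. - 1 * h t" "- 1 * a'" "- 1 * b'" "- 1 * c'"] jet2_cmult[of h a' b' c' "- 1"] by simp

lemma jet2_sum:
  assumes "finite A" "\<And>i. i \<in> A \<Longrightarrow> jet2 (g i) (a i) (b i) (c i)"
  shows "jet2 (\<lambda>t. \<Sum>i\<in>A. g i t) (\<Sum>i\<in>A. a i) (\<Sum>i\<in>A. b i) (\<Sum>i\<in>A. c i)"
  using assms by (induction A rule: finite_induct) (auto intro: jet2_const jet2_add)

lemma jet2_compose:
  assumes "jet2 (\<lambda>s. G (t0 + s)) a b c" "jet2 \<tau> t0 t1 t2"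
  shows "jet2 (\<lambda>t. G (\<tau> t)) a (b * t1) (c * t1\<^sup>2 + b * t2)"
proof -
  obtain g' where g: "\<forall>\<^sub>F s in nhds 0. ((\<lambda>s. G (t0 + s)) has_real_derivative g' s) (at s)" "G t0 = a" "g' 0 = b"
    "(g' has_real_derivative c) (at 0)"
    using assms(1) by (auto simp: jet2_def)
  obtain \<tau>' where t: "\<forall>\<^sub>F t in nhds 0. (\<tau> has_real_derivative \<tau>' t) (at t)" "\<tau> 0 = t0" "\<tau>' 0 = t1"
    "(\<tau>' has_real_derivative t2) (at 0)"
    using assms(2) by (auto simp: jet2_def)
  have "((\<lambda>t. \<tau> t - t0) \<longlongrightarrow> t0 - t0) (nhds 0)"
    by (intro tendsto_diff jet2_tendsto[OF assms(2)] tendsto_const)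
  then have lim: "filterlim (\<lambda>t. \<tau> t - t0) (nhds 0) (nhds 0)" by simp
  have "\<forall>\<^sub>F t in nhds 0. ((\<lambda>s. G (t0 + s)) has_real_derivative g' (\<tau> t - t0)) (at (\<tau> t - t0))"
    by (rule eventually_compose_filterlim[OF g(1) lim])
  with t(1) have ev: "\<forall>\<^sub>F t in nhds 0. ((\<lambda>t. G (\<tau> t)) has_real_derivative g' (\<tau> t - t0) * \<tau>' t) (at t)"
  proof eventually_elim
    case (elim t)
    have "((\<lambda>t. \<tau> t - t0) has_real_derivative \<tau>' t) (at t)"
      using DERIV_diff[OF elim(1) DERIV_const[of t0]] by simp
    from DERIV_chain2[OF elim(2) this] show ?case by simp
  qed
  have t0: "((\<lambda>t. \<tau> t - t0) has_real_derivative t1) (at 0)"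
    using DERIV_diff[OF eventually_nhds_x_imp_x[OF t(1)] DERIV_const[of t0]] t(3) by simp
  have "((\<lambda>t. g' (\<tau> t - t0)) has_real_derivative c * t1) (at 0)"
    using g(4) t(2) by (intro DERIV_chain2[OF _ t0]) simp
  from DERIV_mult[OF this t(4)]
  have "((\<lambda>t. g' (\<tau> t - t0) * \<tau>' t) has_real_derivative c * t1\<^sup>2 + b * t2) (at 0)"
    using g t by (simp add: power2_eq_square mult_ac)
  then show ?thesis unfolding jet2_def using ev g t
    by (intro exI[of _ "\<lambda>t. g' (\<tau> t - t0) * \<tau>' t"]) auto
qed

lemma jet2_ln:
  assumes "jet2 g a b c" "a > 0"
  shows "jet2 (\<lambda>t. ln (g t)) (ln a) (b / a) (c / a - (b / a)\<^sup>2)"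
proof -
  have ev: "\<forall>\<^sub>F s in nhds (0::real). a + s > 0"
    using eventually_nhds_in_open[of "{- a<..}" 0] assms(2) by (auto elim: eventually_mono)
  have 1: "\<forall>\<^sub>F s in nhds 0. ((\<lambda>s. ln (a + s)) has_real_derivative 1 / (a + s)) (at s)"
    using ev by eventually_elim (auto intro!: derivative_eq_intros)
  have 2: "((\<lambda>s. 1 / (a + s)) has_real_derivative - (1 / a\<^sup>2)) (at 0)"
    using assms(2) by (auto intro!: derivative_eq_intros simp: power2_eq_square)
  have "jet2 (\<lambda>s. ln (a + s)) (ln a) (1 / a) (- (1 / a\<^sup>2))"
    unfolding jet2_def using 1 2 by (intro exI[of _ "\<lambda>s. 1 / (a + s)"]) auto
  from jet2_compose[OF this assms(1)] show ?thesis
    by (simp add: power_divide)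
qed

lemma jet2_exp:
  assumes "jet2 g a b c"
  shows "jet2 (\<lambda>t. exp (g t)) (exp a) (exp a * b) (exp a * (c + b\<^sup>2))"
proof -
  have "jet2 (\<lambda>s. exp (a + s)) (exp (a + 0)) (exp (a + 0)) (exp a)"
    by (rule jet2I) (auto intro!: derivative_eq_intros)
  from jet2_compose[OF this assms] show ?thesis by (simp add: algebra_simps)
qed

lemma jet2_nonneg:
  assumes "jet2 g 0 b c" "\<And>t. \<bar>t\<bar> < d \<Longrightarrow> 0 \<le> g t" "d > 0"
  shows "b = 0" "0 \<le> c"
proof -
  obtain g' where g: "\<forall>\<^sub>F t in nhds 0. (g has_real_derivative g' t) (at t)" "g 0 = 0" "g' 0 = b"
    "(g' has_real_derivative c) (at 0)"
    using assms(1) by (auto simp: jet2_def)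
  then have "(g has_real_derivative b) (at 0)"
    using eventually_nhds_x_imp_x by fastforce
  then show b: "b = 0"
    by (rule DERIV_local_min[OF _ assms(3)]) (use assms(2) g(2) in auto)
  obtain e where e: "e > 0" "\<And>t. \<bar>t\<bar> < e \<Longrightarrow> (g has_real_derivative g' t) (at t)"
    using g(1) by (auto simp: eventually_nhds_metric dist_real_def)
  show "0 \<le> c"
  proof (rule ccontr)
    assume "\<not> 0 \<le> c"
    then obtain e' where e': "e' > 0" "\<And>h. 0 < h \<Longrightarrow> h < e' \<Longrightarrow> g' (0 + h) < g' 0"
      using DERIV_neg_dec_right[OF g(4)] by force
    define t where "t = min d (min e e') / 2"
    have t: "0 < t" "t < d" "t < e" "t < e'" using assms(3) e(1) e'(1) by (auto simp: t_def)
    obtain z where z: "0 < z" "z < t" "g t - g 0 = (t - 0) * g' z"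
      using MVT2[OF t(1), of g g'] e(2) t by auto
    have "g' z < 0" using e'(2)[of z] z t b g(3) by simp
    then have "(t - 0) * g' z < 0" using t(1) by (simp add: mult_pos_neg)
    then show False using z(3) g(2) assms(2)[of t] t by simp
  qed
qed

lemma jet2_tan: "jet2 tan 0 1 0"
proof -
  have ev: "\<forall>\<^sub>F t in nhds (0::real). cos t \<noteq> 0"
  proof -
    have "\<forall>\<^sub>F t in nhds (0::real). t \<in> {- pi/2<..<pi/2}"
      by (rule eventually_nhds_in_open) auto
    then show ?thesis by eventually_elim (auto dest: cos_gt_zero_pi)
  qed
  have 1: "\<forall>\<^sub>F t in nhds (0::real). (tan has_real_derivative inverse ((cos t)\<^sup>2)) (at t)"
    using ev by eventually_elim (rule DERIV_tan)
  have 2: "((\<lambda>t. inverse ((cos t)\<^sup>2)) has_real_derivative 0) (at (0::real))"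
    by (auto intro!: derivative_eq_intros)
  show ?thesis unfolding jet2_def using 1 2
    by (intro exI[of _ "\<lambda>t. inverse ((cos t)\<^sup>2)"]) auto
qed

text \<open>The second derivative 1 found here is the source of the curvature term in the
  interchange of derivatives of W; the reparametrization by tan contributes nothing at second
  order.\<close>

lemma jet2_sec: "jet2 (\<lambda>t. 1 / cos t) 1 0 1"
proof -
  have ev: "\<forall>\<^sub>F t in nhds (0::real). cos t \<noteq> 0"
  proof -
    have "\<forall>\<^sub>F t in nhds (0::real). t \<in> {- pi/2<..<pi/2}"
      by (rule eventually_nhds_in_open) auto
    then show ?thesis by eventually_elim (auto dest: cos_gt_zero_pi)
  qed
  have 1: "\<forall>\<^sub>F t in nhds (0::real). ((\<lambda>t. 1 / cos t) has_real_derivative sin t / (cos t)\<^sup>2) (at t)"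
    using ev by eventually_elim (auto intro!: derivative_eq_intros simp: power2_eq_square)
  have 2: "((\<lambda>t. sin t / (cos t)\<^sup>2) has_real_derivative 1) (at (0::real))"
    by (auto intro!: derivative_eq_intros)
  show ?thesis unfolding jet2_def using 1 2
    by (intro exI[of _ "\<lambda>t. sin t / (cos t)\<^sup>2"]) auto
qed

section \<open>Great circles and gnomonic projection\<close>

definition gc :: "real^'m \<Rightarrow> real^'m \<Rightarrow> real \<Rightarrow> real^'m" where
  "gc x v t = cos t *\<^sub>R x + sin t *\<^sub>R v"

definition gc_vel :: "real^'m \<Rightarrow> real^'m \<Rightarrow> real \<Rightarrow> real^'m" where
  "gc_vel x v t = cos t *\<^sub>R v - sin t *\<^sub>R x"

definition unit_tangent :: "real^'m \<Rightarrow> real^'m \<Rightarrow> bool" where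
  "unit_tangent x v \<longleftrightarrow> norm x = 1 \<and> norm v = 1 \<and> v \<bullet> x = 0"

lemma unit_tangent_inner:
  "unit_tangent x v \<longleftrightarrow> x \<bullet> x = 1 \<and> v \<bullet> v = 1 \<and> v \<bullet> x = 0 \<and> x \<bullet> v = 0"
  by (auto simp: unit_tangent_def norm_eq_1 inner_commute)

lemma gc_0 [simp]: "gc x v 0 = x" "gc_vel x v 0 = v"
  by (simp_all add: gc_def gc_vel_def)

lemma gc_unit_tangent:
  assumes "unit_tangent x v"
  shows "unit_tangent (gc x v t) (gc_vel x v t)"
  using assms sin_cos_squared_add[of t] unfolding unit_tangent_inner
  by (simp add: gc_def gc_vel_def inner_add_left inner_add_right inner_diff_left inner_diff_right
      power2_eq_square add.commute)

lemma gc_norm: "unit_tangent x v \<Longrightarrow> norm (gc x v t) = 1"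
  using gc_unit_tangent unit_tangent_def by blast

text \<open>A vector orthogonal to x and v, kept constant in the ambient space, is the parallel
  field along the great circle.\<close>

lemma gc_tangent:
  assumes "unit_tangent x v" "unit_tangent x w" "w \<bullet> v = 0"
  shows "unit_tangent (gc x v t) w"
  using gc_norm[OF assms(1)] assms by (simp add: unit_tangent_def gc_def inner_add_right)

lemma gc_deriv:
  "(gc x v has_vector_derivative gc_vel x v t) (at t)"
  "(gc_vel x v has_vector_derivative - gc x v t) (at t)"
  unfolding gc_def[abs_def] gc_vel_def[abs_def]
  by (auto intro!: derivative_eq_intros simp: algebra_simps)

text \<open>Great circles are geodesics: the acceleration \<open>- gc x v t\<close> is purely normal
  and accounts for the term \<open>- (egrad f x \<bullet> x)\<close> in
  \<open>shess\<close>.\<close>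

lemma gc_function_deriv:
  assumes "open U" "sphere 0 1 \<subseteq> U" "Ck 2 U f" "unit_tangent x v"
  defines "f' \<equiv> \<lambda>t. egrad f (gc x v t) \<bullet> gc_vel x v t"
  shows "((\<lambda>t. f (gc x v t)) has_real_derivative f' t) (at t)"
    and "(f' has_real_derivative shess f (gc x v t) (gc_vel x v t) (gc_vel x v t)) (at t)"
proof -
  have C2: "Ck (Suc (Suc 0)) U f" using assms(3) by (simp only: numeral_2_eq_2)
  have inU: "gc x v t \<in> U" for t using gc_norm[OF assms(4), of t] assms(2) by auto
  have f': "f' t = (\<Sum>j\<in>UNIV. gc_vel x v t $ j * pd f j (gc x v t))" for t
    by (simp add: f'_def egrad_def inner_vec_def mult.commute)
  show "((\<lambda>t. f (gc x v t)) has_real_derivative f' t) (at t)"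
    unfolding f' by (rule Ck_curve_deriv[OF assms(1) C2 inU gc_deriv(1)])
  have comp: "((\<lambda>t. gc_vel x v t $ j) has_real_derivative - (gc x v t $ j)) (at t)" for j
    unfolding gc_vel_def gc_def by (auto intro!: derivative_eq_intros)
  have "((\<lambda>t. \<Sum>j\<in>UNIV. gc_vel x v t $ j * pd f j (gc x v t)) has_real_derivative
      (\<Sum>j\<in>UNIV. - (gc x v t $ j) * pd f j (gc x v t)
        + (\<Sum>i\<in>UNIV. gc_vel x v t $ i * pd (pd f j) i (gc x v t)) * gc_vel x v t $ j)) (at t)"
    by (intro DERIV_sum DERIV_mult comp Ck_curve_deriv[OF assms(1) Ck_pd[OF C2] inU gc_deriv(1)])
  also have "(\<Sum>j\<in>UNIV. - (gc x v t $ j) * pd f j (gc x v t)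
        + (\<Sum>i\<in>UNIV. gc_vel x v t $ i * pd (pd f j) i (gc x v t)) * gc_vel x v t $ j)
     = shess f (gc x v t) (gc_vel x v t) (gc_vel x v t)"
  proof -
    have "gc_vel x v t \<bullet> gc_vel x v t = 1"
      using gc_unit_tangent[OF assms(4), of t] by (simp add: unit_tangent_inner)
    moreover have "egrad f (gc x v t) \<bullet> gc x v t = (\<Sum>j\<in>UNIV. gc x v t $ j * pd f j (gc x v t))"
      by (simp add: egrad_def inner_vec_def mult.commute)
    moreover have "(\<Sum>j\<in>UNIV. (\<Sum>i\<in>UNIV. gc_vel x v t $ i * pd (pd f j) i (gc x v t)) * gc_vel x v t $ j)
      = (\<Sum>i\<in>UNIV. \<Sum>j\<in>UNIV. gc_vel x v t $ i * gc_vel x v t $ j * pd (pd f j) i (gc x v t))"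
      unfolding sum_distrib_right by (subst sum.swap) (simp add: mult_ac)
    ultimately show ?thesis
      unfolding shess_def by (simp add: sum_subtractf)
  qed
  finally show "(f' has_real_derivative shess f (gc x v t) (gc_vel x v t) (gc_vel x v t)) (at t)"
    unfolding f'[abs_def] .
qed

text \<open>The tensor W on the diagonal, for unit vectors: the term \<open>f x\<close> carries no
  factor v . v.\<close>

definition Wq :: "((real^'m) \<Rightarrow> real) \<Rightarrow> real^'m \<Rightarrow> real^'m \<Rightarrow> real" where
  "Wq f x v = shess f x v v + f x"

text \<open>Why U + U'' appears: on a straight line at distance rho from the origin, the degree-one
  extension is the radius sqrt(rho^2 + t^2) times U of the angle arctan(t / rho). In its second
  derivative the first derivatives of U cancel.\<close>

lemma gnomonic_deriv:
  assumes U: "\<And>t. (U has_real_derivative U1 t) (at t)" "\<And>t. (U1 has_real_derivative U2 t) (at t)"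
    and \<rho>: "\<rho> > 0"
  shows "((\<lambda>t. sqrt (\<rho>\<^sup>2 + t\<^sup>2) * U (arctan (t / \<rho>))) has_real_derivative
      (t * U (arctan (t / \<rho>)) + \<rho> * U1 (arctan (t / \<rho>))) / sqrt (\<rho>\<^sup>2 + t\<^sup>2)) (at t)" (is ?A)
    and "((\<lambda>t. (t * U (arctan (t / \<rho>)) + \<rho> * U1 (arctan (t / \<rho>))) / sqrt (\<rho>\<^sup>2 + t\<^sup>2)) has_real_derivative
      \<rho>\<^sup>2 * (U (arctan (t / \<rho>)) + U2 (arctan (t / \<rho>))) / sqrt (\<rho>\<^sup>2 + t\<^sup>2) ^ 3) (at t)" (is ?B)
proof -
  define R where "R t = sqrt (\<rho>\<^sup>2 + t\<^sup>2)" for t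
  have pos: "\<rho>\<^sup>2 + t\<^sup>2 > 0" for t using \<rho> by (simp add: add_pos_nonneg)
  have R: "R t > 0" "R t * R t = \<rho>\<^sup>2 + t\<^sup>2" for t
    using pos[of t] by (simp_all add: R_def)
  have dR: "(R has_real_derivative t / R t) (at t)" for t
    unfolding R_def[abs_def] using pos[of t]
    by (auto intro!: derivative_eq_intros simp: field_simps)
  have dat: "((\<lambda>t. arctan (t / \<rho>)) has_real_derivative \<rho> / (R t * R t)) (at t)" for t
  proof -
    have "((\<lambda>t. arctan (t / \<rho>)) has_real_derivative inverse (1 + (t / \<rho>)\<^sup>2) * (1 / \<rho>)) (at t)"
      using \<rho> by (auto intro!: derivative_eq_intros)
    moreover have "inverse (1 + (t / \<rho>)\<^sup>2) * (1 / \<rho>) = \<rho> / (R t * R t)"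
      unfolding R(2) using \<rho> pos[of t] by (simp add: field_simps power2_eq_square)
    ultimately show ?thesis by simp
  qed
  note dU = DERIV_chain2[OF U(1) dat] and dU1 = DERIV_chain2[OF U(2) dat]
  let ?U = "U (arctan (t / \<rho>))" and ?U1 = "U1 (arctan (t / \<rho>))" and ?U2 = "U2 (arctan (t / \<rho>))"
  have "((\<lambda>t. R t * U (arctan (t / \<rho>))) has_real_derivative t / R t * ?U + (?U1 * (\<rho> / (R t * R t))) * R t) (at t)"
    by (intro DERIV_mult dR dU)
  moreover have "t / R t * ?U + (?U1 * (\<rho> / (R t * R t))) * R t = (t * ?U + \<rho> * ?U1) / R t"
    using R(1)[of t] by (simp add: field_simps)
  ultimately show ?A unfolding R_def[symmetric] by simp
  have "((\<lambda>t. (t * U (arctan (t / \<rho>)) + \<rho> * U1 (arctan (t / \<rho>))) / R t) has_real_derivative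
     ((1 * ?U + ?U1 * (\<rho> / (R t * R t)) * t + \<rho> * (?U2 * (\<rho> / (R t * R t)))) * R t - (t * ?U + \<rho> * ?U1) * (t / R t))
       / (R t * R t)) (at t)"
    using R(1)[of t] by (intro DERIV_divide DERIV_add DERIV_mult DERIV_cmult dR dU dU1 DERIV_ident) auto
  moreover have "((1 * ?U + ?U1 * (\<rho> / (R t * R t)) * t + \<rho> * (?U2 * (\<rho> / (R t * R t)))) * R t - (t * ?U + \<rho> * ?U1) * (t / R t))
       / (R t * R t) = \<rho>\<^sup>2 * (?U + ?U2) / R t ^ 3"
  proof -
    have "(1 * ?U + ?U1 * (\<rho> / (R t * R t)) * t + \<rho> * (?U2 * (\<rho> / (R t * R t)))) * R t - (t * ?U + \<rho> * ?U1) * (t / R t)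
      = (?U * (R t * R t) + \<rho>\<^sup>2 * ?U2 - t\<^sup>2 * ?U) / R t"
      using R(1)[of t] by (simp add: field_simps power2_eq_square)
    also have "\<dots> = \<rho>\<^sup>2 * (?U + ?U2) / R t" unfolding R(2) by (simp add: algebra_simps)
    finally show ?thesis by (simp add: power3_eq_cube mult_ac)
  qed
  ultimately show ?B unfolding R_def[symmetric] by simp
qed

lemma pd_line_eqI:
  assumes "\<And>t. f (y + t *\<^sub>R axis j 1) = h t"
    and "\<And>t. (h has_real_derivative h' t) (at t)" "\<And>t. (h' has_real_derivative h'' t) (at t)"
  shows "pd (pd f j) j (y + t *\<^sub>R axis j 1) = h'' t"
proof -
  have sh: "((\<lambda>s. g (t + s)) has_real_derivative d) (at 0)" if "(g has_real_derivative d) (at t)" for g d t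
    using that DERIV_shift[of g d 0 t] by (simp add: add.commute)
  have line: "y + t *\<^sub>R axis j 1 + s *\<^sub>R axis j 1 = y + (t + s) *\<^sub>R axis j 1" for t s
    by (simp add: scaleR_add_left)
  have 1: "pd f j (y + t *\<^sub>R axis j 1) = h' t" for t
    by (rule pd_eqI) (unfold line assms(1), rule sh[OF assms(2)])
  show ?thesis
    by (rule pd_eqI) (unfold line 1, rule sh[OF assms(3)])
qed

text \<open>The degree-one homogeneous extension of \<open>f\<close> restricted to the affine tangent plane at \<open>x\<close>:
  its Euclidean Hessian is \<open>W\<close> up to a factor.\<close>

definition gnom :: "((real^'m) \<Rightarrow> real) \<Rightarrow> real^'m \<Rightarrow> ('p \<Rightarrow> real^'m) \<Rightarrow> real^'p \<Rightarrow> real" where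
  "gnom f x d y = sqrt (1 + y \<bullet> y) * f ((1 / sqrt (1 + y \<bullet> y)) *\<^sub>R (x + (\<Sum>i\<in>UNIV. y $ i *\<^sub>R d i)))"

lemma gnom_Ck:
  fixes d :: "'p::finite \<Rightarrow> real^'m"
  assumes "open U" "sphere 0 1 \<subseteq> U" "Ck k U f" "norm x = 1"
    and d: "\<And>i. d i \<bullet> x = 0" "\<And>i j. d i \<bullet> d j = (if i = j then 1 else 0)"
  shows "Ck k UNIV (gnom f x d)"
proof -
  let ?s = "\<lambda>y::real^'p. 1 + (\<Sum>i\<in>UNIV. y $ i * y $ i)"
  have s: "?s y = 1 + y \<bullet> y" for y by (simp add: inner_vec_def)
  have pos: "?s y > 0" for y by (simp add: s add_pos_nonneg)
  have Cs: "Ck k UNIV ?s" by (intro Ck_add Ck_const Ck_sum Ck_mult Ck_coord) auto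
  let ?g = "\<lambda>y. (?s y powr (- 1 / 2)) *\<^sub>R (x + (\<Sum>i\<in>UNIV. y $ i *\<^sub>R d i))"
  have pw: "?s y powr (1/2) = sqrt (1 + y \<bullet> y)" "?s y powr (- 1/2) = 1 / sqrt (1 + y \<bullet> y)" for y
    using pos[of y] unfolding s by (simp_all add: powr_half_sqrt powr_minus_divide)
  have nrm: "norm (?g y) = 1" for y
  proof -
    let ?S = "\<Sum>i\<in>UNIV. y $ i *\<^sub>R d i"
    have xS: "x \<bullet> ?S = 0" using d(1) by (simp add: inner_sum_right inner_commute[of x])
    have "?S \<bullet> ?S = (\<Sum>i\<in>UNIV. \<Sum>j\<in>UNIV. y $ i * (y $ j * (d j \<bullet> d i)))"
      by (simp add: inner_sum_left inner_sum_right sum_distrib_left)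
    also have "\<dots> = y \<bullet> y"
      by (simp add: d(2) if_distrib sum.delta cong: if_cong) (simp add: inner_vec_def)
    finally have "?S \<bullet> ?S = y \<bullet> y" .
    then have "(x + ?S) \<bullet> (x + ?S) = 1 + y \<bullet> y"
      using assms(4) xS by (simp add: inner_add_left inner_add_right norm_eq_1 inner_commute[of ?S x])
    then have "norm (x + ?S) = sqrt (1 + y \<bullet> y)" by (simp add: norm_eq_sqrt_inner)
    then have "norm ((1 / sqrt (1 + y \<bullet> y)) *\<^sub>R (x + ?S)) = 1"
      using pos[of y] unfolding s by simp
    then show ?thesis by (simp only: pw)
  qed
  have comp: "Ck k UNIV (\<lambda>y. ?g y $ j)" for j
  proof -
    have eq: "?g y $ j = ?s y powr (- 1 / 2) * (x $ j + (\<Sum>i\<in>UNIV. y $ i * d i $ j))" for y by simp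
    show ?thesis unfolding eq
      by (intro Ck_add Ck_const Ck_sum Ck_mult Ck_coord Ck_powr Cs pos) auto
  qed
  have "Ck k UNIV (\<lambda>y. ?s y powr (1/2) * f (?g y))"
    by (intro Ck_mult Ck_powr Cs pos Ck_compose[OF assms(1) _ _ assms(3) comp]) (use nrm assms(2) in auto)
  moreover have "gnom f x d y = ?s y powr (1/2) * f (?g y)" for y
    unfolding gnom_def pw by simp
  ultimately show ?thesis by (simp add: Ck_cong[of UNIV])
qed

text \<open>Lines in the affine tangent plane project to great circles, and the point x + tan
  \<theta> d i lies at distance 1 / cos \<theta> above the point at angle \<theta>. Transversally to
  d i, the line through it has rho = 1 / cos \<theta> and t = 0, which gives the factor 1 / cos
  \<theta>. Along d i one has rho = 1 and t = tan \<theta>, which gives its cube.\<close>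

lemma gnom_hess:
  fixes d :: "'p::finite \<Rightarrow> real^'m"
  assumes "open U" "sphere 0 1 \<subseteq> U" "Ck 2 U f" "norm x = 1"
    and d: "\<And>i. d i \<bullet> x = 0" "\<And>i j. d i \<bullet> d j = (if i = j then 1 else 0)"
    and \<theta>: "\<bar>\<theta>\<bar> < pi / 2"
  shows "i \<noteq> j \<Longrightarrow> Wq f (gc x (d i) \<theta>) (d j)
      = pd (pd (gnom f x d) j) j (0 + tan \<theta> *\<^sub>R axis i 1) * (1 / cos \<theta>)"
    and "Wq f (gc x (d i) \<theta>) (gc_vel x (d i) \<theta>)
      = pd (pd (gnom f x d) i) i (0 + tan \<theta> *\<^sub>R axis i 1) * (1 / cos \<theta> * (1 / cos \<theta> * (1 / cos \<theta>)))"
proof -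
  have c: "cos \<theta> > 0" using \<theta> by (intro cos_gt_zero_pi) auto
  have ut: "unit_tangent x (d k)" for k
    using assms(4) d[of k] by (simp add: unit_tangent_def norm_eq_1)
  have at: "cos (arctan s) = 1 / sqrt (1 + s\<^sup>2)" "sin (arctan s) = s / sqrt (1 + s\<^sup>2)" for s
    by (simp_all add: cos_arctan sin_arctan)
  have sum_ax: "(\<Sum>k\<in>UNIV. (b *\<^sub>R axis i (1::real) + t *\<^sub>R axis j 1) $ k *\<^sub>R d k) = b *\<^sub>R d i + t *\<^sub>R d j" for b t i j
    by (simp add: axis_def scaleR_add_left sum.distrib if_distrib[of "\<lambda>z. z *\<^sub>R _"] if_distrib[of "\<lambda>z. _ * z"]
        cong: if_cong)
  have gn: "gnom f x d (y0 + t *\<^sub>R axis j 1) = sqrt (\<rho>\<^sup>2 + t\<^sup>2) * f (gc X (d j) (arctan (t / \<rho>)))"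
    if "\<rho> > 0" "1 + (y0 + t *\<^sub>R axis j 1) \<bullet> (y0 + t *\<^sub>R axis j 1) = \<rho>\<^sup>2 + t\<^sup>2"
      "x + (\<Sum>k\<in>UNIV. (y0 + t *\<^sub>R axis j 1) $ k *\<^sub>R d k) = \<rho> *\<^sub>R X + t *\<^sub>R d j" for \<rho> y0 t X j
  proof -
    have sq: "sqrt (\<rho>\<^sup>2 + t\<^sup>2) = \<rho> * sqrt (1 + (t / \<rho>)\<^sup>2)"
    proof -
      have "\<rho>\<^sup>2 + t\<^sup>2 = \<rho>\<^sup>2 * (1 + (t / \<rho>)\<^sup>2)" using that(1) by (simp add: field_simps)
      then show ?thesis using that(1) by (simp add: real_sqrt_mult)
    qed
    have p: "sqrt (1 + (t / \<rho>)\<^sup>2) > 0" by (simp add: add_pos_nonneg)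
    have "(1 / sqrt (\<rho>\<^sup>2 + t\<^sup>2)) *\<^sub>R (\<rho> *\<^sub>R X + t *\<^sub>R d j) = gc X (d j) (arctan (t / \<rho>))"
      unfolding gc_def at sq using that(1) p by (simp add: scaleR_add_right)
    then show ?thesis unfolding gnom_def that(2,3) by simp
  qed
  show "Wq f (gc x (d i) \<theta>) (d j) = pd (pd (gnom f x d) j) j (0 + tan \<theta> *\<^sub>R axis i 1) * (1 / cos \<theta>)"
    if ij: "i \<noteq> j"
  proof -
    let ?X = "gc x (d i) \<theta>" and ?\<rho> = "1 / cos \<theta>"
    have utX: "unit_tangent ?X (d j)" using gc_tangent[OF ut ut] d(2) ij by simp
    note U = gc_function_deriv[OF assms(1-3) utX]
    have rho: "?\<rho> > 0" using c by simp
    have rho2: "?\<rho>\<^sup>2 = 1 + (tan \<theta>)\<^sup>2" using tan_sec[of \<theta>] c by (simp add: inverse_eq_divide power_divide)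
    have n: "1 + (tan \<theta> *\<^sub>R axis i (1::real) + t *\<^sub>R axis j 1) \<bullet> (tan \<theta> *\<^sub>R axis i 1 + t *\<^sub>R axis j 1) = ?\<rho>\<^sup>2 + t\<^sup>2" for t
      unfolding rho2 using ij by (simp add: inner_add_left inner_add_right inner_axis_axis power2_eq_square)
    have X: "x + (\<Sum>k\<in>UNIV. (tan \<theta> *\<^sub>R axis i 1 + t *\<^sub>R axis j 1) $ k *\<^sub>R d k) = ?\<rho> *\<^sub>R ?X + t *\<^sub>R d j" for t
      unfolding sum_ax using c by (simp add: gc_def scaleR_add_right tan_def)
    have "pd (pd (gnom f x d) j) j (tan \<theta> *\<^sub>R axis i 1 + 0 *\<^sub>R axis j 1)
       = ?\<rho>\<^sup>2 * (f (gc ?X (d j) (arctan (0 / ?\<rho>))) + shess f (gc ?X (d j) (arctan (0 / ?\<rho>)))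
            (gc_vel ?X (d j) (arctan (0 / ?\<rho>))) (gc_vel ?X (d j) (arctan (0 / ?\<rho>)))) / sqrt (?\<rho>\<^sup>2 + 0\<^sup>2) ^ 3"
      by (rule pd_line_eqI[OF gn[OF rho n X] gnomonic_deriv[OF U rho]])
    then have "pd (pd (gnom f x d) j) j (0 + tan \<theta> *\<^sub>R axis i 1) = Wq f ?X (d j) * cos \<theta>"
      using c by (simp add: Wq_def power_divide real_sqrt_divide power2_eq_square power3_eq_cube add.commute)
    then show ?thesis using c by simp
  qed
  show "Wq f (gc x (d i) \<theta>) (gc_vel x (d i) \<theta>)
      = pd (pd (gnom f x d) i) i (0 + tan \<theta> *\<^sub>R axis i 1) * (1 / cos \<theta> * (1 / cos \<theta> * (1 / cos \<theta>)))"
  proof -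
    note U = gc_function_deriv[OF assms(1-3) ut[of i]]
    have n: "1 + (0 + t *\<^sub>R axis i (1::real)) \<bullet> (0 + t *\<^sub>R axis i 1) = 1\<^sup>2 + t\<^sup>2" for t :: real
      by (simp add: inner_axis_axis power2_eq_square)
    have X: "x + (\<Sum>k\<in>UNIV. (0 + t *\<^sub>R axis i 1) $ k *\<^sub>R d k) = 1 *\<^sub>R x + t *\<^sub>R d i" for t
      using sum_ax[of 0 i t i] by simp
    have at': "arctan (tan \<theta> / 1) = \<theta>" using \<theta> by (simp add: arctan_tan)
    have sq: "sqrt (1\<^sup>2 + (tan \<theta>)\<^sup>2) = 1 / cos \<theta>"
      using tan_sec[of \<theta>] c by (simp add: inverse_eq_divide real_sqrt_divide)
    have "pd (pd (gnom f x d) i) i (0 + tan \<theta> *\<^sub>R axis i 1)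
       = 1\<^sup>2 * (f (gc x (d i) (arctan (tan \<theta> / 1))) + shess f (gc x (d i) (arctan (tan \<theta> / 1)))
            (gc_vel x (d i) (arctan (tan \<theta> / 1))) (gc_vel x (d i) (arctan (tan \<theta> / 1)))) / sqrt (1\<^sup>2 + (tan \<theta>)\<^sup>2) ^ 3"
      by (rule pd_line_eqI[OF gn[OF zero_less_one n X] gnomonic_deriv[OF U zero_less_one]])
    then show ?thesis
      unfolding at' sq using c by (simp add: Wq_def power3_eq_cube)
  qed
qed

lemma jet2_pd_line:
  assumes "Ck (Suc (Suc 0)) UNIV h"
  shows "jet2 (\<lambda>t. h (0 + t *\<^sub>R axis i 1)) (h 0) (pd h i 0) (pd (pd h i) i 0)"
proof -
  have "jet2 (\<lambda>t. h (0 + t *\<^sub>R axis i 1)) (h (0 + 0 *\<^sub>R axis i 1)) (pd h i (0 + 0 *\<^sub>R axis i 1))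
      (pd (pd h i) i (0 + 0 *\<^sub>R axis i 1))"
    by (rule jet2I; rule Ck_line_deriv[OF assms] Ck_line_deriv[OF Ck_pd[OF assms]]) simp_all
  then show ?thesis by simp
qed

lemma eventually_abs_lt_pi_half: "\<forall>\<^sub>F t in nhds (0::real). \<bar>t\<bar> < pi / 2"
proof -
  have "\<forall>\<^sub>F t in nhds (0::real). t \<in> {- (pi/2)<..<pi/2}"
    by (rule eventually_nhds_in_open) auto
  then show ?thesis by eventually_elim auto
qed

text \<open>Interchanging the order of the covariant derivatives \<open>W\<^sub>q\<^sub>q\<^sub>,\<^sub>p\<^sub>p\<close> and \<open>W\<^sub>p\<^sub>p\<^sub>,\<^sub>q\<^sub>q\<close>
  costs \<open>W\<^sub>q\<^sub>q - W\<^sub>p\<^sub>p\<close>: in gnomonic coordinates both are the same mixed fourth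
  derivative up to a conformal factor.\<close>

lemma Wq_jets:
  assumes "open U" "sphere 0 1 \<subseteq> U" "Ck 4 U f"
    and "unit_tangent x p" "unit_tangent x q" "q \<bullet> p = 0"
  obtains b b' D where
    "jet2 (\<lambda>t. Wq f (gc x p t) q) (Wq f x q) b (D + Wq f x q)"
    "jet2 (\<lambda>t. Wq f (gc x q t) p) (Wq f x p) b' (D + Wq f x p)"
proof -
  \<comment> \<open>Only the plane spanned by p and q matters, so the chart is two-dimensional and
    indexed by \<open>bool\<close>.\<close>
  define d where "d i = (if i then p else q)" for i
  have nx: "norm x = 1" using assms(4) by (simp add: unit_tangent_def)
  have d: "d i \<bullet> x = 0" "d i \<bullet> d j = (if i = j then 1 else 0)" for i j
    using assms(4-6) by (auto simp: d_def unit_tangent_inner inner_commute)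
  have C2: "Ck 2 U f" by (rule Ck_mono[OF assms(1,3)]) simp
  let ?G = "gnom f x d"
  have C4: "Ck 4 UNIV ?G" by (rule gnom_Ck[OF assms(1-3) nx d])
  then have C4': "Ck (Suc (Suc (Suc (Suc 0)))) UNIV ?G"
    by (simp only: numeral_eq_Suc pred_numeral_simps BitM.simps)
  note hess = gnom_hess[OF assms(1,2) C2 nx d]
  have base: "pd (pd ?G j) j 0 = Wq f x (d j)" for j
    using hess(1)[of 0 "\<not> j" j] by simp
  have main: "\<exists>b. jet2 (\<lambda>t. Wq f (gc x (d i) t) (d j)) (Wq f x (d j)) b (pd (pd (pd (pd ?G j) j) i) i 0 + Wq f x (d j))"
    if ij: "i \<noteq> j" for i j
  proof -
    let ?h = "pd (pd ?G j) j"
    have "jet2 (\<lambda>s. ?h (0 + (0 + s) *\<^sub>R axis i 1)) (?h 0) (pd ?h i 0) (pd (pd ?h i) i 0)"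
      using jet2_pd_line[OF Ck_pd[OF Ck_pd[OF C4']]] by simp
    from jet2_mult[OF jet2_compose[OF this jet2_tan] jet2_sec]
    have "jet2 (\<lambda>t. ?h (0 + tan t *\<^sub>R axis i 1) * (1 / cos t)) (?h 0) (pd ?h i 0) (pd (pd ?h i) i 0 + ?h 0)"
      by simp
    moreover have "\<forall>\<^sub>F t in nhds 0. ?h (0 + tan t *\<^sub>R axis i 1) * (1 / cos t) = Wq f (gc x (d i) t) (d j)"
      using eventually_abs_lt_pi_half by eventually_elim (simp only: hess(1)[OF _ ij])
    ultimately have "jet2 (\<lambda>t. Wq f (gc x (d i) t) (d j)) (?h 0) (pd ?h i 0) (pd (pd ?h i) i 0 + ?h 0)"
      by (rule jet2_cong)
    then show ?thesis unfolding base by blast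
  qed
  have comm: "pd (pd (pd (pd ?G False) False) True) True 0 = pd (pd (pd (pd ?G True) True) False) False 0"
    by (rule pd_commute4[OF open_UNIV C4]) simp
  from main[of True False] main[of False True] that show ?thesis
    unfolding comm by (auto simp: d_def)
qed

text \<open>The direction p itself has to turn with the circle, so this is the longitudinal factor
  in a one-dimensional chart. Only the existence of the jet is asserted; its second-order entry is
  estimated later by the maximum property.\<close>

lemma Wq_jet_self:
  assumes "open U" "sphere 0 1 \<subseteq> U" "Ck 4 U f" "unit_tangent x p"
  obtains b c where "jet2 (\<lambda>t. Wq f (gc x p t) (gc_vel x p t)) (Wq f x p) b c"
proof -
  define d where "d i = p" for i :: unit
  have nx: "norm x = 1" using assms(4) by (simp add: unit_tangent_def)
  have d: "d i \<bullet> x = 0" "d i \<bullet> d j = (if i = j then 1 else 0)" for i j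
    using assms(4) by (auto simp: d_def unit_tangent_inner inner_commute)
  have C2: "Ck 2 U f" by (rule Ck_mono[OF assms(1,3)]) simp
  let ?G = "gnom f x d"
  have "Ck 4 UNIV ?G" by (rule gnom_Ck[OF assms(1-3) nx d])
  then have C4': "Ck (Suc (Suc (Suc (Suc 0)))) UNIV ?G"
    by (simp only: numeral_eq_Suc pred_numeral_simps BitM.simps)
  let ?h = "pd (pd ?G ()) ()"
  have j: "jet2 (\<lambda>s. ?h (0 + (0 + s) *\<^sub>R axis () 1)) (?h 0) (pd ?h () 0) (pd (pd ?h ()) () 0)"
    using jet2_pd_line[OF Ck_pd[OF Ck_pd[OF C4']]] by simp
  obtain a b c where J: "jet2 (\<lambda>t. ?h (0 + tan t *\<^sub>R axis () 1) * (1 / cos t * (1 / cos t * (1 / cos t)))) a b c"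
    using jet2_mult[OF jet2_compose[OF j jet2_tan] jet2_mult[OF jet2_sec jet2_mult[OF jet2_sec jet2_sec]]] by blast
  have ev: "\<forall>\<^sub>F t in nhds 0. ?h (0 + tan t *\<^sub>R axis () 1) * (1 / cos t * (1 / cos t * (1 / cos t)))
      = Wq f (gc x (d ()) t) (gc_vel x (d ()) t)"
    using eventually_abs_lt_pi_half
    by eventually_elim (simp only: gnom_hess(2)[OF assms(1,2) C2 nx d])
  from jet2_cong[OF J ev] have K: "jet2 (\<lambda>t. Wq f (gc x p t) (gc_vel x p t)) a b c"
    by (simp add: d_def)
  then have "a = Wq f x p" by (auto simp: jet2_def)
  with K that show ?thesis by blast
qed

section \<open>The tensor \<open>W = \<nabla>\<^sup>2f + f I\<close> on the sphere\<close>

lemma CkS_mono: "CkS k f \<Longrightarrow> j \<le> k \<Longrightarrow> CkS j f"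
  unfolding CkS_def using Ck_mono by blast

definition Wb :: "((real^'m) \<Rightarrow> real) \<Rightarrow> real^'m \<Rightarrow> real^'m \<Rightarrow> real^'m \<Rightarrow> real" where
  "Wb f x X Y = shess f x X Y + f x * (X \<bullet> Y)"

lemma bilinear_Wb: "bilinear (Wb f x)"
  unfolding bilinear_def
proof (intro conjI allI)
  fix Y show "linear (Wb f x Y)"
    by (rule linearI) (simp_all add: Wb_def shess_def inner_add_right algebra_simps sum.distrib sum_distrib_left)
next
  fix Y show "linear (\<lambda>X. Wb f x X Y)"
    by (rule linearI) (simp_all add: Wb_def shess_def inner_add_left algebra_simps sum.distrib sum_distrib_left)
qed

lemma Wb_commute:
  assumes "CkS 2 f" "norm x = 1"
  shows "Wb f x X Y = Wb f x Y X"
proof -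
  obtain U where U: "open U" "sphere 0 1 \<subseteq> U" "Ck 2 U f" using assms(1) by (auto simp: CkS_def)
  have C2: "Ck (Suc (Suc 0)) U f" using U(3) by (simp only: numeral_2_eq_2)
  have x: "x \<in> U" using U(2) assms(2) by auto
  have "(\<Sum>i\<in>UNIV. \<Sum>j\<in>UNIV. X $ i * Y $ j * pd (pd f j) i x) = (\<Sum>j\<in>UNIV. \<Sum>i\<in>UNIV. X $ i * Y $ j * pd (pd f j) i x)"
    by (rule sum.swap)
  also have "\<dots> = (\<Sum>j\<in>UNIV. \<Sum>i\<in>UNIV. Y $ j * X $ i * pd (pd f i) j x)"
    using pd_commute[OF U(1) C2 x] by (simp add: mult.commute)
  finally show ?thesis by (simp add: Wb_def shess_def inner_commute)
qed

lemma Wq_eq_Wb: "unit_tangent x v \<Longrightarrow> Wq f x v = Wb f x v v"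
  by (simp add: Wq_def Wb_def unit_tangent_inner)

lemma frame_unit_tangent: "frame (x::real^'m) e \<Longrightarrow> norm x = 1 \<Longrightarrow> i < CARD('m) - 1 \<Longrightarrow> unit_tangent x (e i)"
  by (auto simp: frame_def unit_tangent_def norm_eq_1)

lemma frame_inner:
  "frame (x::real^'m) e \<Longrightarrow> i < CARD('m) - 1 \<Longrightarrow> j < CARD('m) - 1 \<Longrightarrow> e i \<bullet> e j = (if i = j then 1 else 0)"
  by (auto simp: frame_def)

text \<open>\<open>eig\<close> is a choice of diagonal entries, so the spectral theorem has to show
  first that some choice exists; the frame obtained here then realizes exactly the chosen numbers in
  the chosen order.\<close>

lemma eigenframe:
  fixes x :: "real^'m"
  assumes "CkS 2 f" "norm x = 1"
  obtains e where "frame x e"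
    "\<And>i j. i < CARD('m) - 1 \<Longrightarrow> j < CARD('m) - 1 \<Longrightarrow> Wb f x (e i) (e j) = (if i = j then eig f x i else 0)"
proof -
  obtain e where e: "frame x e"
    "\<And>i j. i < CARD('m) - 1 \<Longrightarrow> j < CARD('m) - 1 \<Longrightarrow> i \<noteq> j \<Longrightarrow> Wb f x (e i) (e j) = 0"
    using spectral_frame[OF bilinear_Wb[of f x] Wb_commute[OF assms], of x] by blast
  let ?P = "\<lambda>lam. \<exists>e. frame x e \<and>
     (\<forall>i<CARD('m) - 1. \<forall>j<CARD('m) - 1. shess f x (e i) (e j) + f x * (e i \<bullet> e j) = (if i = j then lam i else 0))"
  have "?P (\<lambda>i. Wb f x (e i) (e i))"
    using e by (intro exI[of _ e]) (auto simp: Wb_def)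
  then have "?P (eig f x)" unfolding eig_def by (rule someI[of ?P])
  then show ?thesis using that unfolding Wb_def by blast
qed

lemma Wb_frame_expand:
  fixes x :: "real^'m"
  assumes "frame x e" "norm x = 1" "X \<bullet> x = 0" "Y \<bullet> x = 0"
  shows "Wb f x X Y = (\<Sum>i<CARD('m) - 1. \<Sum>j<CARD('m) - 1. (X \<bullet> e i) * (Y \<bullet> e j) * Wb f x (e i) (e j))"
proof -
  let ?n = "CARD('m) - 1"
  have "Wb f x X Y = Wb f x (\<Sum>i<?n. (X \<bullet> e i) *\<^sub>R e i) (\<Sum>j<?n. (Y \<bullet> e j) *\<^sub>R e j)"
    using frame_expand[OF assms(1,2,3)] frame_expand[OF assms(1,2,4)] by simp
  also have "\<dots> = (\<Sum>(i,j)\<in>{..<?n} \<times> {..<?n}. Wb f x ((X \<bullet> e i) *\<^sub>R e i) ((Y \<bullet> e j) *\<^sub>R e j))"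
    by (rule bilinear_sum[OF bilinear_Wb])
  also have "\<dots> = (\<Sum>i<?n. \<Sum>j<?n. (X \<bullet> e i) * (Y \<bullet> e j) * Wb f x (e i) (e j))"
    by (simp add: sum.cartesian_product[symmetric] bilinear_lmul[OF bilinear_Wb] bilinear_rmul[OF bilinear_Wb] mult_ac)
  finally show ?thesis .
qed

lemma Wb_eigen_expand:
  fixes x :: "real^'m"
  assumes "frame x e" "norm x = 1" "X \<bullet> x = 0" "Y \<bullet> x = 0"
    and "\<And>i j. i < CARD('m) - 1 \<Longrightarrow> j < CARD('m) - 1 \<Longrightarrow> Wb f x (e i) (e j) = (if i = j then lam i else 0)"
  shows "Wb f x X Y = (\<Sum>i<CARD('m) - 1. (X \<bullet> e i) * (Y \<bullet> e i) * lam i)"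
proof -
  have "(\<Sum>j<CARD('m) - 1. (X \<bullet> e i) * (Y \<bullet> e j) * Wb f x (e i) (e j)) = (X \<bullet> e i) * (Y \<bullet> e i) * lam i"
    if "i < CARD('m) - 1" for i
  proof -
    have "(\<Sum>j<CARD('m) - 1. (X \<bullet> e i) * (Y \<bullet> e j) * Wb f x (e i) (e j))
        = (\<Sum>j<CARD('m) - 1. if j = i then (X \<bullet> e i) * (Y \<bullet> e i) * lam i else 0)"
      using assms(5)[OF that] by (intro sum.cong) auto
    then show ?thesis using that by simp
  qed
  then show ?thesis unfolding Wb_frame_expand[OF assms(1-4)] by (intro sum.cong) auto
qed

section \<open>Sums over index sets and the supporting form in an arbitrary frame\<close>

lemma finite_Pset [simp]: "finite (Pset n P)"
  by (simp add: Pset_def)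

lemma card_Pset: "card (Pset n P) = n choose P"
  using n_subsets[of "{..<n}" P] by (simp add: Pset_def)

text \<open>The chain rule through Lambda: the weight of the i-th eigenvalue is the total weight of
  the index sets containing i.\<close>

lemma sum_Pset_swap:
  fixes w :: "nat set \<Rightarrow> real"
  shows "(\<Sum>I\<in>Pset n P. w I * (\<Sum>i\<in>I. a i)) = (\<Sum>i<n. (\<Sum>I\<in>Pset n P. if i \<in> I then w I else 0) * a i)"
proof -
  have "(\<Sum>I\<in>Pset n P. w I * (\<Sum>i\<in>I. a i)) = (\<Sum>I\<in>Pset n P. \<Sum>i<n. if i \<in> I then w I * a i else 0)"
  proof (rule sum.cong[OF refl])
    fix I assume "I \<in> Pset n P"
    then have "{..<n} \<inter> I = I" by (auto simp: Pset_def)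
    then have "(\<Sum>i\<in>I. w I * a i) = (\<Sum>i<n. if i \<in> I then w I * a i else 0)"
      using sum.inter_restrict[of "{..<n}" "\<lambda>i. w I * a i" I] by simp
    then show "w I * (\<Sum>i\<in>I. a i) = (\<Sum>i<n. if i \<in> I then w I * a i else 0)"
      by (simp add: sum_distrib_left)
  qed
  also have "\<dots> = (\<Sum>i<n. \<Sum>I\<in>Pset n P. if i \<in> I then w I * a i else 0)" by (rule sum.swap)
  also have "\<dots> = (\<Sum>i<n. (\<Sum>I\<in>Pset n P. if i \<in> I then w I else 0) * a i)"
    unfolding sum_distrib_right by (intro sum.cong refl) auto
  finally show ?thesis .
qed

lemma bij_betw_Pset:
  assumes "bij_betw p {..<n} {..<n}"
  shows "bij_betw (image p) (Pset n P) (Pset n P)"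
proof -
  have inj: "inj_on p {..<n}" and im: "p ` {..<n} = {..<n}" using assms by (auto simp: bij_betw_def)
  have "inj_on (image p) (Pset n P)"
    using inj by (intro inj_onI) (auto simp: Pset_def dest: inj_on_image_eq_iff)
  moreover have "image p ` Pset n P \<subseteq> Pset n P"
    using inj im by (auto simp: Pset_def card_image[OF inj_on_subset[OF inj]])
  ultimately show ?thesis
    by (simp add: bij_betw_def endo_inj_surj)
qed

text \<open>In an arbitrary frame the diagonal of W is a doubly stochastic average of the
  eigenvalues. The rearrangement lemma bounds its weighted sum from below by the one with suitably
  permuted eigenvalues, and the quotient does not see the permutation. Hence weights chosen at one
  point can be used at every other point, in any frame.\<close>

lemma support_at_frame:
  fixes x :: "real^'m" and P k l :: nat
  defines "n \<equiv> CARD('m) - 1"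
  assumes "CkS 2 f" "norm x = 1" "frame x e" "Gamma k (Lam P f x) (Pset n P)"
    and w: "\<And>g. Gamma k g (Pset n P) \<Longrightarrow> quot_root k l g (Pset n P) \<le> (\<Sum>I\<in>Pset n P. w I * g I)"
  shows "quot_root k l (Lam P f x) (Pset n P)
    \<le> (\<Sum>i<n. (\<Sum>I\<in>Pset n P. if i \<in> I then w I else 0) * Wq f x (e i))"
proof -
  define F where "F i = (\<Sum>I\<in>Pset n P. if i \<in> I then w I else 0)" for i
  define lam where "lam = eig f x"
  obtain g where g: "frame x g"
    "\<And>i j. i < n \<Longrightarrow> j < n \<Longrightarrow> Wb f x (g i) (g j) = (if i = j then lam i else 0)"
    using eigenframe[OF assms(2,3)] unfolding n_def lam_def by blast
  have ut: "unit_tangent x (e i)" "unit_tangent x (g i)" if "i < n" for i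
    using frame_unit_tangent[OF assms(4,3)] frame_unit_tangent[OF g(1) assms(3)] that by (auto simp: n_def)
  have We: "Wq f x (e i) = (\<Sum>j<n. (e i \<bullet> g j)\<^sup>2 * lam j)" if "i < n" for i
    using Wb_eigen_expand[OF g(1) assms(3) _ _ g(2)[unfolded n_def], of "e i" "e i"] ut[OF that]
    by (simp add: Wq_eq_Wb n_def unit_tangent_def power2_eq_square)
  obtain \<pi> where \<pi>: "bij_betw \<pi> {..<n} {..<n}"
    "(\<Sum>i<n. F i * lam (\<pi> i)) \<le> (\<Sum>i<n. \<Sum>j<n. (e i \<bullet> g j)\<^sup>2 * (F i * lam j))"
  proof (rule rearrangement)
    show "(\<Sum>j<n. (e i \<bullet> g j)\<^sup>2) = 1" if "i < n" for i
      using frame_norm_sq[OF g(1) assms(3), of "e i"] ut[OF that] by (simp add: n_def unit_tangent_inner)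
    show "(\<Sum>i<n. (e i \<bullet> g j)\<^sup>2) = 1" if "j < n" for j
      using frame_norm_sq[OF assms(4,3), of "g j"] ut[OF that] by (simp add: n_def unit_tangent_inner inner_commute)
  qed auto
  have inj: "inj_on \<pi> I" if "I \<in> Pset n P" for I
    using \<pi>(1) that by (auto simp: bij_betw_def Pset_def intro: inj_on_subset)
  let ?L = "\<lambda>I. Lam P f x (\<pi> ` I)"
  have L: "?L I = (\<Sum>i\<in>I. lam (\<pi> i))" if "I \<in> Pset n P" for I
    unfolding Lam_def lam_def using sum.reindex[OF inj[OF that]] by simp
  have bij: "bij_betw (image \<pi>) (Pset n P) (Pset n P)" by (rule bij_betw_Pset[OF \<pi>(1)])
  have "quot_root k l (Lam P f x) (Pset n P) = quot_root k l ?L (Pset n P)"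
    by (rule quot_root_reindex(1)[OF bij, symmetric])
  also have "\<dots> \<le> (\<Sum>I\<in>Pset n P. w I * ?L I)"
    using quot_root_reindex(2)[OF bij] assms(5) by (intro w) simp
  also have "\<dots> = (\<Sum>I\<in>Pset n P. w I * (\<Sum>i\<in>I. lam (\<pi> i)))"
    using L by (intro sum.cong) auto
  also have "\<dots> = (\<Sum>i<n. F i * lam (\<pi> i))"
    unfolding F_def by (rule sum_Pset_swap)
  also have "\<dots> \<le> (\<Sum>i<n. \<Sum>j<n. (e i \<bullet> g j)\<^sup>2 * (F i * lam j))" by (rule \<pi>(2))
  also have "\<dots> = (\<Sum>i<n. F i * Wq f x (e i))"
    by (intro sum.cong refl) (simp add: We sum_distrib_left mult_ac)
  finally show ?thesis by (simp only: F_def)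
qed

section \<open>Pointwise bounds from the C^2 norm\<close>

lemma continuous_on_shess:
  fixes f :: "real^'m \<Rightarrow> real"
  assumes "CkS 2 f"
  shows "continuous_on (sphere 0 1 \<times> UNIV) (\<lambda>z. shess f (fst z) (fst (snd z)) (snd (snd z)))"
    and "continuous_on (sphere 0 1) f" "continuous_on (sphere 0 1) (sgrad f)"
proof -
  obtain U where U: "open U" "sphere 0 1 \<subseteq> U" "Ck 2 U f" using assms(1) by (auto simp: CkS_def)
  have C2: "Ck (Suc (Suc 0)) U f" using U(3) by (simp only: numeral_2_eq_2)
  have c0: "continuous_on (sphere 0 1) f"
    using Ck_continuous_on[OF U(1) C2] U(2) continuous_on_subset by blast
  have c1: "continuous_on (sphere 0 1) (pd f i)" for i
    using Ck_continuous_on[OF U(1) Ck_pd[OF C2]] U(2) continuous_on_subset by blast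
  have c2: "continuous_on (sphere 0 1) (pd (pd f i) j)" for i j
    using Ck_continuous_on[OF U(1) Ck_pd[OF Ck_pd[OF C2]]] U(2) continuous_on_subset by blast
  have ce: "continuous_on (sphere 0 1) (egrad f)"
    unfolding egrad_def[abs_def] by (intro continuous_on_vec_lambda c1)
  let ?S = "sphere (0::real^'m) 1 \<times> (UNIV :: ((real^'m) \<times> (real^'m)) set)"
  have fst: "continuous_on ?S (\<lambda>z. h (fst z))" if "continuous_on (sphere 0 1) h" for h :: "real^'m \<Rightarrow> 'b::topological_space"
    by (rule continuous_on_compose2[OF that]) (auto intro: continuous_intros)
  show "continuous_on (sphere 0 1 \<times> UNIV) (\<lambda>z. shess f (fst z) (fst (snd z)) (snd (snd z)))"
    unfolding shess_def
    by (intro continuous_intros fst c2 ce)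
  show "continuous_on (sphere 0 1) f" by fact
  show "continuous_on (sphere 0 1) (sgrad f)"
    unfolding sgrad_def[abs_def] by (intro continuous_intros ce)
qed

text \<open>\<open>hnorm\<close> is evaluated in an unspecified frame, so the entries have to be
  bounded in all frames.\<close>

lemma hnorm_le:
  fixes x :: "real^'m"
  assumes "\<And>e i j. frame x e \<Longrightarrow> i < CARD('m) - 1 \<Longrightarrow> j < CARD('m) - 1 \<Longrightarrow> \<bar>shess f x (e i) (e j)\<bar> \<le> K" "0 \<le> K"
  shows "hnorm f x \<le> real (CARD('m) - 1) * K"
proof -
  let ?n = "CARD('m) - 1"
  define e where "e = (SOME e. frame x e)"
  have "\<exists>e. frame x e" using frame_exists[of x] by blast
  then have fr: "frame x e" unfolding e_def by (rule someI_ex)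
  have "(\<Sum>i<?n. \<Sum>j<?n. (shess f x (e i) (e j))\<^sup>2) \<le> (\<Sum>i<?n. \<Sum>j<?n. K\<^sup>2)"
    using assms(1)[OF fr] assms(2) by (intro sum_mono) (auto simp: abs_le_square_iff[symmetric])
  also have "\<dots> = (real ?n * K)\<^sup>2" by (simp only: sum_constant card_lessThan) (simp add: power2_eq_square)
  finally have "sqrt (\<Sum>i<?n. \<Sum>j<?n. (shess f x (e i) (e j))\<^sup>2) \<le> sqrt ((real ?n * K)\<^sup>2)"
    by (rule real_sqrt_le_mono)
  then show ?thesis using assms(2) unfolding hnorm_def e_def[symmetric] Let_def by simp
qed

text \<open>The squared dimension counts the entries in the expansion of p, each bounded by
  \<open>hnorm\<close>. This crude factor avoids comparing \<open>hnorm\<close> in different frames.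
  \<open>Wb\<close> is the form that gets expanded, and the multiple of f is subtracted
  again.\<close>

lemma shess_le_hnorm:
  fixes x :: "real^'m"
  assumes "CkS 2 f" "unit_tangent x p"
  shows "\<bar>shess f x p p\<bar> \<le> (real (CARD('m) - 1))\<^sup>2 * hnorm f x"
proof -
  let ?n = "CARD('m) - 1"
  have x: "norm x = 1" using assms(2) by (simp add: unit_tangent_def)
  define e where "e = (SOME e. frame x e)"
  have "\<exists>e. frame x e" using frame_exists[of x] by blast
  then have fr: "frame x e" unfolding e_def by (rule someI_ex)
  have hn: "hnorm f x = sqrt (\<Sum>i<?n. \<Sum>j<?n. (shess f x (e i) (e j))\<^sup>2)"
    unfolding hnorm_def e_def[symmetric] Let_def ..
  have ent: "\<bar>shess f x (e i) (e j)\<bar> \<le> hnorm f x" if "i < ?n" "j < ?n" for i j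
  proof -
    have "(shess f x (e i) (e j))\<^sup>2 \<le> (\<Sum>j<?n. (shess f x (e i) (e j))\<^sup>2)"
      using that by (intro member_le_sum) auto
    also have "\<dots> \<le> (\<Sum>i<?n. \<Sum>j<?n. (shess f x (e i) (e j))\<^sup>2)"
      using that by (intro member_le_sum[of i _ "\<lambda>i. \<Sum>j<?n. (shess f x (e i) (e j))\<^sup>2"] sum_nonneg) auto
    finally show ?thesis unfolding hn by (simp add: real_le_rsqrt)
  qed
  have px: "p \<bullet> x = 0" "p \<bullet> p = 1" using assms(2) by (auto simp: unit_tangent_inner)
  have pe: "\<bar>p \<bullet> e i\<bar> \<le> 1" if "i < ?n" for i
    using Cauchy_Schwarz_ineq2[of p "e i"] assms(2) frame_unit_tangent[OF fr x that] by (simp add: unit_tangent_def)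
  have "Wb f x p p = (\<Sum>i<?n. \<Sum>j<?n. (p \<bullet> e i) * (p \<bullet> e j) * shess f x (e i) (e j)) + f x * (\<Sum>i<?n. (p \<bullet> e i)\<^sup>2)"
  proof -
    have "(\<Sum>j<?n. (p \<bullet> e i) * (p \<bullet> e j) * Wb f x (e i) (e j))
        = (\<Sum>j<?n. (p \<bullet> e i) * (p \<bullet> e j) * shess f x (e i) (e j)) + f x * (p \<bullet> e i)\<^sup>2" if i: "i < ?n" for i
    proof -
      have "(\<Sum>j<?n. (p \<bullet> e i) * (p \<bullet> e j) * Wb f x (e i) (e j))
         = (\<Sum>j<?n. (p \<bullet> e i) * (p \<bullet> e j) * shess f x (e i) (e j) + (if j = i then f x * (p \<bullet> e i)\<^sup>2 else 0))"
        using frame_inner[OF fr i] by (intro sum.cong) (auto simp: Wb_def algebra_simps power2_eq_square)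
      then show ?thesis using i by (simp add: sum.distrib)
    qed
    then show ?thesis unfolding Wb_frame_expand[OF fr x px(1) px(1)]
      by (simp add: sum.distrib sum_distrib_left cong: sum.cong_simp)
  qed
  then have "shess f x p p = (\<Sum>i<?n. \<Sum>j<?n. (p \<bullet> e i) * (p \<bullet> e j) * shess f x (e i) (e j))"
    using frame_norm_sq[OF fr x px(1)] px by (simp add: Wb_def)
  also have "\<bar>\<dots>\<bar> \<le> (\<Sum>i<?n. \<Sum>j<?n. hnorm f x)"
  proof (rule order_trans[OF sum_abs], rule sum_mono, rule order_trans[OF sum_abs], rule sum_mono)
    fix i j assume "i \<in> {..<?n}" "j \<in> {..<?n}"
    then have ij: "i < ?n" "j < ?n" by auto
    have "\<bar>p \<bullet> e i\<bar> * \<bar>p \<bullet> e j\<bar> * \<bar>shess f x (e i) (e j)\<bar> \<le> 1 * 1 * hnorm f x"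
      using pe[OF ij(1)] pe[OF ij(2)] ent[OF ij] by (intro mult_mono) auto
    then show "\<bar>(p \<bullet> e i) * (p \<bullet> e j) * shess f x (e i) (e j)\<bar> \<le> hnorm f x" by (simp add: abs_mult)
  qed
  finally show ?thesis by (simp add: power2_eq_square)
qed

text \<open>Each supremum is informative only for a set that is bounded above. For
  \<open>hnorm\<close> this cannot come from continuity, as its frame is chosen separately at each
  point; compactness is applied to \<open>shess\<close> on all triples of unit vectors
  instead.\<close>

lemma C2norm_bounds:
  fixes x :: "real^'m"
  assumes "CkS 2 f" "norm x = 1"
  shows "\<bar>f x\<bar> \<le> C2norm f" "norm (sgrad f x) \<le> C2norm f" "hnorm f x \<le> C2norm f"
proof -
  let ?S = "sphere (0::real^'m) 1"
  note c = continuous_on_shess[OF assms(1)]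
  have x: "x \<in> ?S" using assms(2) by simp
  have b1: "bdd_above ((\<lambda>x. \<bar>f x\<bar>) ` ?S)"
    by (intro bounded_imp_bdd_above compact_imp_bounded compact_continuous_image continuous_intros c compact_sphere)
  have b2: "bdd_above ((\<lambda>x. norm (sgrad f x)) ` ?S)"
    by (intro bounded_imp_bdd_above compact_imp_bounded compact_continuous_image continuous_intros c compact_sphere)
  have "bounded ((\<lambda>z. shess f (fst z) (fst (snd z)) (snd (snd z))) ` (?S \<times> ?S \<times> ?S))"
    by (intro compact_imp_bounded compact_continuous_image compact_Times compact_sphere continuous_on_subset[OF c(1)]) auto
  then obtain K where K: "\<And>x X Y. norm x = 1 \<Longrightarrow> norm X = 1 \<Longrightarrow> norm Y = 1 \<Longrightarrow> \<bar>shess f x X Y\<bar> \<le> K"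
    unfolding bounded_iff by fastforce
  have K0: "0 \<le> K" using K[OF assms(2) assms(2) assms(2)] by linarith
  have "hnorm f y \<le> real (CARD('m) - 1) * K" if "y \<in> ?S" for y
    using that frame_unit_tangent[of y] by (intro hnorm_le K K0) (auto simp: unit_tangent_def)
  then have b3: "bdd_above (hnorm f ` ?S)" by (auto intro!: bdd_aboveI)
  have h0: "0 \<le> hnorm f x" by (auto simp: hnorm_def Let_def intro!: real_sqrt_ge_zero sum_nonneg)
  note s = cSUP_upper[OF x b1] cSUP_upper[OF x b2] cSUP_upper[OF x b3]
  show "\<bar>f x\<bar> \<le> C2norm f" "norm (sgrad f x) \<le> C2norm f" "hnorm f x \<le> C2norm f"
    unfolding C2norm_def using s h0 abs_ge_zero[of "f x"] norm_ge_zero[of "sgrad f x"] by linarith+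
qed

lemma smin_attained:
  fixes f :: "real^'m \<Rightarrow> real"
  assumes "CkS 2 f"
  obtains y where "norm y = 1" "smin f = f y" "\<And>x. norm x = 1 \<Longrightarrow> f y \<le> f x"
proof -
  let ?S = "sphere (0::real^'m) 1"
  have "axis undefined 1 \<in> ?S" by simp
  then have ne: "?S \<noteq> {}" by blast
  obtain y where y: "y \<in> ?S" "\<And>x. x \<in> ?S \<Longrightarrow> f y \<le> f x"
    using continuous_attains_inf[OF compact_sphere ne continuous_on_shess(2)[OF assms]] by auto
  have "smin f = f y" unfolding smin_def
    using y by (intro cInf_eq_minimum) auto
  then show ?thesis using that y by auto
qed

section \<open>Great circles and the maximum principle\<close>

lemma gc_jet:
  assumes "CkS 2 f" "unit_tangent x v"
  shows "jet2 (\<lambda>t. f (gc x v t)) (f x) (egrad f x \<bullet> v) (shess f x v v)"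
proof -
  obtain U where U: "open U" "sphere 0 1 \<subseteq> U" "Ck 2 U f" using assms(1) by (auto simp: CkS_def)
  note d = gc_function_deriv[OF U assms(2)]
  from jet2I[OF d(1) d(2)[of 0]] show ?thesis by simp
qed

lemma shess_nonpos_at_max:
  assumes "CkS 2 f" "unit_tangent x v" "\<And>y. norm y = 1 \<Longrightarrow> f y \<le> f x"
  shows "shess f x v v \<le> 0"
proof -
  have "jet2 (\<lambda>t. f x - f (gc x v t)) 0 (0 - egrad f x \<bullet> v) (0 - shess f x v v)"
    using jet2_diff[OF jet2_const[of "f x"] gc_jet[OF assms(1,2)]] by simp
  from jet2_nonneg(2)[OF this, of 1] show ?thesis
    using assms(3) gc_norm[OF assms(2)] by simp
qed

lemma egrad_tangent_le:
  assumes "unit_tangent x v"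
  shows "\<bar>egrad f x \<bullet> v\<bar> \<le> norm (sgrad f x)"
proof -
  have "sgrad f x \<bullet> v = egrad f x \<bullet> v"
    using assms by (simp add: sgrad_def inner_diff_left unit_tangent_inner)
  then show ?thesis
    using Cauchy_Schwarz_ineq2[of "sgrad f x" v] assms by (simp add: unit_tangent_def)
qed

text \<open>The maximum over one closed period is a maximum over the whole line, so the derivative
  vanishes even if it is attained at an endpoint of the period.\<close>

lemma periodic_deriv_zero:
  fixes Z :: "real \<Rightarrow> real"
  assumes "\<And>t. (Z has_real_derivative Z' t) (at t)" "\<And>t. Z (t + 2 * pi) = Z t"
  obtains t where "Z' t = 0" "\<And>s. Z s \<le> Z t"
proof -
  have c: "continuous_on {0..2 * pi} Z"
    using assms(1) by (intro continuous_at_imp_continuous_on ballI DERIV_isCont) auto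
  obtain t where t: "t \<in> {0..2 * pi}" "\<And>s. s \<in> {0..2 * pi} \<Longrightarrow> Z s \<le> Z t"
    using continuous_attains_sup[OF compact_Icc _ c] by auto
  have per: "Z (s + 2 * pi * of_int k) = Z s" for s k
  proof (induction k rule: int_induct[of _ 0])
    case (step1 i)
    then show ?case using assms(2)[of "s + 2 * pi * of_int i"] by (simp add: algebra_simps)
  next
    case (step2 i)
    then show ?case using assms(2)[of "s + 2 * pi * of_int (i - 1)"] by (simp add: algebra_simps)
  qed simp
  have max: "Z s \<le> Z t" for s
  proof -
    define k where "k = \<lfloor>s / (2 * pi)\<rfloor>"
    have "of_int k \<le> s / (2 * pi)" "s / (2 * pi) < of_int k + 1" unfolding k_def by linarith+
    then have "s + 2 * pi * of_int (- k) \<in> {0..2 * pi}"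
      by (auto simp: field_simps)
    then show ?thesis using t(2) per[of s "- k"] by metis
  qed
  have "Z' t = 0"
    by (rule DERIV_local_max[OF assms(1), of 1]) (use max in auto)
  with max that show ?thesis by blast
qed

lemma log_gradient_bound:
  assumes "CkS 2 u" "\<And>x. norm x = 1 \<Longrightarrow> u x > 0"
    and Q: "\<And>x v. unit_tangent x v \<Longrightarrow> Wq u x v \<le> Q * u x"
    and xv: "unit_tangent x v"
  shows "(egrad u x \<bullet> v / u x)\<^sup>2 \<le> Q - 1"
proof -
  obtain U where U: "open U" "sphere 0 1 \<subseteq> U" "Ck 2 U u" using assms(1) by (auto simp: CkS_def)
  let ?u = "\<lambda>t. u (gc x v t)" and ?u1 = "\<lambda>t. egrad u (gc x v t) \<bullet> gc_vel x v t"
    and ?u2 = "\<lambda>t. shess u (gc x v t) (gc_vel x v t) (gc_vel x v t)"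
  note d = gc_function_deriv[OF U xv]
  have pos: "?u t > 0" for t using assms(2) gc_norm[OF xv] by blast
  define Z where "Z t = ?u1 t / ?u t" for t
  define Z' where "Z' t = ?u2 t / ?u t - (Z t)\<^sup>2" for t
  have dZ: "(Z has_real_derivative Z' t) (at t)" for t
  proof -
    have "((\<lambda>t. ?u1 t / ?u t) has_real_derivative (?u2 t * ?u t - ?u1 t * ?u1 t) / (?u t * ?u t)) (at t)"
      using pos[of t] by (intro DERIV_divide d) auto
    moreover have "(?u2 t * ?u t - ?u1 t * ?u1 t) / (?u t * ?u t) = Z' t"
      using pos[of t] by (simp add: Z'_def Z_def power2_eq_square field_simps)
    ultimately show ?thesis unfolding Z_def[abs_def] by simp
  qed
  have per: "Z (t + 2 * pi) = Z t" for t
    by (simp add: Z_def gc_def gc_vel_def)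
  have le: "Z' t \<le> Q - 1 - (Z t)\<^sup>2" for t
    using Q[OF gc_unit_tangent[OF xv], of t] pos[of t] by (simp add: Wq_def Z'_def field_simps)
  obtain t where t: "Z' t = 0" "\<And>s. Z s \<le> Z t"
    using periodic_deriv_zero[OF dZ per] by blast
  obtain t' where t': "- Z' t' = 0" "\<And>s. - Z s \<le> - Z t'"
    using periodic_deriv_zero[of "\<lambda>t. - Z t" "\<lambda>t. - Z' t"] dZ per by (auto intro: DERIV_minus)
  have b: "(Z t)\<^sup>2 \<le> Q - 1" "(Z t')\<^sup>2 \<le> Q - 1" using le[of t] le[of t'] t t' by auto
  \<comment> \<open>The value at 0 lies between the minimum and the maximum of Z, and the square of
    each is at most Q - 1.\<close>
  have "\<bar>Z 0\<bar> \<le> \<bar>Z t\<bar> \<or> \<bar>Z 0\<bar> \<le> \<bar>Z t'\<bar>" using t(2)[of 0] t'(2)[of 0] by (auto simp: abs_if)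
  then have "(Z 0)\<^sup>2 \<le> Q - 1" using b by (auto simp: abs_le_square_iff)
  then show ?thesis by (simp add: Z_def)
qed

lemma sphere_joined_by_gc:
  fixes x y :: "real^'m"
  assumes "norm x = 1" "norm y = 1" "CARD('m) \<ge> 2"
  obtains v t where "unit_tangent x v" "0 \<le> t" "t \<le> pi" "y = gc x v t"
proof -
  define c where "c = x \<bullet> y"
  have "\<bar>c\<bar> \<le> 1" using Cauchy_Schwarz_ineq2[of x y] assms by (simp add: c_def)
  then have c: "- 1 \<le> c" "c \<le> 1" by auto
  define t where "t = arccos c"
  have t: "0 \<le> t" "t \<le> pi" "cos t = c" "sin t = sqrt (1 - c\<^sup>2)"
    using c by (auto simp: t_def arccos_lbound arccos_ubound sin_arccos)
  define w where "w = y - c *\<^sub>R x"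
  have xx: "x \<bullet> x = 1" "y \<bullet> y = 1" using assms by (auto simp: norm_eq_1)
  have wx: "w \<bullet> x = 0" by (simp add: w_def inner_diff_left xx c_def inner_commute[of y x])
  have ww: "w \<bullet> w = 1 - c\<^sup>2"
    by (simp add: w_def inner_diff_left inner_diff_right xx c_def inner_commute[of y x] power2_eq_square)
  then have nw: "norm w = sin t" by (simp add: t norm_eq_sqrt_inner)
  show ?thesis
  proof (cases "w = 0")
    case True
    \<comment> \<open>Here y is x or - x, and every tangent direction leads to it.\<close>
    obtain e where "frame x e" using frame_exists by blast
    then have "unit_tangent x (e 0)" using frame_unit_tangent[of x e 0] assms by simp
    moreover have "y = gc x (e 0) t" using True nw by (simp add: gc_def w_def t)
    ultimately show ?thesis using that t by blast
  next
    case False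
    let ?v = "(1 / norm w) *\<^sub>R w"
    have "unit_tangent x ?v" using False assms wx by (simp add: unit_tangent_def)
    moreover have "gc x ?v t = c *\<^sub>R x + w" using False by (simp add: gc_def t(3) flip: nw)
    then have "y = gc x ?v t" by (simp add: w_def)
    ultimately show ?thesis using that t by blast
  qed
qed

text \<open>The bound on the logarithmic derivative is integrated along an arc of a great circle,
  whose length is at most pi.\<close>

lemma harnack:
  fixes x y :: "real^'m"
  assumes "CkS 2 u" "\<And>x. norm x = 1 \<Longrightarrow> u x > 0"
    and Q: "\<And>x v. unit_tangent x v \<Longrightarrow> Wq u x v \<le> Q * u x"
    and xy: "norm x = 1" "norm y = 1" "CARD('m) \<ge> 2"
  shows "u y \<le> exp (pi * sqrt Q) * u x"
proof -
  obtain U where U: "open U" "sphere 0 1 \<subseteq> U" "Ck 2 U u" using assms(1) by (auto simp: CkS_def)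
  obtain v t where v: "unit_tangent x v" "0 \<le> t" "t \<le> pi" "y = gc x v t"
    using sphere_joined_by_gc[OF xy] by blast
  have pos: "u (gc x v s) > 0" for s using assms(2) gc_norm[OF v(1)] by blast
  let ?z = "\<lambda>s. egrad u (gc x v s) \<bullet> gc_vel x v s / u (gc x v s)"
  have d: "((\<lambda>s. ln (u (gc x v s))) has_real_derivative ?z s) (at s)" for s
    using DERIV_chain2[OF DERIV_ln_divide[OF pos] gc_function_deriv(1)[OF U v(1)]] by simp
  have z: "?z s \<le> sqrt Q" for s
  proof -
    have "(?z s)\<^sup>2 \<le> Q"
      using log_gradient_bound[OF assms(1-3) gc_unit_tangent[OF v(1)], of s] by simp
    then show ?thesis by (rule real_le_rsqrt)
  qed
  have "0 \<le> Q"
    using log_gradient_bound[OF assms(1-3) v(1)] zero_le_power2[of "egrad u x \<bullet> v / u x"] by linarith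
  then have "0 \<le> sqrt Q" by simp
  have "ln (u (gc x v t)) - ln (u (gc x v 0)) \<le> pi * sqrt Q"
  proof (cases "t = 0")
    case True
    then show ?thesis using \<open>0 \<le> sqrt Q\<close> by simp
  next
    case False
    then have "0 < t" using v(2) by simp
    from MVT2[OF this d] obtain s where "ln (u (gc x v t)) - ln (u (gc x v 0)) = (t - 0) * ?z s" by blast
    also have "\<dots> \<le> t * sqrt Q" using mult_left_mono[OF z[of s] v(2)] by (simp only: diff_zero)
    also have "\<dots> \<le> pi * sqrt Q" using v(3) \<open>0 \<le> sqrt Q\<close> by (intro mult_right_mono)
    finally show ?thesis .
  qed
  then have "ln (u y) \<le> pi * sqrt Q + ln (u x)" using v(4) by simp
  then have "exp (ln (u y)) \<le> exp (pi * sqrt Q + ln (u x))" by simp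
  then show ?thesis using assms(2) xy by (simp add: exp_add)
qed

text \<open>The negative term (1 + s) z^2 is absorbed by the square on the left, and Q on the right
  cancels against one copy of Q on the left. What remains is s Q + 2 Q / \<kappa>, at least (1 + s)
  Q / \<kappa>, against errors of size at most (1 + s) sqrt Q. Dividing by both factors leaves a
  bound free of s.\<close>

lemma quadratic_closing:
  fixes s \<kappa> Q z \<psi>1 \<psi>2 A A' :: real
  assumes "s \<ge> 0" "\<kappa> \<ge> 1" "z\<^sup>2 \<le> Q - 1" "\<bar>\<psi>1\<bar> \<le> A" "\<bar>\<psi>2\<bar> \<le> A'"
    and main: "(1 + s) * (Q - 1 - z\<^sup>2) + \<psi>2 + ((1 + s) * z + \<psi>1)\<^sup>2 \<le> 1 + Q - 2 * (Q / \<kappa>)"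
  shows "Q \<le> (\<kappa> * (2 + A' + 2 * A))\<^sup>2"
proof -
  have Q: "Q \<ge> 1" using assms(3) zero_le_power2[of z] by linarith
  define q where "q = sqrt Q"
  have q: "q \<ge> 1" "q * q = Q" using Q by (auto simp: q_def)
  have zq: "\<bar>z\<bar> \<le> q" unfolding q_def by (rule real_le_rsqrt) (use assms(3) in simp)
  have A: "A \<ge> 0" "A' \<ge> 0" using assms(4,5) by linarith+
  have zp: "- (A * q) \<le> z * \<psi>1"
  proof -
    have "\<bar>z * \<psi>1\<bar> \<le> q * A" unfolding abs_mult using zq assms(4) q by (intro mult_mono) auto
    then show ?thesis by (simp add: abs_le_iff mult.commute)
  qed
  \<comment> \<open>The sign of s enters here: (1 + s)^2 \<ge> 1 + s lets the square dominate the
    negative gradient term.\<close>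
  have sz: "(1 + s) * z\<^sup>2 \<le> (1 + s)\<^sup>2 * z\<^sup>2"
    using assms(1) by (intro mult_right_mono) (auto simp: power2_eq_square algebra_simps)
  have "(1 + s) * (2 * - (A * q)) \<le> (1 + s) * (2 * (z * \<psi>1))"
    using assms(1) zp by (intro mult_left_mono) auto
  have sq: "((1 + s) * z + \<psi>1)\<^sup>2 \<ge> (1 + s) * z\<^sup>2 - (1 + s) * (2 * (A * q))"
  proof -
    have "((1 + s) * z + \<psi>1)\<^sup>2 = (1 + s)\<^sup>2 * z\<^sup>2 + (1 + s) * (2 * (z * \<psi>1)) + \<psi>1\<^sup>2"
      by (simp add: power2_eq_square algebra_simps)
    moreover have "(1 + s) * (2 * - (A * q)) = - ((1 + s) * (2 * (A * q)))" by simp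
    ultimately show ?thesis
      using sz zero_le_power2[of \<psi>1] \<open>(1 + s) * (2 * - (A * q)) \<le> (1 + s) * (2 * (z * \<psi>1))\<close> by linarith
  qed
  have 1: "s * Q + 2 * (Q / \<kappa>) \<le> 2 + s + A' + (1 + s) * (2 * (A * q))"
  proof -
    have "(1 + s) * (Q - 1 - z\<^sup>2) = Q + s * Q - 1 - s - (1 + s) * z\<^sup>2" by (simp add: algebra_simps)
    then show ?thesis using main sq abs_le_D2[OF assms(5)] by linarith
  qed
  have "Q / \<kappa> \<le> Q" using Q assms(2) by (simp add: divide_le_eq mult_left_mono[of 1 \<kappa> Q, simplified])
  then have "s * (Q / \<kappa>) \<le> s * Q" using assms(1) by (rule mult_left_mono)
  moreover have "0 \<le> Q / \<kappa>" using Q assms(2) by simp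
  then have "Q / \<kappa> \<le> 2 * (Q / \<kappa>)" by linarith
  moreover have "(1 + s) * (Q / \<kappa>) = Q / \<kappa> + s * (Q / \<kappa>)"
    by (simp only: distrib_right mult_1_left)
  ultimately have "(1 + s) * (Q / \<kappa>) \<le> 2 + s + A' + (1 + s) * (2 * (A * q))"
    using 1 by linarith
  also have "\<dots> \<le> (1 + s) * ((2 + A' + 2 * A) * q)"
  proof -
    have "2 + A' \<le> (2 + A') * q" using q A by (simp add: mult_left_mono[of 1 q "2 + A'", simplified])
    then have "(1 + s) * (2 + A') \<le> (1 + s) * ((2 + A') * q)" using assms(1) by (intro mult_left_mono) auto
    moreover have "2 + s + A' \<le> (1 + s) * (2 + A')" using assms(1) A by (simp add: algebra_simps)
    ultimately show ?thesis by (simp add: algebra_simps)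
  qed
  finally have "Q / \<kappa> \<le> (2 + A' + 2 * A) * q"
    by (rule mult_left_le_imp_le) (use assms(1) in simp)
  then have "q * q \<le> \<kappa> * (2 + A' + 2 * A) * q"
    using assms(2) q by (simp add: pos_divide_le_eq mult_ac)
  then have "q \<le> \<kappa> * (2 + A' + 2 * A)" using q(1) by simp
  then have "q\<^sup>2 \<le> (\<kappa> * (2 + A' + 2 * A))\<^sup>2" using q(1) by (intro power_mono) auto
  then show ?thesis using q(2) by (simp add: power2_eq_square)
qed

lemma max_ratio_attained:
  fixes u :: "real^'m \<Rightarrow> real"
  assumes "CkS 2 u" "\<And>x. norm x = 1 \<Longrightarrow> u x > 0" "CARD('m) \<ge> 2"
  obtains x v where "unit_tangent x v" "\<And>y w. unit_tangent y w \<Longrightarrow> Wq u y w / u y \<le> Wq u x v / u x"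
proof -
  define T where "T = {z :: (real^'m) \<times> (real^'m). unit_tangent (fst z) (snd z)}"
  have Teq: "T = (sphere 0 1 \<times> sphere 0 1) \<inter> {z. snd z \<bullet> fst z = 0}"
    by (auto simp: T_def unit_tangent_def)
  have cl: "closed {z :: (real^'m) \<times> (real^'m). snd z \<bullet> fst z = 0}"
    by (intro closed_Collect_eq continuous_intros)
  have comp: "compact T" unfolding Teq
    by (intro compact_Int_closed compact_Times compact_sphere cl)
  let ?x = "axis undefined 1 :: real^'m"
  obtain e where "frame ?x e" using frame_exists by blast
  then have "unit_tangent ?x (e 0)" using frame_unit_tangent[of ?x e 0] assms(3) by simp
  then have ne: "T \<noteq> {}" by (auto simp: T_def)
  have cW: "continuous_on T (\<lambda>z. shess u (fst z) (snd z) (snd z))"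
  proof -
    have "continuous_on T (\<lambda>z. (fst z, (snd z, snd z)))" by (intro continuous_intros)
    moreover have "(\<lambda>z. (fst z, (snd z, snd z))) ` T \<subseteq> sphere 0 1 \<times> UNIV" by (auto simp: Teq)
    ultimately show ?thesis
      using continuous_on_compose2[OF continuous_on_shess(1)[OF assms(1)]] by fastforce
  qed
  have cu: "continuous_on T (\<lambda>z. u (fst z))"
    by (rule continuous_on_compose2[OF continuous_on_shess(2)[OF assms(1)]]) (auto simp: Teq intro: continuous_intros)
  have "continuous_on T (\<lambda>z. Wq u (fst z) (snd z) / u (fst z))"
    unfolding Wq_def using assms(2) by (intro continuous_intros cW cu) (force simp: Teq)
  from continuous_attains_sup[OF comp ne this]
  obtain z where "z \<in> T" "\<And>y. y \<in> T \<Longrightarrow> Wq u (fst y) (snd y) / u (fst y) \<le> Wq u (fst z) (snd z) / u (fst z)"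
    by blast
  then show ?thesis using that[of "fst z" "snd z"] by (force simp: T_def)
qed

section \<open>Bound for \<open>W / u\<close>\<close>

text \<open>Parallel transport along the circle in direction e m: the tangent vector becomes the
  velocity, all others stay constant.\<close>

lemma frame_along_gc:
  fixes x :: "real^'m"
  assumes "frame x e" "norm x = 1" "m < CARD('m) - 1"
  shows "frame (gc x (e m) t) (e(m := gc_vel x (e m) t))"
proof -
  have ut: "unit_tangent x (e m)" by (rule frame_unit_tangent[OF assms])
  have v: "gc_vel x (e m) t \<bullet> gc x (e m) t = 0" "gc_vel x (e m) t \<bullet> gc_vel x (e m) t = 1"
    using gc_unit_tangent[OF ut, of t] by (auto simp: unit_tangent_inner)
  have ex: "e i \<bullet> x = 0" "x \<bullet> e i = 0" if "i < CARD('m) - 1" for i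
    using assms(1) that by (auto simp: frame_def inner_commute)
  have g: "e i \<bullet> gc x (e m) t = 0" "e i \<bullet> gc_vel x (e m) t = 0" "gc_vel x (e m) t \<bullet> e i = 0"
    if "i < CARD('m) - 1" "i \<noteq> m" for i
    using ex[OF that(1)] frame_inner[OF assms(1) that(1) assms(3)] frame_inner[OF assms(1) assms(3) that(1)] that(2)
    by (simp_all add: gc_def gc_vel_def inner_add_right inner_diff_right inner_diff_left)
  show ?thesis
    unfolding frame_def using v g frame_inner[OF assms(1)] by auto
qed

lemma Lam_const_le:
  assumes "I \<in> Pset n P" "\<And>i. i < n \<Longrightarrow> eig f x i \<le> c"
  shows "Lam P f x I \<le> real P * c"
proof -
  have "(\<Sum>i\<in>I. eig f x i) \<le> (\<Sum>i\<in>I. c)"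
    using assms by (intro sum_mono) (auto simp: Pset_def)
  then show ?thesis using assms(1) by (simp add: Lam_def Pset_def)
qed

text \<open>At a maximum the Hessian is nonpositive, so every eigenvalue of W is at most
  \<open>u x\<close>. The support is taken at the multiple \<open>u x\<close> of the identity, for
  which Lambda is the constant \<open>u x * real P\<close>. Its nonnegative weights supply the
  monotonicity, and degree one extracts \<open>u x\<close>.\<close>

lemma quot_root_le_at_max:
  fixes x :: "real^'m" and P k l :: nat
  defines "A \<equiv> Pset (CARD('m) - 1) P"
  assumes u: "CkS 2 u" "norm x = 1" "u x > 0" "\<And>y. norm y = 1 \<Longrightarrow> u y \<le> u x"
    and kl: "l < k" "k \<le> card A" "0 < P" and G: "Gamma k (Lam P u x) A"
  shows "quot_root k l (Lam P u x) A \<le> u x * quot_root k l (\<lambda>_. real P) A"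
proof -
  have fin: "finite A" by (simp add: A_def)
  have GP: "Gamma k (\<lambda>_. real P) A" using Gamma_const[OF fin kl(2), of "real P"] kl(3) by simp
  note sc = quot_root_scale[OF fin kl(1) u(3) GP]
  obtain w where w: "\<And>a. a \<in> A \<Longrightarrow> 0 \<le> w a" "\<And>g. Gamma k g A \<Longrightarrow> quot_root k l g A \<le> (\<Sum>a\<in>A. w a * g a)"
    "quot_root k l (\<lambda>_. u x * real P) A = (\<Sum>a\<in>A. w a * (u x * real P))"
    using quot_root_support[OF fin kl(1) sc(2)] by blast
  obtain e where e: "frame x e"
    "\<And>i j. i < CARD('m) - 1 \<Longrightarrow> j < CARD('m) - 1 \<Longrightarrow> Wb u x (e i) (e j) = (if i = j then eig u x i else 0)"
    using eigenframe[OF u(1,2)] by blast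
  have eig: "eig u x i \<le> u x" if i: "i < CARD('m) - 1" for i
  proof -
    have ut: "unit_tangent x (e i)" by (rule frame_unit_tangent[OF e(1) u(2) i])
    then have "eig u x i = shess u x (e i) (e i) + u x"
      using e(2)[OF i i] by (simp add: Wb_def unit_tangent_inner)
    then show ?thesis using shess_nonpos_at_max[OF u(1) ut u(4)] by simp
  qed
  have "quot_root k l (Lam P u x) A \<le> (\<Sum>a\<in>A. w a * Lam P u x a)" by (rule w(2)[OF G])
  also have "\<dots> \<le> (\<Sum>a\<in>A. w a * (u x * real P))"
  proof (intro sum_mono mult_left_mono w(1))
    fix I assume "I \<in> A"
    then show "Lam P u x I \<le> u x * real P"
      using Lam_const_le[of I "CARD('m) - 1" P u x "u x"] eig by (simp add: A_def mult.commute)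
  qed
  also have "\<dots> = u x * quot_root k l (\<lambda>_. real P) A" using w(3) sc(1) by simp
  finally show ?thesis .
qed

text \<open>The equation is assumed in exponential form, so that the second-order jet of its
  right-hand side is assembled from the jets of ln u and ln \<phi>. The number s enters the
  hypotheses but not the resulting bound.\<close>

lemma ratio_bound:
  fixes u \<phi> :: "real^'m \<Rightarrow> real" and P k l :: nat and s m M M' :: real
  defines "n \<equiv> CARD('m) - 1"
  defines "A \<equiv> Pset n P"
  defines "r \<equiv> real (k - l)"
  assumes kl: "l < k" "k \<le> n choose P" "0 < P" "0 < n"
    and u: "CkS 4 u" "\<And>x. norm x = 1 \<Longrightarrow> u x > 0" "\<And>x. norm x = 1 \<Longrightarrow> Gamma k (Lam P u x) A"
    and \<phi>: "CkS 2 \<phi>" "0 < m" "\<And>x. norm x = 1 \<Longrightarrow> m \<le> \<phi> x" "\<And>x. norm x = 1 \<Longrightarrow> \<phi> x \<le> M"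
      "\<And>x v. unit_tangent x v \<Longrightarrow> \<bar>egrad \<phi> x \<bullet> v\<bar> \<le> M" "\<And>x v. unit_tangent x v \<Longrightarrow> \<bar>shess \<phi> x v v\<bar> \<le> M'"
    and s: "0 \<le> s"
    and eqn: "\<And>x. norm x = 1 \<Longrightarrow> quot_root k l (Lam P u x) A = exp ((1 + s) * ln (u x) + ln (\<phi> x) / r)"
  obtains Q where "\<And>x v. unit_tangent x v \<Longrightarrow> Wq u x v \<le> Q * u x"
    "Q \<le> (M / m * (2 + (M' / m + (M / m)\<^sup>2) + 2 * (M / m)))\<^sup>2"
proof -
  have fin: "finite A" by (simp add: A_def)
  have cardA: "k \<le> card A" using kl(2) by (simp add: A_def card_Pset)
  have r: "1 \<le> r" using kl(1) by (simp add: r_def)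
  have u2: "CkS 2 u" using CkS_mono[OF u(1)] by simp
  have c2: "CARD('m) \<ge> 2" using kl(4) by (simp add: n_def)
  obtain U where U: "open U" "sphere 0 1 \<subseteq> U" "Ck 4 U u" using u(1) by (auto simp: CkS_def)
  obtain x v where xv: "unit_tangent x v" "\<And>y w. unit_tangent y w \<Longrightarrow> Wq u y w / u y \<le> Wq u x v / u x"
    using max_ratio_attained[OF u2 u(2) c2] by blast
  define Q where "Q = Wq u x v / u x"
  have x: "norm x = 1" using xv(1) by (simp add: unit_tangent_def)
  have Q: "Wq u y w \<le> Q * u y" if "unit_tangent y w" for y w
    using xv(2)[OF that] u(2)[of y] that by (simp add: Q_def unit_tangent_def pos_divide_le_eq)
  define u0 where "u0 = u x"
  have u0: "u0 > 0" using u(2) x by (simp add: u0_def)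
  have W0: "Wq u x v = Q * u0" using u0 by (simp add: Q_def u0_def)
  obtain e where e: "frame x e" "\<And>i j. i < n \<Longrightarrow> j < n \<Longrightarrow> Wb u x (e i) (e j) = (if i = j then eig u x i else 0)"
    using eigenframe[OF u2 x] unfolding n_def by blast
  define lam where "lam = eig u x"
  have ut: "unit_tangent x (e i)" if "i < n" for i
    using frame_unit_tangent[OF e(1) x] that by (simp add: n_def)
  have We: "Wq u x (e i) = lam i" if "i < n" for i
    using e(2)[OF that that] Wq_eq_Wb[OF ut[OF that]] by (simp add: lam_def)
  have he: "shess u x (e i) (e i) = lam i - u0" if "i < n" for i
    using We[OF that] by (simp add: Wq_def u0_def)
  have "\<exists>p\<in>{..<n}. \<forall>i\<in>{..<n}. lam i \<le> lam p"
  proof -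
    have "Max (lam ` {..<n}) \<in> lam ` {..<n}" using kl(4) by (intro Max_in) auto
    then obtain p where "p < n" "lam p = Max (lam ` {..<n})" by auto
    then show ?thesis by (intro bexI[of _ p]) auto
  qed
  then obtain p where p: "p < n" "\<And>i. i < n \<Longrightarrow> lam i \<le> lam p" by auto
  \<comment> \<open>The maximum of W over unit tangent vectors at x is the top eigenvalue, so e p
    can replace the maximizing vector v.\<close>
  have lamp: "lam p = Q * u0"
  proof (rule antisym)
    show "lam p \<le> Q * u0" using Q[OF ut[OF p(1)]] We[OF p(1)] by (simp add: u0_def)
    have vv: "v \<bullet> x = 0" "v \<bullet> v = 1" using xv(1) by (auto simp: unit_tangent_inner)
    have "Wq u x v = (\<Sum>i<n. (v \<bullet> e i)\<^sup>2 * lam i)"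
      using Wb_eigen_expand[OF e(1) x vv(1) vv(1) e(2)[unfolded n_def]] Wq_eq_Wb[OF xv(1)]
      by (simp add: n_def lam_def power2_eq_square)
    also have "\<dots> \<le> (\<Sum>i<n. (v \<bullet> e i)\<^sup>2 * lam p)"
      using p(2) by (intro sum_mono mult_left_mono) auto
    also have "\<dots> = lam p"
      using frame_norm_sq[OF e(1) x vv(1)] vv(2) by (simp add: sum_distrib_right[symmetric] n_def)
    finally show "Q * u0 \<le> lam p" using W0 by simp
  qed
  let ?f = "\<lambda>x. exp ((1 + s) * ln (u x) + ln (\<phi> x) / r)"
  \<comment> \<open>The weights are fixed at x and used at all points of the circle below;
    \<open>F\<close> collects them per eigenvalue and stands for the diagonal of the derivative
    F'.\<close>
  obtain w where w: "\<And>a. a \<in> A \<Longrightarrow> 0 \<le> w a" "\<And>g. Gamma k g A \<Longrightarrow> quot_root k l g A \<le> (\<Sum>a\<in>A. w a * g a)"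
    "quot_root k l (Lam P u x) A = (\<Sum>a\<in>A. w a * Lam P u x a)"
    using quot_root_support[OF fin kl(1) u(3)[OF x]] by blast
  define F where "F i = (\<Sum>I\<in>A. if i \<in> I then w I else 0)" for i
  have F0: "0 \<le> F i" for i unfolding F_def using w(1) by (intro sum_nonneg) auto
  have Flam: "(\<Sum>i<n. F i * lam i) = ?f x"
    using w(3) eqn[OF x] sum_Pset_swap[of w lam n P] by (simp add: F_def A_def Lam_def lam_def)
  define c0 where "c0 = quot_root k l (\<lambda>_. real P) A"
  have GP: "Gamma k (\<lambda>_. real P) A" using Gamma_const[OF fin cardA] kl(3) by simp
  have c0: "c0 > 0" unfolding c0_def by (rule quot_root_pos[OF GP fin kl(1)])
  \<comment> \<open>The support is tested on Lambda(I), the constant P.\<close>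
  have trF: "c0 \<le> (\<Sum>i<n. F i)"
  proof -
    have "c0 \<le> (\<Sum>I\<in>A. w I * real P)" unfolding c0_def by (rule w(2)[OF GP])
    also have "\<dots> = (\<Sum>I\<in>A. w I * (\<Sum>i\<in>I. 1))"
      by (intro sum.cong refl) (simp add: A_def Pset_def)
    also have "\<dots> = (\<Sum>i<n. F i)"
      unfolding A_def sum_Pset_swap by (simp add: F_def A_def)
    finally show ?thesis .
  qed
  define \<kappa> where "\<kappa> = M / m"
  have mM: "m \<le> M" using \<phi>(3)[OF x] \<phi>(4)[OF x] by simp
  have \<kappa>: "\<kappa> \<ge> 1" using mM \<phi>(2) by (simp add: \<kappa>_def)
  \<comment> \<open>Comparison with constants at a maximum point of \<open>u\<close> bounds \<open>u\<^sup>s\<close> from above, uniformly in \<open>s\<close>.\<close>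
  have fle: "?f x \<le> c0 * \<kappa> * u0"
  proof -
    have ne: "sphere (0::real^'m) 1 \<noteq> {}" using x by force
    obtain y where y: "norm y = 1" "\<And>z. norm z = 1 \<Longrightarrow> u z \<le> u y"
      using continuous_attains_sup[OF compact_sphere ne continuous_on_shess(2)[OF u2]] by auto
    have "?f y \<le> u y * c0"
      using quot_root_le_at_max[OF u2 y(1) u(2)[OF y(1)] y(2) kl(1) _ kl(3)] cardA u(3)[OF y(1)] eqn[OF y(1)]
      by (simp add: A_def n_def c0_def)
    then have "ln (?f y) \<le> ln (u y * c0)" by (intro ln_mono) auto
    then have 1: "(1 + s) * ln (u y) + ln (\<phi> y) / r \<le> ln (u y) + ln c0"
      using u(2)[OF y(1)] c0 by (simp add: ln_mult)
    have 2: "s * ln u0 \<le> s * ln (u y)"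
      using s u0 y(2)[OF x] by (intro mult_left_mono ln_mono) (auto simp: u0_def)
    have 3: "ln (\<phi> x) / r - ln (\<phi> y) / r \<le> ln \<kappa>"
    proof -
      have "ln (\<phi> x) \<le> ln M" "ln m \<le> ln (\<phi> y)"
        using \<phi>(2-4) x y(1) by (auto intro!: ln_mono) (meson less_le_trans)+
      then have "ln (\<phi> x) - ln (\<phi> y) \<le> ln \<kappa>"
        using \<phi>(2) mM by (simp add: \<kappa>_def ln_div)
      then have "(ln (\<phi> x) - ln (\<phi> y)) / r \<le> ln \<kappa> / r" using r by (intro divide_right_mono) auto
      also have "\<dots> \<le> ln \<kappa>" using r ln_ge_zero[OF \<kappa>] by (simp add: divide_le_eq mult_left_mono[of 1 r "ln \<kappa>", simplified])
      finally show ?thesis by (simp add: diff_divide_distrib)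
    qed
    have "(1 + s) * ln (u x) + ln (\<phi> x) / r \<le> ln c0 + ln \<kappa> + ln u0"
      using 1 2 3 by (simp add: algebra_simps u0_def)
    then have "?f x \<le> exp (ln c0 + ln \<kappa> + ln u0)" by simp
    also have "\<dots> = c0 * \<kappa> * u0" using c0 \<kappa> u0 by (simp add: exp_add)
    finally show ?thesis .
  qed
  let ?E = "\<lambda>t. e(p := gc_vel x (e p) t)"
  have utp: "unit_tangent x (e p)" by (rule ut[OF p(1)])
  have ujet: "jet2 (\<lambda>t. u (gc x w t)) u0 (egrad u x \<bullet> w) (shess u x w w)" if "unit_tangent x w" for w
    using gc_jet[OF u2 that] by (simp add: u0_def)
  \<comment> \<open>The nonnegative difference of Q u and W vanishes at x. For i = p it is tested
    along the circle with the velocity as argument. For i other than p it is tested along the circle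
    in direction e i with e p held fixed, and interchanging the derivatives moves the result to W on
    e i along e p. The two cases give the same bound because lam p = Q u0.\<close>
  have "\<exists>q. jet2 (\<lambda>t. Wq u (gc x (e p) t) (?E t i)) (lam i) (fst q) (snd q)
      \<and> snd q \<le> (1 + Q) * lam i - 2 * Q * u0" if i: "i < n" for i
  proof (cases "i = p")
    case True
    obtain b c where j: "jet2 (\<lambda>t. Wq u (gc x (e p) t) (gc_vel x (e p) t)) (Wq u x (e p)) b c"
      using Wq_jet_self[OF U utp] by blast
    have "jet2 (\<lambda>t. Q * u (gc x (e p) t) - Wq u (gc x (e p) t) (gc_vel x (e p) t)) 0
        (Q * (egrad u x \<bullet> e p) - b) (Q * shess u x (e p) (e p) - c)"
      using jet2_diff[OF jet2_cmult[OF ujet[OF utp], of Q] j] We[OF p(1)] lamp by simp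
    from jet2_nonneg(2)[OF this, of 1] have "c \<le> Q * (lam p - u0)"
      using Q[OF gc_unit_tangent[OF utp]] he[OF p(1)] by simp
    then have "c \<le> (1 + Q) * lam p - 2 * Q * u0" using lamp by (simp add: algebra_simps)
    then show ?thesis using j True We[OF p(1)] by (intro exI[of _ "(b, c)"]) auto
  next
    case False
    have ip: "e i \<bullet> e p = 0" using frame_inner[OF e(1)] i p(1) False by (simp add: n_def)
    obtain b b' D where j: "jet2 (\<lambda>t. Wq u (gc x (e p) t) (e i)) (Wq u x (e i)) b (D + Wq u x (e i))"
      "jet2 (\<lambda>t. Wq u (gc x (e i) t) (e p)) (Wq u x (e p)) b' (D + Wq u x (e p))"
      using Wq_jets[OF U utp ut[OF i] ip] by blast
    have "jet2 (\<lambda>t. Q * u (gc x (e i) t) - Wq u (gc x (e i) t) (e p)) 0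
        (Q * (egrad u x \<bullet> e i) - b') (Q * shess u x (e i) (e i) - (D + lam p))"
      using jet2_diff[OF jet2_cmult[OF ujet[OF ut[OF i]], of Q] j(2)] We[OF p(1)] lamp by simp
    from jet2_nonneg(2)[OF this, of 1] have "D + lam p \<le> Q * (lam i - u0)"
      using Q[OF gc_tangent[OF ut[OF i] utp]] ip he[OF i] by (simp add: inner_commute)
    then have "D + lam i \<le> (1 + Q) * lam i - 2 * Q * u0" using lamp by (simp add: algebra_simps)
    then show ?thesis using j(1) False We[OF i] by (intro exI[of _ "(b, D + lam i)"]) auto
  qed
  then have "\<forall>i. \<exists>q. i < n \<longrightarrow> jet2 (\<lambda>t. Wq u (gc x (e p) t) (?E t i)) (lam i) (fst q) (snd q)
      \<and> snd q \<le> (1 + Q) * lam i - 2 * Q * u0" by blast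
  from choice[OF this] obtain q where q: "\<forall>i. i < n \<longrightarrow> jet2 (\<lambda>t. Wq u (gc x (e p) t) (?E t i)) (lam i) (fst (q i)) (snd (q i))
      \<and> snd (q i) \<le> (1 + Q) * lam i - 2 * Q * u0" by blast
  define b c where "b i = fst (q i)" and "c i = snd (q i)" for i
  have bc: "jet2 (\<lambda>t. Wq u (gc x (e p) t) (?E t i)) (lam i) (b i) (c i)"
    "c i \<le> (1 + Q) * lam i - 2 * Q * u0" if "i < n" for i
    using q that by (simp_all only: b_def c_def)
  have Ljet: "jet2 (\<lambda>t. \<Sum>i<n. F i * Wq u (gc x (e p) t) (?E t i)) (?f x) (\<Sum>i<n. F i * b i) (\<Sum>i<n. F i * c i)"
    unfolding Flam[symmetric] using bc(1) by (intro jet2_sum jet2_cmult) auto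
  define z where "z = egrad u x \<bullet> e p / u0"
  define \<phi>0 where "\<phi>0 = \<phi> x"
  have \<phi>0: "m \<le> \<phi>0" "0 < \<phi>0" using \<phi>(2) \<phi>(3)[OF x] by (auto simp: \<phi>0_def)
  define \<psi>1 where "\<psi>1 = (egrad \<phi> x \<bullet> e p / \<phi>0) / r"
  define \<psi>2 where "\<psi>2 = (shess \<phi> x (e p) (e p) / \<phi>0 - (egrad \<phi> x \<bullet> e p / \<phi>0)\<^sup>2) / r"
  have up: "shess u x (e p) (e p) / u0 = Q - 1"
    using he[OF p(1)] lamp u0 by (simp add: field_simps)
  have "jet2 (\<lambda>t. (1 + s) * ln (u (gc x (e p) t)) + (1 / r) * ln (\<phi> (gc x (e p) t)))
      ((1 + s) * ln u0 + (1 / r) * ln \<phi>0) ((1 + s) * z + (1 / r) * (egrad \<phi> x \<bullet> e p / \<phi>0))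
      ((1 + s) * (Q - 1 - z\<^sup>2) + (1 / r) * (shess \<phi> x (e p) (e p) / \<phi>0 - (egrad \<phi> x \<bullet> e p / \<phi>0)\<^sup>2))"
    unfolding z_def up[symmetric] \<phi>0_def
    using u0 \<phi>0 by (intro jet2_add jet2_cmult jet2_ln ujet[OF utp] gc_jet[OF \<phi>(1) utp]) (auto simp: \<phi>0_def)
  then have "jet2 (\<lambda>t. (1 + s) * ln (u (gc x (e p) t)) + ln (\<phi> (gc x (e p) t)) / r)
      ((1 + s) * ln u0 + ln \<phi>0 / r) ((1 + s) * z + \<psi>1) ((1 + s) * (Q - 1 - z\<^sup>2) + \<psi>2)"
    by (simp add: \<psi>1_def \<psi>2_def mult.commute[of r])
  from jet2_exp[OF this]
  have fjet: "jet2 (\<lambda>t. ?f (gc x (e p) t)) (?f x) (?f x * ((1 + s) * z + \<psi>1))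
      (?f x * ((1 + s) * (Q - 1 - z\<^sup>2) + \<psi>2 + ((1 + s) * z + \<psi>1)\<^sup>2))"
    by (simp add: u0_def \<phi>0_def)
  \<comment> \<open>The weighted diagonal of W lies above the right-hand side all along the circle
    and meets it at t = 0, so the second-derivative test applies to the difference.\<close>
  have "?f (gc x (e p) t) \<le> (\<Sum>i<n. F i * Wq u (gc x (e p) t) (?E t i))" for t
  proof -
    have g: "norm (gc x (e p) t) = 1" by (rule gc_norm[OF utp])
    have fr: "frame (gc x (e p) t) (?E t)" by (rule frame_along_gc[OF e(1) x p(1)[unfolded n_def]])
    show ?thesis
      using support_at_frame[OF u2 g fr, of k P l w] u(3)[OF g] w(2) eqn[OF g] by (simp add: A_def n_def F_def)
  qed
  then have "0 \<le> (\<Sum>i<n. F i * c i) - ?f x * ((1 + s) * (Q - 1 - z\<^sup>2) + \<psi>2 + ((1 + s) * z + \<psi>1)\<^sup>2)"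
    by (intro jet2_nonneg(2)[OF jet2_diff[OF Ljet fjet, simplified], of 1]) auto
  also have "(\<Sum>i<n. F i * c i) \<le> (1 + Q) * ?f x - 2 * Q * u0 * c0"
  proof -
    have "(\<Sum>i<n. F i * c i) \<le> (\<Sum>i<n. F i * ((1 + Q) * lam i - 2 * Q * u0))"
      using bc(2) F0 by (intro sum_mono mult_left_mono) auto
    also have "\<dots> = (1 + Q) * (\<Sum>i<n. F i * lam i) - 2 * Q * u0 * (\<Sum>i<n. F i)"
      by (simp add: right_diff_distrib sum_subtractf sum_distrib_left mult_ac)
    also have "\<dots> \<le> (1 + Q) * ?f x - 2 * Q * u0 * c0"
    proof -
      have "0 \<le> Q" using log_gradient_bound[OF u2 u(2) Q utp] zero_le_power2[of "egrad u x \<bullet> e p / u x"] by linarith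
      then have "2 * Q * u0 * c0 \<le> 2 * Q * u0 * (\<Sum>i<n. F i)" using u0 trF by (intro mult_left_mono) auto
      then show ?thesis unfolding Flam by linarith
    qed
    finally show ?thesis .
  qed
  finally have main0: "?f x * ((1 + s) * (Q - 1 - z\<^sup>2) + \<psi>2 + ((1 + s) * z + \<psi>1)\<^sup>2) \<le> (1 + Q) * ?f x - 2 * Q * u0 * c0"
    by simp
  have z2: "z\<^sup>2 \<le> Q - 1" using log_gradient_bound[OF u2 u(2) Q utp] by (simp add: z_def u0_def)
  have Q1: "Q \<ge> 1" using z2 zero_le_power2[of z] by linarith
  \<comment> \<open>The bound \<open>fle\<close> trades u0 c0 for the value of the right-hand side
    over \<kappa>; this value is then a positive common factor and cancels.\<close>
  have "?f x * (2 * (Q / \<kappa>)) \<le> (c0 * \<kappa> * u0) * (2 * (Q / \<kappa>))"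
    using fle Q1 \<kappa> by (intro mult_right_mono) auto
  also have "\<dots> = 2 * Q * u0 * c0" using \<kappa> by (simp add: field_simps)
  finally have "?f x * ((1 + s) * (Q - 1 - z\<^sup>2) + \<psi>2 + ((1 + s) * z + \<psi>1)\<^sup>2) \<le> ?f x * (1 + Q - 2 * (Q / \<kappa>))"
    using main0 by (simp add: algebra_simps)
  then have main: "(1 + s) * (Q - 1 - z\<^sup>2) + \<psi>2 + ((1 + s) * z + \<psi>1)\<^sup>2 \<le> 1 + Q - 2 * (Q / \<kappa>)"
    by (simp only: mult_le_cancel_left_pos[OF exp_gt_zero])
  have dr: "\<bar>a / r\<bar> \<le> \<bar>a\<bar>" for a
    using r divide_left_mono[of 1 r "\<bar>a\<bar>"] by (simp add: abs_divide)
  have q1: "\<bar>egrad \<phi> x \<bullet> e p / \<phi>0\<bar> \<le> M / m"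
    using \<phi>(5)[OF utp] \<phi>(2) \<phi>0 by (auto simp: abs_divide intro!: frac_le)
  have "\<bar>\<psi>1\<bar> \<le> M / m"
  proof -
    have "\<bar>\<psi>1\<bar> \<le> \<bar>egrad \<phi> x \<bullet> e p / \<phi>0\<bar>"
      unfolding \<psi>1_def by (rule dr)
    then show ?thesis using q1 by linarith
  qed
  moreover have "\<bar>\<psi>2\<bar> \<le> M' / m + (M / m)\<^sup>2"
  proof -
    let ?a = "shess \<phi> x (e p) (e p) / \<phi>0" and ?b = "egrad \<phi> x \<bullet> e p / \<phi>0"
    have "\<bar>\<psi>2\<bar> \<le> \<bar>?a - ?b\<^sup>2\<bar>"
      unfolding \<psi>2_def by (rule dr)
    moreover have "\<bar>?a\<bar> \<le> M' / m"
      using \<phi>(6)[OF utp] \<phi>(2) \<phi>0 by (auto simp: abs_divide intro!: frac_le)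
    moreover have "?b\<^sup>2 \<le> (M / m)\<^sup>2" using q1 by (metis abs_ge_zero power2_abs power_mono)
    ultimately show ?thesis using zero_le_power2[of ?b] by linarith
  qed
  ultimately have "Q \<le> (\<kappa> * (2 + (M' / m + (M / m)\<^sup>2) + 2 * (M / m)))\<^sup>2"
    using quadratic_closing[OF s \<kappa> z2 _ _ main] by blast
  then show ?thesis using that Q unfolding \<kappa>_def by blast
qed

section \<open>The Hessian estimate\<close>

text \<open>All eigenvalues are at most T, so every Lambda is at most P T, plus the i-th eigenvalue
  if its index set contains i and that eigenvalue is negative. Summing over the index sets bounds
  the negative eigenvalue from below.\<close>

lemma eig_bound:
  fixes x :: "real^'m" and P k :: nat
  defines "n \<equiv> CARD('m) - 1"
  assumes f: "CkS 2 f" "norm x = 1" and G: "Gamma k (Lam P f x) (Pset n P)" "1 \<le> k" "1 \<le> P" "P \<le> n"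
    and T: "\<And>v. unit_tangent x v \<Longrightarrow> Wq f x v \<le> T" "0 \<le> T" and i: "i < n"
  shows "\<bar>eig f x i\<bar> \<le> real (n choose P) * real P * T"
proof -
  obtain e where e: "frame x e" "\<And>i j. i < n \<Longrightarrow> j < n \<Longrightarrow> Wb f x (e i) (e j) = (if i = j then eig f x i else 0)"
    using eigenframe[OF f] unfolding n_def by blast
  have up: "eig f x j \<le> T" if j: "j < n" for j
  proof -
    have ut: "unit_tangent x (e j)" using frame_unit_tangent[OF e(1) f(2)] j by (simp add: n_def)
    show ?thesis using T(1)[OF ut] Wq_eq_Wb[OF ut, of f] e(2)[OF j j] by simp
  qed
  let ?N = "real (n choose P)"
  have N: "1 \<le> ?N" using G(4) by (simp add: Suc_le_eq zero_less_binomial)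
  have NP: "1 \<le> ?N * real P" using mult_mono[OF N, of 1 "real P"] G(3) N by simp
  have TNP: "T \<le> ?N * real P * T" using mult_right_mono[OF NP T(2)] by simp
  show ?thesis
  proof (cases "0 \<le> eig f x i")
    case True
    then show ?thesis using up[OF i] TNP by simp
  next
    case False
    \<comment> \<open>Positivity of \<open>\<sigma>\<^sub>1\<close> is the only lower bound on the eigenvalues available for \<open>k = 1\<close>.\<close>
    have le: "Lam P f x I \<le> real P * T + (if i \<in> I then eig f x i else 0)" if I: "I \<in> Pset n P" for I
    proof (cases "i \<in> I")
      case True
      have fin: "finite I" using I by (auto simp: Pset_def intro: finite_subset)
      have "Lam P f x I = eig f x i + (\<Sum>j\<in>I - {i}. eig f x j)"
        unfolding Lam_def by (rule sum.remove[OF fin True])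
      also have "(\<Sum>j\<in>I - {i}. eig f x j) \<le> (\<Sum>j\<in>I - {i}. T)"
        using I up by (intro sum_mono) (auto simp: Pset_def)
      also have "\<dots> \<le> (\<Sum>j\<in>I. T)" using fin T(2) by (intro sum_mono2) auto
      also have "\<dots> = real P * T" using I by (simp add: Pset_def)
      finally show ?thesis using True by simp
    next
      case False
      then show ?thesis using Lam_const_le[OF I, of f x T] up by simp
    qed
    \<comment> \<open>One index set containing i is enough: the others contribute further negative
      terms, which are discarded.\<close>
    have "P - 1 \<le> card ({..<n} - {i})" using G(4) i by (simp add: diff_le_mono)
    then obtain I0 where I0: "I0 \<subseteq> {..<n} - {i}" "card I0 = P - 1" "finite I0"
      by (rule obtain_subset_with_card_n)
    have I1: "insert i I0 \<in> Pset n P"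
      using I0 i G(3) by (auto simp: Pset_def card_insert_if)
    have "0 < sigma (Suc 0) (Lam P f x) (Pset n P)" using Gamma_pos[OF G(1)] G(2) by simp
    also have "\<dots> = (\<Sum>I\<in>Pset n P. Lam P f x I)" by (simp add: sigma_1)
    also have "\<dots> \<le> (\<Sum>I\<in>Pset n P. real P * T + (if i \<in> I then eig f x i else 0))"
      by (intro sum_mono le)
    also have "\<dots> = ?N * (real P * T) + (\<Sum>I\<in>Pset n P. if i \<in> I then eig f x i else 0)"
      by (simp add: sum.distrib card_Pset)
    also have "(\<Sum>I\<in>Pset n P. if i \<in> I then eig f x i else 0) \<le> eig f x i"
    proof -
      have "(\<Sum>I\<in>Pset n P. if i \<in> I then eig f x i else 0)
          = eig f x i + (\<Sum>I\<in>Pset n P - {insert i I0}. if i \<in> I then eig f x i else 0)"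
        using sum.remove[OF finite_Pset I1, of "\<lambda>I. if i \<in> I then eig f x i else 0"] by simp
      moreover have "(\<Sum>I\<in>Pset n P - {insert i I0}. if i \<in> I then eig f x i else 0) \<le> 0"
        using False by (intro sum_nonpos) auto
      ultimately show ?thesis by linarith
    qed
    finally show ?thesis using False by (simp add: mult.assoc)
  qed
qed

lemma shess_divide:
  assumes "CkS 2 f" "norm x = 1" "c \<noteq> 0"
  shows "shess (\<lambda>y. f y / c) x X Y = shess f x X Y / c"
proof -
  obtain U where U: "open U" "sphere 0 1 \<subseteq> U" "Ck 2 U f" using assms(1) by (auto simp: CkS_def)
  have C2: "Ck (Suc (Suc 0)) U f" using U(3) by (simp only: numeral_2_eq_2)
  have x: "x \<in> U" using U(2) assms(2) by auto
  have d: "pd (\<lambda>y. g y / c) i y = pd g i y / c" if "Ck (Suc k) U g" "y \<in> U" for g i y k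
    using that by (intro pd_eqI DERIV_cdivide) auto
  have d2: "pd (pd (\<lambda>y. f y / c) j) i x = pd (pd f j) i x / c" for i j
  proof -
    have "pd (pd (\<lambda>y. f y / c) j) i x = pd (\<lambda>y. pd f j y / c) i x"
      by (rule pd_cong[OF U(1) x d[OF C2]])
    then show ?thesis using d[OF Ck_pd[OF C2] x] by simp
  qed
  have "egrad (\<lambda>y. f y / c) x = (1 / c) *\<^sub>R egrad f x"
    using d[OF C2 x] by (simp add: egrad_def vec_eq_iff)
  then show ?thesis
    unfolding shess_def d2 by (simp add: diff_divide_distrib sum_divide_distrib)
qed

theorem theorem5p4:
  fixes n P k l :: nat and m M :: real
  assumes "CARD('m::finite) = n + 1"
    and "n \<ge> 2" and "1 < P" and "P \<le> n - 1"
    and "l < k" and "k \<le> n choose P"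
  shows "\<exists>C>0. \<forall>\<epsilon>::real. \<forall>(u::real^'m \<Rightarrow> real) \<phi>.
     \<epsilon> > 0 \<and> CkS 2 \<phi> \<and> (\<forall>x\<in>sphere 0 1. \<phi> x > 0) \<and>
     CkS 4 u \<and> (\<forall>x\<in>sphere 0 1. u x > 0) \<and> admissible P k u \<and>
     (\<forall>x\<in>sphere 0 1.
        sigma k (Lam P u x) (Pset n P) / sigma l (Lam P u x) (Pset n P) =
        u x powr (real (k + 1 - l) - 1 + \<epsilon>)
        * ((u x)\<^sup>2 + (norm (sgrad u x))\<^sup>2) powr ((real k + 1 - real (k + 1)) / 2)
        * \<phi> x) \<and>
     smin \<phi> = m \<and> C2norm \<phi> = M
     \<longrightarrow> (\<forall>x\<in>sphere 0 1. hnorm (\<lambda>y. u y / smin u) x \<le> C)"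
proof -
  have n: "CARD('m) - 1 = n" "CARD('m) \<ge> 2" using assms(1,2) by auto
  \<comment> \<open>All constants are fixed before u and \<phi>, for arbitrary reals m and M;
    \<open>Qb\<close> is nonnegative simply as a square. \<open>M'\<close> has the factor from
    \<open>shess_le_hnorm\<close>. \<open>B\<close> bounds the Hessian entries relative to u: one
    eigenvalue bound for each of the n terms of the expansion of W, and 1 for the multiple of u
    subtracted from W. \<open>C\<close> adds the Harnack factor and the passage from entries to
    \<open>hnorm\<close>.\<close>
  define M' where "M' = (real n)\<^sup>2 * M"
  define Qb where "Qb = (M / m * (2 + (M' / m + (M / m)\<^sup>2) + 2 * (M / m)))\<^sup>2"
  define B where "B = real n * (real (n choose P) * real P * Qb) + 1"
  define C where "C = real n * (B * exp (pi * sqrt Qb)) + 1"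
  have Qb: "0 \<le> Qb" by (simp add: Qb_def)
  have B: "0 < B" unfolding B_def using Qb by (intro add_nonneg_pos mult_nonneg_nonneg) auto
  have C: "0 < C" unfolding C_def using B by (intro add_nonneg_pos mult_nonneg_nonneg) auto
  have "hnorm (\<lambda>y. u y / smin u) x \<le> C"
    if "\<epsilon> > 0" and \<phi>: "CkS 2 \<phi>" "\<forall>x\<in>sphere 0 1. \<phi> x > 0"
      and u: "CkS 4 u" "\<forall>x\<in>sphere 0 1. u x > 0" "admissible P k u"
      and eq: "\<forall>x\<in>sphere 0 1.
        sigma k (Lam P u x) (Pset n P) / sigma l (Lam P u x) (Pset n P) =
        u x powr (real (k + 1 - l) - 1 + \<epsilon>)
        * ((u x)\<^sup>2 + (norm (sgrad u x))\<^sup>2) powr ((real k + 1 - real (k + 1)) / 2)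
        * \<phi> x"
      and mM: "smin \<phi> = m" "C2norm \<phi> = M" and x: "x \<in> sphere 0 1"
    for \<epsilon> :: real and u \<phi> :: "real^'m \<Rightarrow> real" and x
  proof -
    have x1: "norm x = 1" using x by simp
    have upos: "u y > 0" if "norm y = 1" for y using u(2) that by simp
    have \<phi>pos: "\<phi> y > 0" if "norm y = 1" for y using \<phi>(2) that by simp
    have u2: "CkS 2 u" using CkS_mono[OF u(1)] by simp
    have G: "Gamma k (Lam P u y) (Pset n P)" if "norm y = 1" for y
      using u(3) that n by (simp add: admissible_def)
    obtain y0 where y0: "norm y0 = 1" "smin \<phi> = \<phi> y0" "\<And>x. norm x = 1 \<Longrightarrow> \<phi> y0 \<le> \<phi> x"
      using smin_attained[OF \<phi>(1)] by blast
    have m: "0 < m" "\<And>y. norm y = 1 \<Longrightarrow> m \<le> \<phi> y"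
      using y0 \<phi>pos mM(1) by auto
    define r where "r = real (k - l)"
    have r: "r > 0" "real (k + 1 - l) - 1 = r" using assms(5) by (auto simp: r_def)
    define s where "s = \<epsilon> / r"
    have s: "0 \<le> s" "(1 + s) * r = r + \<epsilon>" using r \<open>\<epsilon> > 0\<close> by (auto simp: s_def field_simps)
    have eqn: "quot_root k l (Lam P u y) (Pset n P) = exp ((1 + s) * ln (u y) + ln (\<phi> y) / r)" if y: "norm y = 1" for y
    proof -
      \<comment> \<open>The gradient factor has exponent 0, and \<open>powr\<close> gives 1 there
        only for a nonzero base.\<close>
      have "(u y)\<^sup>2 + (norm (sgrad u y))\<^sup>2 > 0" using upos[OF y] by (simp add: add_pos_nonneg)
      then have "sigma k (Lam P u y) (Pset n P) / sigma l (Lam P u y) (Pset n P) = u y powr (r + \<epsilon>) * \<phi> y"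
        using eq y r(2) by simp
      also have "\<dots> = exp ((r + \<epsilon>) * ln (u y) + ln (\<phi> y))"
        using upos[OF y] \<phi>pos[OF y] by (simp add: powr_def exp_add)
      finally have "quot_root k l (Lam P u y) (Pset n P) = exp ((r + \<epsilon>) * ln (u y) + ln (\<phi> y)) powr (1 / r)"
        by (simp add: quot_root_def r_def)
      also have "\<dots> = exp (((r + \<epsilon>) * ln (u y) + ln (\<phi> y)) / r)" by (simp add: powr_def)
      also have "((r + \<epsilon>) * ln (u y) + ln (\<phi> y)) / r = (1 + s) * ln (u y) + ln (\<phi> y) / r"
        using r(1) by (simp add: s(2)[symmetric] add_divide_distrib)
      finally show ?thesis .
    qed
    obtain Q where Q: "\<And>x v. unit_tangent x v \<Longrightarrow> Wq u x v \<le> Q * u x" "Q \<le> Qb"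
    proof (rule ratio_bound[of l k P u \<phi> m M M' s])
      show "k \<le> CARD('m) - 1 choose P" "0 < CARD('m) - 1" using assms(2,6) n by auto
      show "\<phi> y \<le> M" if "norm y = 1" for y
        using C2norm_bounds(1)[OF \<phi>(1) that] mM(2) by simp
      show "\<bar>egrad \<phi> y \<bullet> v\<bar> \<le> M" if "unit_tangent y v" for y v
        using egrad_tangent_le[OF that, of \<phi>] C2norm_bounds(2)[OF \<phi>(1), of y] that mM(2)
        by (simp add: unit_tangent_def)
      show "\<bar>shess \<phi> y v v\<bar> \<le> M'" if yv: "unit_tangent y v" for y v
      proof -
        have "\<bar>shess \<phi> y v v\<bar> \<le> (real n)\<^sup>2 * hnorm \<phi> y" using shess_le_hnorm[OF \<phi>(1) yv] unfolding n(1) .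
        also have "\<dots> \<le> (real n)\<^sup>2 * M"
          using C2norm_bounds(3)[OF \<phi>(1), of y] yv mM(2) by (intro mult_left_mono) (auto simp: unit_tangent_def)
        finally show ?thesis by (simp add: M'_def)
      qed
    qed (use assms u upos G \<phi> m s(1) eqn n in \<open>auto simp: Qb_def r_def\<close>)
    have Wle: "Wq u y v \<le> Qb * u y" if yv: "unit_tangent y v" for y v
      using upos[of y] yv
      by (intro order_trans[OF Q(1)[OF yv]] mult_right_mono[OF Q(2)]) (simp add: unit_tangent_def)
    have T0: "0 \<le> Qb * u x" using Qb upos[OF x1] by simp
    define K where "K = real (n choose P) * real P * (Qb * u x)"
    have eig: "\<bar>eig u x i\<bar> \<le> K" if "i < n" for i
      unfolding K_def using eig_bound[OF u2 x1, of k P "Qb * u x" i] G[OF x1] Wle T0 that assms n by simp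
    obtain g where g: "frame x g" "\<And>i j. i < CARD('m) - 1 \<Longrightarrow> j < CARD('m) - 1 \<Longrightarrow> Wb u x (g i) (g j) = (if i = j then eig u x i else 0)"
      using eigenframe[OF u2 x1] by blast
    have sh: "\<bar>shess u x (e i) (e j)\<bar> \<le> B * u x" if e: "frame x e" "i < n" "j < n" for e i j
    proof -
      have ut: "unit_tangent x (e i)" "unit_tangent x (e j)" using frame_unit_tangent[OF e(1) x1] e n by auto
      have le1: "\<bar>X \<bullet> Y\<bar> \<le> 1" if "norm X = 1" "norm Y = 1" for X Y :: "real^'m"
        using Cauchy_Schwarz_ineq2[of X Y] that by simp
      have gn: "norm (g a) = 1" if "a < n" for a
        using frame_unit_tangent[OF g(1) x1, of a] that n by (simp add: unit_tangent_def)
      have "Wb u x (e i) (e j) = (\<Sum>a<n. (e i \<bullet> g a) * (e j \<bullet> g a) * eig u x a)"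
        using Wb_eigen_expand[OF g(1) x1 _ _ g(2)] ut n by (simp add: unit_tangent_def)
      also have "\<bar>\<dots>\<bar> \<le> (\<Sum>a<n. K)"
      proof (rule order_trans[OF sum_abs], rule sum_mono)
        fix a assume "a \<in> {..<n}"
        then have "\<bar>e i \<bullet> g a\<bar> * \<bar>e j \<bullet> g a\<bar> * \<bar>eig u x a\<bar> \<le> 1 * 1 * K"
          using le1 gn ut eig by (intro mult_mono) (auto simp: unit_tangent_def)
        then show "\<bar>(e i \<bullet> g a) * (e j \<bullet> g a) * eig u x a\<bar> \<le> K" by (simp add: abs_mult)
      qed
      finally have W: "\<bar>Wb u x (e i) (e j)\<bar> \<le> real n * K" by simp
      have "\<bar>u x * (e i \<bullet> e j)\<bar> \<le> u x"
        using le1[of "e i" "e j"] ut upos[OF x1] by (simp add: abs_mult unit_tangent_def)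
      moreover have "B * u x = real n * K + u x" by (simp add: B_def K_def algebra_simps)
      ultimately show ?thesis using W unfolding Wb_def by linarith
    qed
    obtain y where y: "norm y = 1" "smin u = u y" using smin_attained[OF u2] by metis
    have har: "u x \<le> exp (pi * sqrt Qb) * u y" by (rule harnack[OF u2 upos Wle y(1) x1 n(2)])
    have "hnorm (\<lambda>z. u z / u y) x \<le> real (CARD('m) - 1) * (B * exp (pi * sqrt Qb))"
    proof (rule hnorm_le)
      fix e i j assume e: "frame x e" "i < CARD('m) - 1" "j < CARD('m) - 1"
      have "\<bar>shess (\<lambda>z. u z / u y) x (e i) (e j)\<bar> = \<bar>shess u x (e i) (e j)\<bar> / u y"
        using shess_divide[OF u2 x1, of "u y"] upos[OF y(1)] by simp
      also have "\<dots> \<le> B * u x / u y"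
        using sh[OF e(1)] e n upos[OF y(1)] by (intro divide_right_mono) auto
      also have "\<dots> \<le> B * exp (pi * sqrt Qb)"
        using mult_left_mono[OF har, of B] B upos[OF y(1)] by (simp add: pos_divide_le_eq mult.assoc)
      finally show "\<bar>shess (\<lambda>z. u z / u y) x (e i) (e j)\<bar> \<le> B * exp (pi * sqrt Qb)" .
    qed (use B in simp)
    then show ?thesis unfolding n(1) C_def y(2) by simp
  qed
  then show ?thesis using C by blast
qed

end
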